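(* Let $R$ be a ring and $R^{\mathrm e}=R\otimes_{\mathbb Z}R^{\mathrm{op}}$. The $n$-ary restricted tensor products $A\times_RB\times_R\cdots\times_RZ$, the unit $\mathrm{End}(R)$, the associators and the unitors described in the context form a (strictly normal) lax monoidal structure $\{\times_R^n\}_{n\ge-1}$ on the category of $(R^{\mathrm e},R^{\mathrm e})$-bimodules.
   Context: **Lax monoidal category.** A category $\mathcal V$ with functors $\lambda^n:\mathcal V^{n+1}\to\mathcal V$ ($n\ge-1$), natural transformations $\lambda^p(-,\lambda^q,-)\to\lambda^{p+q}$ for $p\ge0,q\ge-1$ and each of the $p+1$ insertion positions, and a unit $\mathrm{Id}\to\lambda^0$, such that (whenever they make sense): $\lambda^p\to\lambda^0\lambda^p\to\lambda^p$ and $\lambda^p\to\lambda^p(-,\lambda^0,-)\to\lambda^p$ are identities; the two composites $\lambda^p(-,\lambda^q,-,\lambda^r,-)\to\lambda^{p+q+r}$ (composing the two insertions in either order) agree; the two composites $\lambda^p(-,\lambda^q(-,\lambda^r,-),-)\to\lambda^{p+q+r}$ (through $\lambda^{p+q}(-,\lambda^r,-)$ and through $\lambda^p(-,\lambda^{q+r},-)$) agree. It is strictly normal if $\lambda^0=\mathrm{Id}$ and the unit and all structure transformations $\lambda^0\lambda^p\to\lambda^p$, $\lambda^p(-,\lambda^0,-)\to\lambda^p$ are identities. **Bimodules.** An $(R^{\mathrm e},R^{\mathrm e})$-bimodule $M$ carries commuting left actions of $r\in R$ and $\bar r\in R^{\mathrm{op}}$ and right actions of $s\in R$, $\bar s\in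 R^{\mathrm{op}}$. **$n$-ary products.** For bimodules $M^{(0)},\dots,M^{(n)}$ ($n\ge0$), let $M^{(0)}\otimes_R\cdots\otimes_RM^{(n)}$ be the quotient of the tensor product of abelian groups by the relations $\cdots\otimes\bar r\,m^{(j)}\otimes m^{(j+1)}\otimes\cdots=\cdots\otimes m^{(j)}\otimes r\,m^{(j+1)}\otimes\cdots$ for all $r\in R$, $0\le j<n$. Then $\times_R^n(M^{(0)},\dots,M^{(n)})=M^{(0)}\times_R\cdots\times_RM^{(n)}$ is the subgroup of those $\sum_i m_i^{(0)}\otimes\cdots\otimes m_i^{(n)}$ such that for all $s\in R$, $0\le j<n$: $\sum_i\cdots\otimes m_i^{(j)}\bar s\otimes m_i^{(j+1)}\otimes\cdots=\sum_i\cdots\otimes m_i^{(j)}\otimes m_i^{(j+1)}s\otimes\cdots$. Its $(R^{\mathrm e},R^{\mathrm e})$-bimodule structure is $(r,s)\cdot(m^{(0)}\otimes\cdots\otimes m^{(n)})\cdot(r',s')=(r\,m^{(0)}r')\otimes\cdots\otimes(\bar s\,m^{(n)}\bar s')$ (for $n=0$ it is $M^{(0)}$ itself). **Unit.** $\times_R^{-1}=\mathrm{End}(R):=\mathrm{Hom}_{\mathbb Z}(R,R)$ with $[(r,r')\cdot f\cdot(s,s')](m)=r\,f(s\,m\,s')\,r'$. **Associators.** For $q\ge0$, $\times^p_R(-,\times^q_R,-)\to\times^{p+q}_R$ is induced by the inclusion of the inner product $M\times_R\cdots\times_RN$ in $M\otimes_R\cdots\otimes_RN$, i.e. $\cdots\otimes(m\otimes\cdots\otimes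 n)\otimes\cdots\mapsto\cdots\otimes m\otimes\cdots\otimes n\otimes\cdots$. **Unitors** ($q=-1$). For $p\geq 1$: insertion of $\mathrm{End}(R)$ in the first position: $\sum_i\phi_i\otimes a_i\otimes\cdots\mapsto\sum_i\phi_i(1_R)\cdot a_i\otimes\cdots$; in the last position: $\sum_i\cdots\otimes z_i\otimes\phi_i\mapsto\sum_i\cdots\otimes\overline{\phi_i(1_R)}\cdot z_i$; in a middle position: $\sum_i\cdots\otimes m_i\otimes\phi_i\otimes n_i\otimes\cdots\mapsto\sum_i\cdots\otimes m_i\otimes(\phi_i(1_R)\cdot n_i)\otimes\cdots=\sum_i\cdots\otimes(\overline{\phi_i(1_R)}\cdot m_i)\otimes n_i\otimes\cdots$. *)

theory Defs
  imports "HOL-Algebra.Free_Abelian_Groups" "HOL-Algebra.Generated_Groups" "HOL-Algebra.Ring"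
begin

section \<open>Categories and lax monoidal structures\<close>

record ('o, 'm) category =
  Obj :: "'o set"
  Mor :: "'m set"
  Dom :: "'m \<Rightarrow> 'o"
  Cod :: "'m \<Rightarrow> 'o"
  Ident :: "'o \<Rightarrow> 'm"
  Comp :: "'m \<Rightarrow> 'm \<Rightarrow> 'm"  \<comment> \<open>\<open>Comp C g f\<close> is ``first \<open>f\<close>, then \<open>g\<close>''\<close>

definition Hom :: "('o, 'm) category \<Rightarrow> 'o \<Rightarrow> 'o \<Rightarrow> 'm set" where
  "Hom C x y = {f \<in> Mor C. Dom C f = x \<and> Cod C f = y}"

locale category =
  fixes C :: "('o, 'm) category"
  assumes dom_obj: "f \<in> Mor C \<Longrightarrow> Dom C f \<in> Obj C"
    and cod_obj: "f \<in> Mor C \<Longrightarrow> Cod C f \<in> Obj C"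
    and ident_hom: "x \<in> Obj C \<Longrightarrow> Ident C x \<in> Hom C x x"
    and comp_hom: "\<lbrakk>f \<in> Hom C x y; g \<in> Hom C y z\<rbrakk> \<Longrightarrow> Comp C g f \<in> Hom C x z"
    and comp_ident_left: "f \<in> Hom C x y \<Longrightarrow> Comp C (Ident C y) f = f"
    and comp_ident_right: "f \<in> Hom C x y \<Longrightarrow> Comp C f (Ident C x) = f"
    and comp_assoc: "\<lbrakk>f \<in> Hom C w x; g \<in> Hom C x y; h \<in> Hom C y z\<rbrakk>
          \<Longrightarrow> Comp C h (Comp C g f) = Comp C (Comp C h g) f"

locale category_functor = S: category S + T: category T
  for S :: "('o, 'm) category" and T :: "('p, 'n) category" +
  fixes FO :: "'o \<Rightarrow> 'p" and FM :: "'m \<Rightarrow> 'n"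
  assumes map_obj: "x \<in> Obj S \<Longrightarrow> FO x \<in> Obj T"
    and map_hom: "f \<in> Hom S x y \<Longrightarrow> FM f \<in> Hom T (FO x) (FO y)"
    and map_ident: "x \<in> Obj S \<Longrightarrow> FM (Ident S x) = Ident T (FO x)"
    and map_comp: "\<lbrakk>f \<in> Hom S x y; g \<in> Hom S y z\<rbrakk> \<Longrightarrow> FM (Comp S g f) = Comp T (FM g) (FM f)"

definition power_category :: "('o, 'm) category \<Rightarrow> nat \<Rightarrow> ('o list, 'm list) category" where
  "power_category C n =
    \<lparr>Obj = {xs. length xs = n \<and> set xs \<subseteq> Obj C},
     Mor = {fs. length fs = n \<and> set fs \<subseteq> Mor C},
     Dom = map (Dom C), Cod = map (Cod C), Ident = map (Ident C), Comp = map2 (Comp C)\<rparr>"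

text \<open>
  The functors \<open>\<lambda>\<^sup>n : V\<^sup>n\<^sup>+\<^sup>1 \<rightarrow> V\<close>, \<open>n \<ge> -1\<close>, are bundled into one pair of functions on lists, of
  objects (\<open>lamO\<close>) and of morphisms (\<open>lamM\<close>): \<open>\<lambda>\<^sup>n\<close> is the restriction to lists of length \<open>n + 1\<close>, and
  \<open>\<lambda>\<^sup>-\<^sup>1\<close> is the value at the empty list.  The component of \<open>\<lambda>\<^sup>p(-, \<lambda>\<^sup>q, -) \<rightarrow> \<lambda>\<^sup>p\<^sup>+\<^sup>q\<close> with outer arguments
  \<open>xs\<close>, \<open>zs\<close> and inner arguments \<open>ys\<close> is \<open>gam xs ys zs\<close>; so \<open>p = length xs + length zs\<close>,
  \<open>q = length ys - 1\<close>, and the insertion position is \<open>length xs\<close>.  The unit is \<open>eta\<close>.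
\<close>

locale lax_monoidal_category = category C
  for C :: "('o, 'm) category" +
  fixes lamO :: "'o list \<Rightarrow> 'o"
    and lamM :: "'m list \<Rightarrow> 'm"
    and gam :: "'o list \<Rightarrow> 'o list \<Rightarrow> 'o list \<Rightarrow> 'm"
    and eta :: "'o \<Rightarrow> 'm"
  assumes lam_functor: "category_functor (power_category C n) C lamO lamM"
    and gam_hom: "set (xs @ ys @ zs) \<subseteq> Obj C
      \<Longrightarrow> gam xs ys zs \<in> Hom C (lamO (xs @ [lamO ys] @ zs)) (lamO (xs @ ys @ zs))"
    and gam_natural: "set (fs @ gs @ hs) \<subseteq> Mor C
      \<Longrightarrow> Comp C (gam (map (Cod C) fs) (map (Cod C) gs) (map (Cod C) hs)) (lamM (fs @ [lamM gs] @ hs))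
        = Comp C (lamM (fs @ gs @ hs)) (gam (map (Dom C) fs) (map (Dom C) gs) (map (Dom C) hs))"
    and eta_hom: "x \<in> Obj C \<Longrightarrow> eta x \<in> Hom C x (lamO [x])"
    and eta_natural: "f \<in> Mor C
      \<Longrightarrow> Comp C (eta (Cod C f)) f = Comp C (lamM [f]) (eta (Dom C f))"
    and unit_outer: "set xs \<subseteq> Obj C
      \<Longrightarrow> Comp C (gam [] xs []) (eta (lamO xs)) = Ident C (lamO xs)"
    and unit_inner: "set (xs @ [y] @ zs) \<subseteq> Obj C
      \<Longrightarrow> Comp C (gam xs [y] zs) (lamM (map (Ident C) xs @ [eta y] @ map (Ident C) zs))
        = Ident C (lamO (xs @ [y] @ zs))"
    and assoc_parallel: "set (xs @ ys @ zs @ ws @ vs) \<subseteq> Obj C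
      \<Longrightarrow> Comp C (gam (xs @ ys @ zs) ws vs) (gam xs ys (zs @ [lamO ws] @ vs))
        = Comp C (gam xs ys (zs @ ws @ vs)) (gam (xs @ [lamO ys] @ zs) ws vs)"
    and assoc_nested: "set (xs @ ys @ zs @ ws @ vs) \<subseteq> Obj C
      \<Longrightarrow> Comp C (gam (xs @ ys) zs (ws @ vs)) (gam xs (ys @ [lamO zs] @ ws) vs)
        = Comp C (gam xs (ys @ zs @ ws) vs)
            (lamM (map (Ident C) xs @ [gam ys zs ws] @ map (Ident C) vs))"

locale strictly_normal_lax_monoidal_category = lax_monoidal_category +
  assumes lam0_obj: "x \<in> Obj C \<Longrightarrow> lamO [x] = x"
    and lam0_mor: "f \<in> Mor C \<Longrightarrow> lamM [f] = f"
    and eta_ident: "x \<in> Obj C \<Longrightarrow> eta x = Ident C x"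
    and gam_outer_ident: "set xs \<subseteq> Obj C \<Longrightarrow> gam [] xs [] = Ident C (lamO xs)"
    and gam_inner_ident: "set (xs @ [y] @ zs) \<subseteq> Obj C
      \<Longrightarrow> gam xs [y] zs = Ident C (lamO (xs @ [y] @ zs))"


section \<open>Bimodules over the enveloping ring\<close>

definition op_ring :: "('r, 'k) ring_scheme \<Rightarrow> ('r, 'k) ring_scheme" where
  "op_ring R = R\<lparr>mult := \<lambda>x y. y \<otimes>\<^bsub>R\<^esub> x\<rparr>"

locale left_action =
  fixes R :: "('r, 'k) ring_scheme" and M :: "('u, 'l) ring_scheme" and act :: "'r \<Rightarrow> 'u \<Rightarrow> 'u"
  assumes act_closed: "\<lbrakk>r \<in> carrier R; m \<in> carrier M\<rbrakk> \<Longrightarrow> act r m \<in> carrier M"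
    and act_add: "\<lbrakk>r \<in> carrier R; m \<in> carrier M; n \<in> carrier M\<rbrakk>
          \<Longrightarrow> act r (m \<oplus>\<^bsub>M\<^esub> n) = act r m \<oplus>\<^bsub>M\<^esub> act r n"
    and add_act: "\<lbrakk>r \<in> carrier R; s \<in> carrier R; m \<in> carrier M\<rbrakk>
          \<Longrightarrow> act (r \<oplus>\<^bsub>R\<^esub> s) m = act r m \<oplus>\<^bsub>M\<^esub> act s m"
    and mult_act: "\<lbrakk>r \<in> carrier R; s \<in> carrier R; m \<in> carrier M\<rbrakk>
          \<Longrightarrow> act (r \<otimes>\<^bsub>R\<^esub> s) m = act r (act s m)"
    and one_act: "m \<in> carrier M \<Longrightarrow> act \<one>\<^bsub>R\<^esub> m = m"

locale right_action =
  fixes R :: "('r, 'k) ring_scheme" and M :: "('u, 'l) ring_scheme" and act :: "'u \<Rightarrow> 'r \<Rightarrow> 'u"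
  assumes act_closed: "\<lbrakk>r \<in> carrier R; m \<in> carrier M\<rbrakk> \<Longrightarrow> act m r \<in> carrier M"
    and act_add: "\<lbrakk>r \<in> carrier R; m \<in> carrier M; n \<in> carrier M\<rbrakk>
          \<Longrightarrow> act (m \<oplus>\<^bsub>M\<^esub> n) r = act m r \<oplus>\<^bsub>M\<^esub> act n r"
    and add_act: "\<lbrakk>r \<in> carrier R; s \<in> carrier R; m \<in> carrier M\<rbrakk>
          \<Longrightarrow> act m (r \<oplus>\<^bsub>R\<^esub> s) = act m r \<oplus>\<^bsub>M\<^esub> act m s"
    and mult_act: "\<lbrakk>r \<in> carrier R; s \<in> carrier R; m \<in> carrier M\<rbrakk>
          \<Longrightarrow> act m (r \<otimes>\<^bsub>R\<^esub> s) = act (act m r) s"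
    and one_act: "m \<in> carrier M \<Longrightarrow> act m \<one>\<^bsub>R\<^esub> = m"

text \<open>
  A bimodule is an additive group with four actions:
  \<open>lact M r m\<close> is \<open>r m\<close>, \<open>lbar M r m\<close> is \<open>r\<^sup>- m\<close>, \<open>ract M m s\<close> is \<open>m s\<close>, and \<open>rbar M m s\<close> is \<open>m s\<^sup>-\<close>,
  where \<open>r\<^sup>-\<close> is \<open>r\<close> regarded as an element of the opposite ring.
  As for modules in HOL-Algebra, the multiplicative fields inherited from \<open>ring\<close> are not used.
\<close>

record ('r, 'u) bimod = "'u ring" +
  lact :: "'r \<Rightarrow> 'u \<Rightarrow> 'u"
  lbar :: "'r \<Rightarrow> 'u \<Rightarrow> 'u"
  ract :: "'u \<Rightarrow> 'r \<Rightarrow> 'u"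
  rbar :: "'u \<Rightarrow> 'r \<Rightarrow> 'u"

locale env_bimodule = ring R + M: abelian_group M
  + lact: left_action R M "lact M" + lbar: left_action "op_ring R" M "lbar M"
  + ract: right_action R M "ract M" + rbar: right_action "op_ring R" M "rbar M"
  for R :: "('r, 'k) ring_scheme" and M :: "('r, 'u) bimod" +
  assumes lact_lbar: "\<lbrakk>r \<in> carrier R; s \<in> carrier R; m \<in> carrier M\<rbrakk>
      \<Longrightarrow> lact M r (lbar M s m) = lbar M s (lact M r m)"
    and ract_rbar: "\<lbrakk>r \<in> carrier R; s \<in> carrier R; m \<in> carrier M\<rbrakk>
      \<Longrightarrow> ract M (rbar M m s) r = rbar M (ract M m r) s"
    and lact_ract: "\<lbrakk>r \<in> carrier R; s \<in> carrier R; m \<in> carrier M\<rbrakk>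
      \<Longrightarrow> lact M r (ract M m s) = ract M (lact M r m) s"
    and lact_rbar: "\<lbrakk>r \<in> carrier R; s \<in> carrier R; m \<in> carrier M\<rbrakk>
      \<Longrightarrow> lact M r (rbar M m s) = rbar M (lact M r m) s"
    and lbar_ract: "\<lbrakk>r \<in> carrier R; s \<in> carrier R; m \<in> carrier M\<rbrakk>
      \<Longrightarrow> lbar M r (ract M m s) = ract M (lbar M r m) s"
    and lbar_rbar: "\<lbrakk>r \<in> carrier R; s \<in> carrier R; m \<in> carrier M\<rbrakk>
      \<Longrightarrow> lbar M r (rbar M m s) = rbar M (lbar M r m) s"

definition bimod_maps ::
    "('r, 'k) ring_scheme \<Rightarrow> ('r, 'u) bimod \<Rightarrow> ('r, 'u) bimod \<Rightarrow> ('u \<Rightarrow> 'u) set" where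
  "bimod_maps R M N = {f \<in> carrier M \<rightarrow>\<^sub>E carrier N.
     (\<forall>m\<in>carrier M. \<forall>n\<in>carrier M. f (m \<oplus>\<^bsub>M\<^esub> n) = f m \<oplus>\<^bsub>N\<^esub> f n) \<and>
     (\<forall>r\<in>carrier R. \<forall>m\<in>carrier M.
        f (lact M r m) = lact N r (f m) \<and> f (lbar M r m) = lbar N r (f m) \<and>
        f (ract M m r) = ract N (f m) r \<and> f (rbar M m r) = rbar N (f m) r)}"

datatype ('r, 'u) bimod_mor =
  BMor (src: "('r, 'u) bimod") (tgt: "('r, 'u) bimod") (fn: "'u \<Rightarrow> 'u")

definition bimod_category ::
    "('r, 'k) ring_scheme \<Rightarrow> (('r, 'u) bimod, ('r, 'u) bimod_mor) category" where
  "bimod_category R =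
    \<lparr>Obj = {M. env_bimodule R M},
     Mor = {F. env_bimodule R (src F) \<and> env_bimodule R (tgt F) \<and> fn F \<in> bimod_maps R (src F) (tgt F)},
     Dom = src, Cod = tgt,
     Ident = (\<lambda>M. BMor M M (\<lambda>m\<in>carrier M. m)),
     Comp = (\<lambda>G F. BMor (src F) (tgt G) (compose (carrier (src F)) (fn G) (fn F)))\<rparr>"


section \<open>Tensor products over R\<close>

text \<open>
  \<open>M\<^sup>(\<^sup>0\<^sup>) \<otimes>\<^sub>R \<cdots> \<otimes>\<^sub>R M\<^sup>(\<^sup>n\<^sup>)\<close> is the free abelian group on the tuples \<open>[m\<^sub>0, ..., m\<^sub>n]\<close> modulo additivity in each
  entry and the balancing relations.  Following \<open>free_Abelian_group\<close>, the group \<open>tensor R Ms\<close> is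
  written multiplicatively.
\<close>

definition tuples :: "('r, 'u) bimod list \<Rightarrow> 'u list set" where
  "tuples Ms = listset (map carrier Ms)"

definition tensor_relations ::
    "('r, 'k) ring_scheme \<Rightarrow> ('r, 'u) bimod list \<Rightarrow> ('u list \<Rightarrow>\<^sub>0 int) set" where
  "tensor_relations R Ms =
     {frag_of (t[j := x \<oplus>\<^bsub>Ms ! j\<^esub> y]) - frag_of (t[j := x]) - frag_of (t[j := y]) | t j x y.
        t \<in> tuples Ms \<and> j < length Ms \<and> x \<in> carrier (Ms ! j) \<and> y \<in> carrier (Ms ! j)}
   \<union> {frag_of (t[j := lbar (Ms ! j) r (t ! j)])
        - frag_of (t[Suc j := lact (Ms ! Suc j) r (t ! Suc j)]) | t j r.
        t \<in> tuples Ms \<and> Suc j < length Ms \<and> r \<in> carrier R}"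

definition tensor_kernel ::
    "('r, 'k) ring_scheme \<Rightarrow> ('r, 'u) bimod list \<Rightarrow> ('u list \<Rightarrow>\<^sub>0 int) set" where
  "tensor_kernel R Ms = generate (free_Abelian_group (tuples Ms)) (tensor_relations R Ms)"

definition tensor ::
    "('r, 'k) ring_scheme \<Rightarrow> ('r, 'u) bimod list \<Rightarrow> ('u list \<Rightarrow>\<^sub>0 int) set monoid" where
  "tensor R Ms = free_Abelian_group (tuples Ms) Mod tensor_kernel R Ms"

definition tensor_class ::
    "('r, 'k) ring_scheme \<Rightarrow> ('r, 'u) bimod list \<Rightarrow> ('u list \<Rightarrow>\<^sub>0 int) \<Rightarrow> ('u list \<Rightarrow>\<^sub>0 int) set" where
  "tensor_class R Ms x = tensor_kernel R Ms #>\<^bsub>free_Abelian_group (tuples Ms)\<^esub> x"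

text \<open>
  The map into \<open>tensor R Ns\<close> sending the class of a tuple \<open>t\<close> to the class of \<open>phi t\<close>, extended additively.
\<close>

definition induced ::
    "('r, 'k) ring_scheme \<Rightarrow> ('r, 'u) bimod list \<Rightarrow> ('u list \<Rightarrow> ('u list \<Rightarrow>\<^sub>0 int))
      \<Rightarrow> ('u list \<Rightarrow>\<^sub>0 int) set \<Rightarrow> ('u list \<Rightarrow>\<^sub>0 int) set" where
  "induced R Ns phi X = tensor_class R Ns (frag_extend phi (SOME x. x \<in> X))"

definition act_at :: "nat \<Rightarrow> ('u \<Rightarrow> 'u) \<Rightarrow> 'u list \<Rightarrow> ('u list \<Rightarrow>\<^sub>0 int)" where
  "act_at j h t = frag_of (t[j := h (t ! j)])"

definition restricted ::
    "('r, 'k) ring_scheme \<Rightarrow> ('r, 'u) bimod list \<Rightarrow> ('u list \<Rightarrow>\<^sub>0 int) set set" where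
  "restricted R Ms = {X \<in> carrier (tensor R Ms). \<forall>s\<in>carrier R. \<forall>j. Suc j < length Ms \<longrightarrow>
     induced R Ms (act_at j (\<lambda>m. rbar (Ms ! j) m s)) X =
     induced R Ms (act_at (Suc j) (\<lambda>m. ract (Ms ! Suc j) m s)) X}"


section \<open>A universe of elements\<close>

text \<open>
  The carriers of \<open>End(R)\<close> and of the products must lie in the same type as those of the
  factors.  The following type contains arbitrary atoms from \<open>'a\<close>, the functions on \<open>R\<close>, and
  is closed under formal integer combinations of tuples.  A bimodule carried by any
  type \<open>'a\<close> is isomorphic to one carried by atoms.
\<close>

datatype ('a, 'r) elt =
    Atom 'a
  | Endo (the_endo: "'r \<Rightarrow> 'r")
  | Comb "(int \<times> ('a, 'r) elt list) list"

definition frag_of_list :: "(int \<times> 'u list) list \<Rightarrow> ('u list \<Rightarrow>\<^sub>0 int)" where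
  "frag_of_list l = (\<Sum>(k, t)\<leftarrow>l. frag_cmul k (frag_of t))"

text \<open>
  A class in the tensor product is encoded by a chosen combination representing it.  The class
  of \<open>[m]\<close> in a tensor product with a single factor is identified with \<open>m\<close> itself.
\<close>

definition encode :: "('r, 'k) ring_scheme \<Rightarrow> ('r, ('a, 'r) elt) bimod list
    \<Rightarrow> (('a, 'r) elt list \<Rightarrow>\<^sub>0 int) set \<Rightarrow> ('a, 'r) elt" where
  "encode R Ms X =
    (if length Ms = 1 then (THE m. m \<in> carrier (hd Ms) \<and> tensor_class R Ms (frag_of [m]) = X)
     else Comb (SOME l. frag_of_list l \<in> X))"

definition decode :: "('r, 'k) ring_scheme \<Rightarrow> ('r, ('a, 'r) elt) bimod list
    \<Rightarrow> ('a, 'r) elt \<Rightarrow> (('a, 'r) elt list \<Rightarrow>\<^sub>0 int) set" where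
  "decode R Ms = the_inv_into (carrier (tensor R Ms)) (encode R Ms)"


section \<open>The restricted tensor products\<close>

definition End_bimod :: "('r, 'k) ring_scheme \<Rightarrow> ('r, ('a, 'r) elt) bimod" where
  "End_bimod R =
    \<lparr>carrier = Endo ` {f \<in> carrier R \<rightarrow>\<^sub>E carrier R.
         \<forall>x\<in>carrier R. \<forall>y\<in>carrier R. f (x \<oplus>\<^bsub>R\<^esub> y) = f x \<oplus>\<^bsub>R\<^esub> f y},
     mult = undefined, one = undefined,
     zero = Endo (\<lambda>m\<in>carrier R. \<zero>\<^bsub>R\<^esub>),
     add = (\<lambda>f g. Endo (\<lambda>m\<in>carrier R. the_endo f m \<oplus>\<^bsub>R\<^esub> the_endo g m)),
     lact = (\<lambda>r f. Endo (\<lambda>m\<in>carrier R. r \<otimes>\<^bsub>R\<^esub> the_endo f m)),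
     lbar = (\<lambda>r f. Endo (\<lambda>m\<in>carrier R. the_endo f m \<otimes>\<^bsub>R\<^esub> r)),
     ract = (\<lambda>f s. Endo (\<lambda>m\<in>carrier R. the_endo f (s \<otimes>\<^bsub>R\<^esub> m))),
     rbar = (\<lambda>f s. Endo (\<lambda>m\<in>carrier R. the_endo f (m \<otimes>\<^bsub>R\<^esub> s)))\<rparr>"

definition multi_bimod ::
    "('r, 'k) ring_scheme \<Rightarrow> ('r, ('a, 'r) elt) bimod list \<Rightarrow> ('r, ('a, 'r) elt) bimod" where
  "multi_bimod R Ms =
    (let n = length Ms - 1;
         on = (\<lambda>j h x. encode R Ms (induced R Ms (act_at j h) (decode R Ms x)))
     in \<lparr>carrier = encode R Ms ` restricted R Ms,
         mult = undefined, one = undefined,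
         zero = encode R Ms \<one>\<^bsub>tensor R Ms\<^esub>,
         add = (\<lambda>x y. encode R Ms (decode R Ms x \<otimes>\<^bsub>tensor R Ms\<^esub> decode R Ms y)),
         lact = (\<lambda>r. on 0 (lact (Ms ! 0) r)),
         lbar = (\<lambda>r. on n (lbar (Ms ! n) r)),
         ract = (\<lambda>x s. on 0 (\<lambda>m. ract (Ms ! 0) m s) x),
         rbar = (\<lambda>x s. on n (\<lambda>m. rbar (Ms ! n) m s) x)\<rparr>)"

fun rprod ::
    "('r, 'k) ring_scheme \<Rightarrow> ('r, ('a, 'r) elt) bimod list \<Rightarrow> ('r, ('a, 'r) elt) bimod" where
  "rprod R [] = End_bimod R"
| "rprod R [M] = M"
| "rprod R (M # N # Ms) = multi_bimod R (M # N # Ms)"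

text \<open>
  The morphism between products of the lists \<open>Ms\<close> and \<open>Ns\<close> (both nonempty) induced by \<open>phi\<close>.
\<close>

definition rprod_induced :: "('r, 'k) ring_scheme \<Rightarrow> ('r, ('a, 'r) elt) bimod list
    \<Rightarrow> ('r, ('a, 'r) elt) bimod list \<Rightarrow> (('a, 'r) elt list \<Rightarrow> (('a, 'r) elt list \<Rightarrow>\<^sub>0 int))
    \<Rightarrow> ('r, ('a, 'r) elt) bimod_mor" where
  "rprod_induced R Ms Ns phi = BMor (rprod R Ms) (rprod R Ns)
     (\<lambda>x\<in>carrier (rprod R Ms). encode R Ns (induced R Ns phi (decode R Ms x)))"

definition rprod_mor ::
    "('r, 'k) ring_scheme \<Rightarrow> ('r, ('a, 'r) elt) bimod_mor list \<Rightarrow> ('r, ('a, 'r) elt) bimod_mor" where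
  "rprod_mor R Fs =
    (if Fs = [] then Ident (bimod_category R) (End_bimod R)
     else rprod_induced R (map src Fs) (map tgt Fs) (\<lambda>t. frag_of (map2 fn Fs t)))"

text \<open>
  On a tuple \<open>a @ [b] @ c\<close> with \<open>b\<close> in the inner product, \<open>b\<close> is replaced by the
  combination of tuples which it represents.
\<close>

definition associator :: "('r, 'k) ring_scheme \<Rightarrow> ('r, ('a, 'r) elt) bimod list
    \<Rightarrow> ('r, ('a, 'r) elt) bimod list \<Rightarrow> ('r, ('a, 'r) elt) bimod list
    \<Rightarrow> ('r, ('a, 'r) elt) bimod_mor" where
  "associator R xs ys zs = rprod_induced R (xs @ [rprod R ys] @ zs) (xs @ ys @ zs)
     (\<lambda>u. let k = length xs in
        frag_extend (\<lambda>t. frag_of (take k u @ t @ drop (Suc k) u))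
          (SOME z. z \<in> decode R ys (u ! k)))"

text \<open>
  On a tuple \<open>a @ [phi] @ c\<close> with \<open>phi\<close> in \<open>End(R)\<close>, \<open>phi(1)\<close> acts on the entry following
  \<open>phi\<close>, or, if there is none, its opposite acts on the entry preceding \<open>phi\<close>.
\<close>

definition unitor :: "('r, 'k) ring_scheme \<Rightarrow> ('r, ('a, 'r) elt) bimod list
    \<Rightarrow> ('r, ('a, 'r) elt) bimod list \<Rightarrow> ('r, ('a, 'r) elt) bimod_mor" where
  "unitor R xs zs =
    (if xs = [] \<and> zs = [] then Ident (bimod_category R) (End_bimod R)
     else rprod_induced R (xs @ [End_bimod R] @ zs) (xs @ zs)
       (\<lambda>u. let k = length xs; e = the_endo (u ! k) \<one>\<^bsub>R\<^esub>; a = take k u; c = drop (Suc k) u in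
          frag_of (if zs \<noteq> [] then a @ [lact (hd zs) e (hd c)] @ tl c
                   else butlast a @ [lbar (last xs) e (last a)])))"

definition structure_map :: "('r, 'k) ring_scheme \<Rightarrow> ('r, ('a, 'r) elt) bimod list
    \<Rightarrow> ('r, ('a, 'r) elt) bimod list \<Rightarrow> ('r, ('a, 'r) elt) bimod list
    \<Rightarrow> ('r, ('a, 'r) elt) bimod_mor" where
  "structure_map R xs ys zs = (if ys = [] then unitor R xs zs else associator R xs ys zs)"

end

theory Submission
  imports Defs
begin

text \<open>
  Every structure map is induced by a map of tuples which acts on one block of adjacent entries
  and fixes the others, with values given by concatenation.  Such a block map descends to
  tensor products as soon as it does so on the block and commutes there with the left actions at
  both ends; if it also commutes with the right actions at both ends, it preserves restricted
  elements and is linear.  The coherence equations then hold because both sides agree on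
  tuples modulo the tensor relations.  The only exception is the equality of the two unitors on
  \<open>End(R) \<times>\<^sub>R End(R)\<close>, which holds on restricted elements only.
\<close>

section \<open>The concatenation product\<close>

text \<open>
  Making lists a monoid turns formal combinations of tuples into a ring (the free ring on the
  entries), in which the product of two tuples is their concatenation.
\<close>

instantiation list :: (type) monoid_add
begin
definition zero_list_def: "0 = []"
definition plus_list_def: "xs + ys = xs @ ys"
instance by standard (simp_all add: zero_list_def plus_list_def)
end

lemma frag_of_append: "frag_of (s @ t) = frag_of s * frag_of t"
  by (simp add: mult_single plus_list_def)

lemma frag_of_Nil: "frag_of [] = 1"
  by (simp flip: single_one add: zero_list_def)

definition frags :: "('r, 'u) bimod list \<Rightarrow> ('u list \<Rightarrow>\<^sub>0 int) set" where
  "frags Ms = {x. Poly_Mapping.keys x \<subseteq> tuples Ms}"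

lemma tuples_iff: "t \<in> tuples Ms \<longleftrightarrow> list_all2 (\<lambda>m M. m \<in> carrier M) t Ms"
proof (induction Ms arbitrary: t)
  case (Cons M Ms)
  then show ?case
    by (cases t) (auto simp: tuples_def set_Cons_def)
qed (simp add: tuples_def)

lemma tuples_Nil [simp]: "t \<in> tuples [] \<longleftrightarrow> t = []"
  by (simp add: tuples_iff)

lemma tuples_Cons [simp]:
  "t \<in> tuples (M # Ms) \<longleftrightarrow> (\<exists>m s. t = m # s \<and> m \<in> carrier M \<and> s \<in> tuples Ms)"
  by (auto simp: tuples_iff list_all2_Cons2)

lemma tuples_append:
  "t \<in> tuples (As @ Bs) \<longleftrightarrow> (\<exists>a b. t = a @ b \<and> a \<in> tuples As \<and> b \<in> tuples Bs)"
  by (auto simp: tuples_iff list_all2_append2 dest: list_all2_lengthD intro: list_all2_appendI)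

lemma tuples_appendI: "a \<in> tuples As \<Longrightarrow> b \<in> tuples Bs \<Longrightarrow> a @ b \<in> tuples (As @ Bs)"
  by (auto simp: tuples_append)

lemma tuples_length: "t \<in> tuples Ms \<Longrightarrow> length t = length Ms"
  by (simp add: tuples_iff list_all2_lengthD)

lemma tuples_nth: "t \<in> tuples Ms \<Longrightarrow> j < length Ms \<Longrightarrow> t ! j \<in> carrier (Ms ! j)"
  by (simp add: tuples_iff list_all2_conv_all_nth)

lemma tuples_update: "t \<in> tuples Ms \<Longrightarrow> m \<in> carrier (Ms ! j) \<Longrightarrow> t[j := m] \<in> tuples Ms"
  unfolding tuples_iff list_all2_conv_all_nth
  by (cases "j < length t") (simp_all add: nth_list_update)

lemma frags_0 [simp]: "0 \<in> frags Ms"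
  by (simp add: frags_def)

lemma frags_of [simp]: "frag_of t \<in> frags Ms \<longleftrightarrow> t \<in> tuples Ms"
  by (simp add: frags_def)

lemma one_in_frags: "1 \<in> frags []"
  by (simp flip: frag_of_Nil)

lemma frags_add: "x \<in> frags Ms \<Longrightarrow> y \<in> frags Ms \<Longrightarrow> x + y \<in> frags Ms"
  using keys_add[of x y] by (auto simp: frags_def)

lemma frags_minus: "x \<in> frags Ms \<Longrightarrow> - x \<in> frags Ms"
  by (simp add: frags_def)

lemma frags_diff: "x \<in> frags Ms \<Longrightarrow> y \<in> frags Ms \<Longrightarrow> x - y \<in> frags Ms"
  using keys_diff[of x y] by (auto simp: frags_def)

lemma frags_induct [consumes 1, case_names zero tuple diff]:
  assumes "x \<in> frags Ms" "P 0" "\<And>t. t \<in> tuples Ms \<Longrightarrow> P (frag_of t)"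
    "\<And>x y. x \<in> frags Ms \<Longrightarrow> y \<in> frags Ms \<Longrightarrow> P x \<Longrightarrow> P y \<Longrightarrow> P (x - y)"
  shows "P x"
proof -
  have "x \<in> frags Ms \<and> P x"
    by (rule frag_induction[where S = "tuples Ms" and P = "\<lambda>x. x \<in> frags Ms \<and> P x"])
      (use assms in \<open>auto simp: frags_def intro!: subset_trans[OF keys_diff]\<close>)
  then show ?thesis ..
qed

lemma frags_mult: "x \<in> frags As \<Longrightarrow> y \<in> frags Bs \<Longrightarrow> x * y \<in> frags (As @ Bs)"
  using keys_mult[of x y] unfolding frags_def plus_list_def by (blast intro: tuples_appendI)

abbreviation "lin \<equiv> frag_extend"

lemma frags_extend:
  assumes "\<And>t. t \<in> tuples Ms \<Longrightarrow> phi t \<in> frags Ns" "x \<in> frags Ms"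
  shows "lin phi x \<in> frags Ns"
  using keys_frag_extend[of phi x] assms unfolding frags_def by blast

lemma frag_extend_cong:
  assumes "x \<in> frags Ms" "\<And>t. t \<in> tuples Ms \<Longrightarrow> phi t = psi t"
  shows "lin phi x = lin psi x"
  using assms by (intro frag_extend_eq) (auto simp: frags_def)

lemma frag_extend_id: "lin frag_of x = x"
  by (rule frag_expansion[symmetric])

lemma frag_extend_frag_extend:
  "lin phi (lin psi x) = lin (\<lambda>t. lin phi (psi t)) x"
  by (induction x rule: frag_induction[OF subset_UNIV]) (simp_all add: frag_extend_diff)

lemma frag_extend_mult:
  assumes "x \<in> frags As" "y \<in> frags Bs"
    and "\<And>a b. a \<in> tuples As \<Longrightarrow> b \<in> tuples Bs \<Longrightarrow> phi (a @ b) = f a * g b"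
  shows "lin phi (x * y) = lin f x * lin g y"
  using assms(1)
proof (induction x rule: frags_induct)
  case (tuple a)
  show ?case using assms(2)
    by (induction y rule: frags_induct)
      (simp_all add: frag_extend_diff right_diff_distrib tuple assms(3) flip: frag_of_append)
qed (simp_all add: frag_extend_diff left_diff_distrib)

lemma frag_extend_mult3:
  assumes "x \<in> frags As" "y \<in> frags Bs" "z \<in> frags Cs"
    and "\<And>a b c. a \<in> tuples As \<Longrightarrow> b \<in> tuples Bs \<Longrightarrow> c \<in> tuples Cs
      \<Longrightarrow> phi (a @ b @ c) = f a * g b * h c"
  shows "lin phi (x * y * z) = lin f x * lin g y * lin h z"
  using assms(1)
proof (induction x rule: frags_induct)
  case (tuple a)
  have "lin phi (frag_of a * x) = lin (\<lambda>t. phi (a @ t)) x" for x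
    by (induction x rule: frag_induction[OF subset_UNIV])
      (simp_all add: frag_extend_diff right_diff_distrib flip: frag_of_append)
  moreover have "lin (\<lambda>t. phi (a @ t)) (y * z) = lin (\<lambda>b. f a * g b) y * lin h z"
    by (rule frag_extend_mult[OF assms(2,3)]) (simp add: tuple assms(4))
  moreover have "lin (\<lambda>b. f a * g b) y = f a * lin g y"
    by (induction y rule: frag_induction[OF subset_UNIV])
      (simp_all add: frag_extend_diff right_diff_distrib)
  ultimately show ?case by (simp add: mult.assoc)
qed (simp_all add: frag_extend_diff left_diff_distrib)


section \<open>The tensor product as a congruence\<close>

definition op_at :: "('r, 'u) bimod list \<Rightarrow> (('r, 'u) bimod \<Rightarrow> 'u \<Rightarrow> 'u) \<Rightarrow> nat
    \<Rightarrow> ('u list \<Rightarrow>\<^sub>0 int) \<Rightarrow> ('u list \<Rightarrow>\<^sub>0 int)" where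
  "op_at Ms op j = lin (act_at j (op (Ms ! j)))"

abbreviation "Lact r \<equiv> (\<lambda>M. lact M r)"
abbreviation "Lbar r \<equiv> (\<lambda>M. lbar M r)"
abbreviation "Ract s \<equiv> (\<lambda>M m. ract M m s)"
abbreviation "Rbar s \<equiv> (\<lambda>M m. rbar M m s)"

lemma op_at_frag_of: "op_at Ms op j (frag_of t) = frag_of (t[j := op (Ms ! j) (t ! j)])"
  by (simp add: op_at_def act_at_def)

lemma op_at_0 [simp]: "op_at Ms op j 0 = 0"
  by (simp add: op_at_def)

lemma op_at_add: "op_at Ms op j (x + y) = op_at Ms op j x + op_at Ms op j y"
  by (simp add: op_at_def frag_extend_add)

lemma op_at_diff: "op_at Ms op j (x - y) = op_at Ms op j x - op_at Ms op j y"
  by (simp add: op_at_def frag_extend_diff)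

lemma op_at_left:
  assumes "x \<in> frags As" "y \<in> frags Bs" "j < length As"
  shows "op_at (As @ Bs) op j (x * y) = op_at As op j x * y"
proof -
  have "op_at (As @ Bs) op j (x * y) = op_at As op j x * lin frag_of y"
    unfolding op_at_def using assms
    by (intro frag_extend_mult)
      (auto simp: act_at_def nth_append list_update_append frag_of_append dest: tuples_length)
  then show ?thesis by (simp add: frag_extend_id)
qed

lemma op_at_right:
  assumes "x \<in> frags As" "y \<in> frags Bs" "j = length As + i"
  shows "op_at (As @ Bs) op j (x * y) = x * op_at Bs op i y"
proof -
  have "op_at (As @ Bs) op j (x * y) = lin frag_of x * op_at Bs op i y"
    unfolding op_at_def using assms
    by (intro frag_extend_mult)
      (auto simp: act_at_def nth_append list_update_append frag_of_append dest: tuples_length)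
  then show ?thesis by (simp add: frag_extend_id)
qed

lemma op_at_mid:
  assumes "x \<in> frags As" "y \<in> frags Bs" "z \<in> frags Cs" "j = length As + i" "i < length Bs"
  shows "op_at (As @ Bs @ Cs) op j (x * y * z) = x * op_at Bs op i y * z"
  using op_at_right[OF assms(1) frags_mult[OF assms(2,3)] assms(4), of op]
    op_at_left[OF assms(2,3,5), of op] by (simp add: mult.assoc)

lemma op_at_op_at:
  assumes "x \<in> frags Ms" "j < length Ms"
  shows "op_at Ms op j (op_at Ms op' j x) = op_at Ms (\<lambda>M m. op M (op' M m)) j x"
  using assms(1)
  by (induction x rule: frags_induct)
    (auto simp: op_at_diff op_at_frag_of assms(2) dest: tuples_length)

lemma op_at_cong:
  assumes "x \<in> frags Ms" "\<And>m. m \<in> carrier (Ms ! j) \<Longrightarrow> op (Ms ! j) m = op' (Ms ! j) m"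
    "j < length Ms"
  shows "op_at Ms op j x = op_at Ms op' j x"
  using assms(1)
  by (induction x rule: frags_induct) (simp_all add: op_at_diff op_at_frag_of assms tuples_nth)

lemma op_at_id:
  assumes "x \<in> frags Ms" "\<And>m. m \<in> carrier (Ms ! j) \<Longrightarrow> op (Ms ! j) m = m" "j < length Ms"
  shows "op_at Ms op j x = x"
  using assms(1)
  by (induction x rule: frags_induct) (simp_all add: op_at_diff op_at_frag_of assms tuples_nth)

lemma op_at_commute:
  assumes "x \<in> frags Ms" "i \<noteq> j"
  shows "op_at Ms op i (op_at Ms op' j x) = op_at Ms op' j (op_at Ms op i x)"
  using assms(1)
  by (induction x rule: frags_induct)
    (auto simp: op_at_diff op_at_frag_of list_update_swap assms(2) assms(2)[symmetric])

locale ground_ring = ring R for R :: "('r, 'k) ring_scheme"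
begin

definition bimods :: "('r, 'u) bimod list \<Rightarrow> bool" where
  "bimods Ms \<longleftrightarrow> (\<forall>M\<in>set Ms. env_bimodule R M)"

lemma bimods_simps [simp]:
  "bimods []" "bimods (M # Ms) \<longleftrightarrow> env_bimodule R M \<and> bimods Ms"
  "bimods (Ms @ Ns) \<longleftrightarrow> bimods Ms \<and> bimods Ns"
  by (auto simp: bimods_def)

lemma bimods_nth: "bimods Ms \<Longrightarrow> j < length Ms \<Longrightarrow> env_bimodule R (Ms ! j)"
  by (simp add: bimods_def)

definition teq :: "('r, 'u) bimod list \<Rightarrow> ('u list \<Rightarrow>\<^sub>0 int) \<Rightarrow> ('u list \<Rightarrow>\<^sub>0 int) \<Rightarrow> bool" where
  "teq Ms x y \<longleftrightarrow> x - y \<in> tensor_kernel R Ms"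

definition additive_op :: "(('r, 'u) bimod \<Rightarrow> 'u \<Rightarrow> 'u) \<Rightarrow> bool" where
  "additive_op op \<longleftrightarrow> (\<forall>M. env_bimodule R M \<longrightarrow> (\<forall>m\<in>carrier M. op M m \<in> carrier M \<and>
     (\<forall>n\<in>carrier M. op M (m \<oplus>\<^bsub>M\<^esub> n) = op M m \<oplus>\<^bsub>M\<^esub> op M n)))"

lemma bimod_closed:
  assumes "env_bimodule R M" "r \<in> carrier R" "m \<in> carrier M"
  shows "lact M r m \<in> carrier M" (is ?lact)
    "lbar M r m \<in> carrier M" (is ?lbar)
    "ract M m r \<in> carrier M" (is ?ract)
    "rbar M m r \<in> carrier M" (is ?rbar)
proof -
  interpret env_bimodule R M by fact
  show ?lact ?lbar ?ract ?rbar
    using assms by (simp_all add: lact.act_closed lbar.act_closed ract.act_closed rbar.act_closed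
      op_ring_def)
qed

lemma additive_actions:
  assumes r: "r \<in> carrier R"
  shows "additive_op (Lact r)" (is ?lact)
    "additive_op (Lbar r)" (is ?lbar)
    "additive_op (Ract r)" (is ?ract)
    "additive_op (Rbar r)" (is ?rbar)
proof -
  have *: "lact M r (m \<oplus>\<^bsub>M\<^esub> n) = lact M r m \<oplus>\<^bsub>M\<^esub> lact M r n \<and>
    lbar M r (m \<oplus>\<^bsub>M\<^esub> n) = lbar M r m \<oplus>\<^bsub>M\<^esub> lbar M r n \<and>
    ract M (m \<oplus>\<^bsub>M\<^esub> n) r = ract M m r \<oplus>\<^bsub>M\<^esub> ract M n r \<and>
    rbar M (m \<oplus>\<^bsub>M\<^esub> n) r = rbar M m r \<oplus>\<^bsub>M\<^esub> rbar M n r"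
    if M: "env_bimodule R M" and mn: "m \<in> carrier M" "n \<in> carrier M"
    for M :: "('r, 'u) bimod" and m n
  proof -
    interpret env_bimodule R M by fact
    show ?thesis
      using mn r by (simp add: lact.act_add lbar.act_add ract.act_add rbar.act_add op_ring_def)
  qed
  show ?lact ?lbar ?ract ?rbar
    using r by (auto simp: additive_op_def bimod_closed *)
qed

lemma carrier_add:
  assumes "env_bimodule R M" "m \<in> carrier M" "n \<in> carrier M"
  shows "m \<oplus>\<^bsub>M\<^esub> n \<in> carrier M"
proof -
  interpret env_bimodule R M by fact
  show ?thesis using assms by simp
qed

lemma action_add:
  assumes "env_bimodule R M" "m \<in> carrier M" "n \<in> carrier M" "r \<in> carrier R"
  shows "lact M r (m \<oplus>\<^bsub>M\<^esub> n) = lact M r m \<oplus>\<^bsub>M\<^esub> lact M r n"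
    "lbar M r (m \<oplus>\<^bsub>M\<^esub> n) = lbar M r m \<oplus>\<^bsub>M\<^esub> lbar M r n"
  using additive_actions(1,2)[OF assms(4)] assms unfolding additive_op_def by blast+

lemma op_at_closed:
  assumes "additive_op op" "bimods Ms" "j < length Ms" "x \<in> frags Ms"
  shows "op_at Ms op j x \<in> frags Ms"
  unfolding op_at_def using assms
  by (intro frags_extend[OF _ assms(4)])
    (auto simp: act_at_def additive_op_def intro!: tuples_update tuples_nth bimods_nth)

lemma tensor_relations_frags:
  assumes "bimods Ms" "x \<in> tensor_relations R Ms"
  shows "x \<in> frags Ms"
  using assms unfolding tensor_relations_def
  by (auto intro!: carrier_add frags_diff tuples_update bimod_closed tuples_nth bimods_nth)

abbreviation "ker \<equiv> tensor_kernel R"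

lemma kernel_0 [simp]: "0 \<in> ker Ms"
  using generate.one[of "free_Abelian_group (tuples Ms)"] by (simp add: tensor_kernel_def)

lemma kernel_add: "x \<in> ker Ms \<Longrightarrow> y \<in> ker Ms \<Longrightarrow> x + y \<in> ker Ms"
  using generate.eng[of x "free_Abelian_group (tuples Ms)"] by (simp add: tensor_kernel_def)

lemma kernel_induct [consumes 2, case_names zero relation minus_relation add]:
  assumes "x \<in> ker Ms" "bimods Ms" "P 0" "\<And>x. x \<in> tensor_relations R Ms \<Longrightarrow> P x"
    "\<And>x. x \<in> tensor_relations R Ms \<Longrightarrow> P (- x)" "\<And>x y. P x \<Longrightarrow> P y \<Longrightarrow> P (x + y)"
  shows "P x"
  using assms(1) unfolding tensor_kernel_def
proof (induction rule: generate.induct)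
  case (inv h)
  then have "h \<in> frags Ms" using assms(2) by (rule tensor_relations_frags[rotated])
  then show ?case using inv assms(5) by (simp add: frags_def)
qed (use assms in auto)

lemma kernel_frags:
  assumes "x \<in> ker Ms" "bimods Ms"
  shows "x \<in> frags Ms"
  using assms
proof (induction rule: kernel_induct)
  case (relation x)
  then show ?case by (rule tensor_relations_frags[OF assms(2)])
next
  case (minus_relation x)
  then show ?case by (intro frags_minus tensor_relations_frags[OF assms(2)])
qed (simp_all add: frags_add)

lemma kernel_relation: "x \<in> tensor_relations R Ms \<Longrightarrow> x \<in> ker Ms"
  unfolding tensor_kernel_def by (rule generate.incl)

lemma kernel_minus:
  assumes "x \<in> ker Ms" "bimods Ms"
  shows "- x \<in> ker Ms"
  using assms
proof (induction rule: kernel_induct)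
  case (relation x)
  then have "inv\<^bsub>free_Abelian_group (tuples Ms)\<^esub> x \<in> ker Ms"
    unfolding tensor_kernel_def by (rule generate.inv)
  then show ?case using tensor_relations_frags[OF assms(2) relation] by (simp add: frags_def)
next
  case (add x y)
  then show ?case using kernel_add[of "- x" Ms "- y"] by simp
qed (auto intro: kernel_relation)

lemma kernel_diff:
  assumes "x \<in> ker Ms" "y \<in> ker Ms" "bimods Ms"
  shows "x - y \<in> ker Ms"
  using kernel_add[OF assms(1) kernel_minus[OF assms(2,3)]] by simp

lemma teq_refl [simp, intro]: "teq Ms x x"
  by (simp add: teq_def)

lemma teq_sym: "teq Ms x y \<Longrightarrow> bimods Ms \<Longrightarrow> teq Ms y x"
  unfolding teq_def using kernel_minus[of "x - y" Ms] by simp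

lemma teq_trans [trans]: "teq Ms x y \<Longrightarrow> teq Ms y z \<Longrightarrow> teq Ms x z"
  unfolding teq_def using kernel_add[of "x - y" Ms "y - z"] by simp

lemma teq_add: "teq Ms x y \<Longrightarrow> teq Ms x' y' \<Longrightarrow> teq Ms (x + x') (y + y')"
  unfolding teq_def using kernel_add[of "x - y" Ms "x' - y'"] by (simp add: algebra_simps)

lemma teq_diff: "teq Ms x y \<Longrightarrow> teq Ms x' y' \<Longrightarrow> bimods Ms \<Longrightarrow> teq Ms (x - x') (y - y')"
  unfolding teq_def using kernel_diff[of "x - y" Ms "x' - y'"] by (simp add: algebra_simps)

lemma teq_frags:
  assumes "teq Ms x y" "bimods Ms" "y \<in> frags Ms"
  shows "x \<in> frags Ms"
  using frags_add[OF kernel_frags[of "x - y" Ms] assms(3)] assms by (simp add: teq_def)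

lemma teq_additive:
  assumes "t \<in> tuples Ms" "j < length Ms" "x \<in> carrier (Ms ! j)" "y \<in> carrier (Ms ! j)"
  shows "teq Ms (frag_of (t[j := x \<oplus>\<^bsub>Ms ! j\<^esub> y])) (frag_of (t[j := x]) + frag_of (t[j := y]))"
proof -
  have "frag_of (t[j := x \<oplus>\<^bsub>Ms ! j\<^esub> y]) - frag_of (t[j := x]) - frag_of (t[j := y])
      \<in> tensor_relations R Ms"
    unfolding tensor_relations_def using assms by blast
  then show ?thesis unfolding teq_def using kernel_relation by (simp add: diff_diff_eq)
qed

lemma teq_balanced:
  assumes "x \<in> frags Ms" "Suc j < length Ms" "r \<in> carrier R" "bimods Ms"
  shows "teq Ms (op_at Ms (Lbar r) j x) (op_at Ms (Lact r) (Suc j) x)"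
  using assms(1)
proof (induction x rule: frags_induct)
  case (tuple t)
  then have "frag_of (t[j := lbar (Ms ! j) r (t ! j)])
      - frag_of (t[Suc j := lact (Ms ! Suc j) r (t ! Suc j)]) \<in> tensor_relations R Ms"
    unfolding tensor_relations_def using assms by blast
  then show ?case unfolding teq_def using kernel_relation by (simp add: op_at_frag_of)
qed (simp_all add: op_at_diff teq_diff assms(4))

lemma teq_op_at_plus:
  assumes x: "x \<in> frags Ms" and j: "j < length Ms" and "bimods Ms"
    and "additive_op op" "additive_op op'"
    and "\<And>m. m \<in> carrier (Ms ! j) \<Longrightarrow> op'' (Ms ! j) m = op (Ms ! j) m \<oplus>\<^bsub>Ms ! j\<^esub> op' (Ms ! j) m"
  shows "teq Ms (op_at Ms op'' j x) (op_at Ms op j x + op_at Ms op' j x)"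
  using x
proof (induction x rule: frags_induct)
  case (tuple t)
  then show ?case
    unfolding op_at_frag_of using assms
    by (auto simp: tuples_nth additive_op_def bimods_nth intro!: teq_additive)
next
  case (diff x y)
  from teq_diff[OF diff(3,4) assms(3)] show ?case by (simp add: op_at_diff algebra_simps)
qed simp

definition respectful :: "('r, 'u) bimod list \<Rightarrow> ('r, 'v) bimod list
    \<Rightarrow> ('u list \<Rightarrow> ('v list \<Rightarrow>\<^sub>0 int)) \<Rightarrow> bool" where
  "respectful Ms Ns phi \<longleftrightarrow> (\<forall>t\<in>tuples Ms. phi t \<in> frags Ns) \<and>
     (\<forall>x\<in>ker Ms. lin phi x \<in> ker Ns)"

lemma respectfulI:
  assumes bim: "bimods Ms" "bimods Ns"
    and closed: "\<And>t. t \<in> tuples Ms \<Longrightarrow> phi t \<in> frags Ns"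
    and additive: "\<And>t j x y. t \<in> tuples Ms \<Longrightarrow> j < length Ms \<Longrightarrow> x \<in> carrier (Ms ! j)
      \<Longrightarrow> y \<in> carrier (Ms ! j)
      \<Longrightarrow> teq Ns (phi (t[j := x \<oplus>\<^bsub>Ms ! j\<^esub> y])) (phi (t[j := x]) + phi (t[j := y]))"
    and balanced: "\<And>t j r. t \<in> tuples Ms \<Longrightarrow> Suc j < length Ms \<Longrightarrow> r \<in> carrier R
      \<Longrightarrow> teq Ns (lin phi (op_at Ms (Lbar r) j (frag_of t)))
                 (lin phi (op_at Ms (Lact r) (Suc j) (frag_of t)))"
  shows "respectful Ms Ns phi"
proof -
  have rel: "lin phi x \<in> ker Ns" if "x \<in> tensor_relations R Ms" for x
    using that unfolding tensor_relations_def
  proof (elim UnE CollectE exE conjE)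
    fix t j u v assume "x = frag_of (t[j := u \<oplus>\<^bsub>Ms ! j\<^esub> v]) - frag_of (t[j := u]) - frag_of (t[j := v])"
      "t \<in> tuples Ms" "j < length Ms" "u \<in> carrier (Ms ! j)" "v \<in> carrier (Ms ! j)"
    then show ?thesis
      using additive[of t j u v] by (simp add: frag_extend_diff frag_extend_add teq_def diff_diff_eq)
  next
    fix t j r assume "x = frag_of (t[j := lbar (Ms ! j) r (t ! j)])
        - frag_of (t[Suc j := lact (Ms ! Suc j) r (t ! Suc j)])"
      "t \<in> tuples Ms" "Suc j < length Ms" "r \<in> carrier R"
    then show ?thesis
      using balanced[of t j r] by (simp add: frag_extend_diff teq_def op_at_frag_of)
  qed
  have "lin phi x \<in> ker Ns" if "x \<in> ker Ms" for x
    using that bim(1)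
    by (induction rule: kernel_induct)
      (auto simp: frag_extend_add frag_extend_minus rel bim intro: kernel_add kernel_minus)
  then show ?thesis using closed by (simp add: respectful_def)
qed

lemma respectful_frags: "respectful Ms Ns phi \<Longrightarrow> x \<in> frags Ms \<Longrightarrow> lin phi x \<in> frags Ns"
  by (auto simp: respectful_def intro: frags_extend)

lemma respectful_teq:
  "respectful Ms Ns phi \<Longrightarrow> teq Ms x y \<Longrightarrow> teq Ns (lin phi x) (lin phi y)"
  by (simp add: respectful_def teq_def flip: frag_extend_diff)

lemma respectful_additive:
  assumes "respectful Ms Ns phi" "t \<in> tuples Ms" "j < length Ms" "x \<in> carrier (Ms ! j)"
    "y \<in> carrier (Ms ! j)"
  shows "teq Ns (phi (t[j := x \<oplus>\<^bsub>Ms ! j\<^esub> y])) (phi (t[j := x]) + phi (t[j := y]))"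
  using respectful_teq[OF assms(1) teq_additive[OF assms(2-5)]] by (simp add: frag_extend_add)

lemma respectful_compose:
  "respectful Ms Ns phi \<Longrightarrow> respectful Ns Os psi
    \<Longrightarrow> respectful Ms Os (\<lambda>t. lin psi (phi t))"
  by (auto simp: respectful_def simp flip: frag_extend_frag_extend intro: frags_extend)

lemma teq_extend_cong:
  assumes "x \<in> frags Ms" "bimods Ns" "\<And>t. t \<in> tuples Ms \<Longrightarrow> teq Ns (phi t) (psi t)"
  shows "teq Ns (lin phi x) (lin psi x)"
  using assms(1)
  by (induction x rule: frags_induct) (auto simp: frag_extend_diff assms intro: teq_diff)

lemma frag_extend_mult_left: "lin (\<lambda>b. x * frag_of b) y = x * y"
  by (induction y rule: frag_induction[OF subset_UNIV])
    (simp_all add: frag_extend_diff right_diff_distrib)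

lemma frag_extend_mult_right: "lin (\<lambda>b. frag_of b * x) y = y * x"
  by (induction y rule: frag_induction[OF subset_UNIV])
    (simp_all add: frag_extend_diff left_diff_distrib)

lemma teq_mult_left:
  assumes bim: "bimods As" "bimods Bs" and "x \<in> frags As" "teq Bs y z"
  shows "teq (As @ Bs) (x * y) (x * z)"
  using assms(3)
proof (induction x rule: frags_induct)
  case (tuple a)
  have "respectful Bs (As @ Bs) (\<lambda>b. frag_of a * frag_of b)"
  proof (rule respectfulI)
    fix t j x y assume "t \<in> tuples Bs" "j < length Bs" "x \<in> carrier (Bs ! j)" "y \<in> carrier (Bs ! j)"
    then show "teq (As @ Bs) (frag_of a * frag_of (t[j := x \<oplus>\<^bsub>Bs ! j\<^esub> y]))
        (frag_of a * frag_of (t[j := x]) + frag_of a * frag_of (t[j := y]))"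
      using teq_additive[of "a @ t" "As @ Bs" "length As + j" x y] tuple
      by (simp add: tuples_appendI tuples_length list_update_append flip: frag_of_append)
  next
    fix t j r assume "t \<in> tuples Bs" "Suc j < length Bs" "r \<in> carrier R"
    then show "teq (As @ Bs)
        (lin (\<lambda>b. frag_of a * frag_of b) (op_at Bs (Lbar r) j (frag_of t)))
        (lin (\<lambda>b. frag_of a * frag_of b) (op_at Bs (Lact r) (Suc j) (frag_of t)))"
      using teq_balanced[of "frag_of a * frag_of t" "As @ Bs" "length As + j" r] tuple bim
      by (simp add: frags_mult frag_extend_mult_left op_at_right
        op_at_right[where i = j] op_at_right[where i = "Suc j"])
  qed (use bim tuple in \<open>auto simp: frags_mult\<close>)
  from respectful_teq[OF this assms(4)] show ?case by (simp add: frag_extend_mult_left)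
qed (use bim in \<open>auto simp: left_diff_distrib intro: teq_diff\<close>)

lemma teq_mult_right:
  assumes bim: "bimods As" "bimods Bs" and "x \<in> frags Bs" "teq As y z"
  shows "teq (As @ Bs) (y * x) (z * x)"
  using assms(3)
proof (induction x rule: frags_induct)
  case (tuple b)
  have "respectful As (As @ Bs) (\<lambda>a. frag_of a * frag_of b)"
  proof (rule respectfulI)
    fix t j x y assume "t \<in> tuples As" "j < length As" "x \<in> carrier (As ! j)" "y \<in> carrier (As ! j)"
    then show "teq (As @ Bs) (frag_of (t[j := x \<oplus>\<^bsub>As ! j\<^esub> y]) * frag_of b)
        (frag_of (t[j := x]) * frag_of b + frag_of (t[j := y]) * frag_of b)"
      using teq_additive[of "t @ b" "As @ Bs" "j" x y] tuple
      by (simp add: tuples_appendI tuples_length list_update_append nth_append flip: frag_of_append)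
  next
    fix t j r assume "t \<in> tuples As" "Suc j < length As" "r \<in> carrier R"
    then show "teq (As @ Bs)
        (lin (\<lambda>a. frag_of a * frag_of b) (op_at As (Lbar r) j (frag_of t)))
        (lin (\<lambda>a. frag_of a * frag_of b) (op_at As (Lact r) (Suc j) (frag_of t)))"
      using teq_balanced[of "frag_of t * frag_of b" "As @ Bs" "j" r] tuple bim
      by (simp add: frags_mult frag_extend_mult_right op_at_left)
  qed (use bim tuple in \<open>auto simp: frags_mult\<close>)
  from respectful_teq[OF this assms(4)] show ?case by (simp add: frag_extend_mult_right)
qed (use bim in \<open>auto simp: right_diff_distrib intro: teq_diff\<close>)

lemma teq_mult3:
  assumes "bimods As" "bimods Bs" "bimods Cs" "x \<in> frags As" "z \<in> frags Cs" "teq Bs y y'"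
  shows "teq (As @ Bs @ Cs) (x * y * z) (x * y' * z)"
  using teq_mult_left[OF assms(1) _ assms(4) teq_mult_right[OF assms(2,3,5,6)]] assms
  by (auto simp: mult.assoc)


section \<open>Classes and restricted elements\<close>

abbreviation "cls \<equiv> tensor_class R"

lemma mem_tensor_class: "y \<in> cls Ms x \<longleftrightarrow> teq Ms y x"
proof
  assume "teq Ms y x"
  then show "y \<in> cls Ms x"
    unfolding tensor_class_def r_coset_def teq_def by (auto intro!: bexI[of _ "y - x"])
qed (auto simp: tensor_class_def r_coset_def teq_def)

lemma tensor_class_eq_iff:
  assumes "bimods Ms"
  shows "cls Ms x = cls Ms y \<longleftrightarrow> teq Ms x y"
  unfolding set_eq_iff mem_tensor_class using teq_trans teq_sym[OF _ assms] teq_refl by metis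

lemma carrier_tensor: "carrier (tensor R Ms) = cls Ms ` frags Ms"
  unfolding tensor_def FactGroup_def RCOSETS_def tensor_class_def frags_def by auto

lemma mult_tensor:
  assumes "bimods Ms"
  shows "cls Ms x \<otimes>\<^bsub>tensor R Ms\<^esub> cls Ms y = cls Ms (x + y)"
proof -
  have "\<exists>a\<in>cls Ms x. \<exists>b\<in>cls Ms y. z = a + b"
    if "teq Ms z (x + y)" for z
    by (rule bexI[of _ "z - y"], rule bexI[of _ y])
      (use that in \<open>simp_all add: mem_tensor_class teq_def diff_diff_eq add.commute\<close>)
  then show ?thesis
    unfolding tensor_def FactGroup_def set_mult_def
    by (auto simp: mem_tensor_class intro: teq_add)
qed

lemma one_tensor: "\<one>\<^bsub>tensor R Ms\<^esub> = cls Ms 0"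
  by (auto simp: tensor_def FactGroup_def mem_tensor_class teq_def)

lemma induced_tensor_class:
  assumes "respectful Ms Ns phi" "bimods Ns"
  shows "induced R Ns phi (cls Ms x) = cls Ns (lin phi x)"
proof -
  have "(SOME y. y \<in> cls Ms x) \<in> cls Ms x"
    by (rule someI[of _ x]) (simp add: mem_tensor_class)
  then show ?thesis
    using assms by (simp add: induced_def mem_tensor_class tensor_class_eq_iff respectful_teq)
qed

definition commutes :: "(('r, 'u) bimod \<Rightarrow> 'u \<Rightarrow> 'u) \<Rightarrow> (('r, 'u) bimod \<Rightarrow> 'u \<Rightarrow> 'u) \<Rightarrow> bool" where
  "commutes op op' \<longleftrightarrow>
    (\<forall>M. env_bimodule R M \<longrightarrow> (\<forall>m\<in>carrier M. op M (op' M m) = op' M (op M m)))"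

lemma commutes_sym: "commutes op op' \<Longrightarrow> commutes op' op"
  by (simp add: commutes_def)

lemma commutes_actions:
  assumes r: "r \<in> carrier R" and s: "s \<in> carrier R"
  shows "commutes (Lact r) (Lbar s)" (is ?A)
    "commutes (Lact r) (Ract s)" (is ?B)
    "commutes (Lact r) (Rbar s)" (is ?C)
    "commutes (Lbar r) (Ract s)" (is ?D)
    "commutes (Lbar r) (Rbar s)" (is ?E)
    "commutes (Ract r) (Rbar s)" (is ?F)
proof -
  have *: "lact M r (lbar M s m) = lbar M s (lact M r m) \<and>
    lact M r (ract M m s) = ract M (lact M r m) s \<and> lact M r (rbar M m s) = rbar M (lact M r m) s \<and>
    lbar M r (ract M m s) = ract M (lbar M r m) s \<and> lbar M r (rbar M m s) = rbar M (lbar M r m) s \<and>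
    ract M (rbar M m s) r = rbar M (ract M m r) s"
    if M: "env_bimodule R M" and m: "m \<in> carrier M" for M :: "('r, 'u) bimod" and m
  proof -
    interpret env_bimodule R M by fact
    show ?thesis
      using r s m by (simp add: lact_lbar lact_ract lact_rbar lbar_ract lbar_rbar ract_rbar)
  qed
  show ?A ?B ?C ?D ?E ?F
    unfolding commutes_def by (intro allI ballI impI, drule (1) *, elim conjE, assumption)+
qed

lemma op_at_commute':
  assumes "x \<in> frags Ms" "bimods Ms" "i < length Ms" "i = j \<Longrightarrow> commutes op op'"
  shows "op_at Ms op i (op_at Ms op' j x) = op_at Ms op' j (op_at Ms op i x)"
proof (cases "i = j")
  case True
  then show ?thesis
    using assms op_at_op_at[OF assms(1,3), of op op'] op_at_op_at[OF assms(1,3), of op' op]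
    by (auto intro!: op_at_cong simp: commutes_def bimods_nth)
qed (simp add: op_at_commute assms(1))

lemma frag_extend_act_at: "lin (act_at j (op (Ms ! j))) = op_at Ms op j"
  by (simp add: op_at_def fun_eq_iff)

lemma respectful_op_at:
  assumes bim: "bimods Ms" and i: "i < length Ms" and op: "additive_op op"
    and L: "\<And>r. r \<in> carrier R \<Longrightarrow> 0 < i \<Longrightarrow> commutes op (Lact r)"
    and Lb: "\<And>r. r \<in> carrier R \<Longrightarrow> Suc i < length Ms \<Longrightarrow> commutes op (Lbar r)"
  shows "respectful Ms Ms (act_at i (op (Ms ! i)))"
proof (rule respectfulI[OF bim bim])
  fix t assume "t \<in> tuples Ms"
  then show "act_at i (op (Ms ! i)) t \<in> frags Ms"
    using op_at_closed[OF op bim i, of "frag_of t"] by (simp add: op_at_frag_of act_at_def)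
next
  fix t j x y
  assume *: "t \<in> tuples Ms" "j < length Ms" "x \<in> carrier (Ms ! j)" "y \<in> carrier (Ms ! j)"
  then have t': "t[i := op (Ms ! i) (t ! i)] \<in> tuples Ms"
    using i op by (auto intro!: tuples_update simp: additive_op_def bimods_nth[OF bim] tuples_nth)
  show "teq Ms (act_at i (op (Ms ! i)) (t[j := x \<oplus>\<^bsub>Ms ! j\<^esub> y]))
      (act_at i (op (Ms ! i)) (t[j := x]) + act_at i (op (Ms ! i)) (t[j := y]))"
  proof (cases "i = j")
    case True
    then show ?thesis
      using teq_additive[OF *(1,2), of "op (Ms ! j) x" "op (Ms ! j) y"] * op i bim
      by (simp add: act_at_def additive_op_def bimods_nth tuples_length)
  next
    case False
    then show ?thesis
      using teq_additive[OF t' *(2,3,4)] by (simp add: act_at_def list_update_swap)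
  qed
next
  fix t j r assume *: "t \<in> tuples Ms" "Suc j < length Ms" "r \<in> carrier R"
  have "teq Ms (op_at Ms op i (op_at Ms (Lbar r) j (frag_of t)))
     (op_at Ms op i (op_at Ms (Lact r) (Suc j) (frag_of t)))"
    using teq_balanced[OF op_at_closed[OF op bim i] *(2,3) bim, of "frag_of t"] * i bim
      op_at_commute'[of "frag_of t" Ms i j op "Lbar r"] op_at_commute'[of "frag_of t" Ms i "Suc j" op "Lact r"]
      L[OF *(3)] Lb[OF *(3)]
    by simp
  then show "teq Ms (lin (act_at i (op (Ms ! i))) (op_at Ms (Lbar r) j (frag_of t)))
     (lin (act_at i (op (Ms ! i))) (op_at Ms (Lact r) (Suc j) (frag_of t)))"
    unfolding frag_extend_act_at .
qed

lemma respectful_right_actions: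
  assumes "bimods Ms" "j < length Ms" "s \<in> carrier R"
  shows "respectful Ms Ms (act_at j (Ract s (Ms ! j)))" "respectful Ms Ms (act_at j (Rbar s (Ms ! j)))"
  using assms
  by (auto intro!: respectful_op_at[of _ _ "Ract s"] respectful_op_at[of _ _ "Rbar s"]
      additive_actions commutes_actions intro: commutes_sym[OF commutes_actions(2)]
      commutes_sym[OF commutes_actions(3)] commutes_sym[OF commutes_actions(4)]
      commutes_sym[OF commutes_actions(5)])

definition rfrags :: "('r, 'u) bimod list \<Rightarrow> ('u list \<Rightarrow>\<^sub>0 int) set" where
  "rfrags Ms = {x \<in> frags Ms. \<forall>s\<in>carrier R. \<forall>j. Suc j < length Ms \<longrightarrow>
     teq Ms (op_at Ms (Rbar s) j x) (op_at Ms (Ract s) (Suc j) x)}"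

lemma restricted_eq:
  assumes "bimods Ms"
  shows "restricted R Ms = cls Ms ` rfrags Ms"
proof -
  have "induced R Ms (act_at j (\<lambda>m. rbar (Ms ! j) m s)) (cls Ms x) =
        induced R Ms (act_at (Suc j) (\<lambda>m. ract (Ms ! Suc j) m s)) (cls Ms x)
      \<longleftrightarrow> teq Ms (op_at Ms (Rbar s) j x) (op_at Ms (Ract s) (Suc j) x)"
    if "s \<in> carrier R" "Suc j < length Ms" for s j x
    using respectful_right_actions[OF assms _ that(1), of j]
      respectful_right_actions[OF assms that(2,1)] that(2) assms
    by (simp add: induced_tensor_class tensor_class_eq_iff op_at_def)
  then have "(\<forall>s\<in>carrier R. \<forall>j. Suc j < length Ms \<longrightarrow>
        induced R Ms (act_at j (\<lambda>m. rbar (Ms ! j) m s)) (cls Ms x) =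
        induced R Ms (act_at (Suc j) (\<lambda>m. ract (Ms ! Suc j) m s)) (cls Ms x))
      \<longleftrightarrow> (\<forall>s\<in>carrier R. \<forall>j. Suc j < length Ms \<longrightarrow>
        teq Ms (op_at Ms (Rbar s) j x) (op_at Ms (Ract s) (Suc j) x))" for x
    by blast
  then show ?thesis
    unfolding restricted_def rfrags_def carrier_tensor by fast
qed

lemma rfrags_singleton: "rfrags [M] = frags [M]"
  by (simp add: rfrags_def)

lemma rfrags_subset: "x \<in> rfrags Ms \<Longrightarrow> x \<in> frags Ms"
  by (simp add: rfrags_def)

lemma teq_op_at_right_actions:
  assumes "bimods Ms" "j < length Ms" "s \<in> carrier R" "teq Ms x y"
  shows "teq Ms (op_at Ms (Ract s) j x) (op_at Ms (Ract s) j y)"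
    "teq Ms (op_at Ms (Rbar s) j x) (op_at Ms (Rbar s) j y)"
  using respectful_teq[OF respectful_right_actions(1)[OF assms(1-3)] assms(4)]
    respectful_teq[OF respectful_right_actions(2)[OF assms(1-3)] assms(4)]
  by (simp_all add: op_at_def)

lemma rfrags_teq:
  assumes bim: "bimods Ms" and x: "x \<in> rfrags Ms" and "teq Ms y x"
  shows "y \<in> rfrags Ms"
proof -
  have "teq Ms (op_at Ms (Rbar s) j y) (op_at Ms (Ract s) (Suc j) y)"
    if s: "s \<in> carrier R" and j: "Suc j < length Ms" for s j
  proof -
    have "teq Ms (op_at Ms (Rbar s) j y) (op_at Ms (Rbar s) j x)"
      by (rule teq_op_at_right_actions) (use assms s j in auto)
    also have "teq Ms \<dots> (op_at Ms (Ract s) (Suc j) x)"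
      using x s j by (simp add: rfrags_def)
    also have "teq Ms \<dots> (op_at Ms (Ract s) (Suc j) y)"
      by (rule teq_op_at_right_actions) (use assms s j in \<open>auto intro: teq_sym\<close>)
    finally show ?thesis .
  qed
  then show ?thesis
    using teq_frags[OF assms(3) bim] x by (simp add: rfrags_def)
qed

lemma rfrags_0: "0 \<in> rfrags Ms"
  by (simp add: rfrags_def)

lemma rfrags_add:
  "x \<in> rfrags Ms \<Longrightarrow> y \<in> rfrags Ms \<Longrightarrow> x + y \<in> rfrags Ms"
  by (simp add: rfrags_def op_at_add frags_add teq_add)

lemma rfrags_diff:
  "bimods Ms \<Longrightarrow> x \<in> rfrags Ms \<Longrightarrow> y \<in> rfrags Ms
    \<Longrightarrow> x - y \<in> rfrags Ms"
  by (simp add: rfrags_def op_at_diff frags_diff teq_diff)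

definition end_op :: "('r, 'u) bimod list \<Rightarrow> (('r, 'u) bimod \<Rightarrow> 'u \<Rightarrow> 'u) \<Rightarrow> nat \<Rightarrow> bool" where
  "end_op Ms op i \<longleftrightarrow> additive_op op \<and> i < length Ms \<and> (\<forall>r\<in>carrier R.
     (0 < i \<longrightarrow> commutes op (Lact r) \<and> commutes op (Ract r)) \<and>
     (Suc i < length Ms \<longrightarrow> commutes op (Lbar r) \<and> commutes op (Rbar r)))"

lemma end_op_actions:
  assumes "Ms \<noteq> []" "r \<in> carrier R"
  shows "end_op Ms (Lact r) 0" "end_op Ms (Lbar r) (length Ms - 1)"
    "end_op Ms (Ract r) 0" "end_op Ms (Rbar r) (length Ms - 1)"
  using assms
  by (auto simp: end_op_def intro: additive_actions commutes_actions commutes_sym[OF commutes_actions(1)]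
      commutes_sym[OF commutes_actions(2)]
      commutes_sym[OF commutes_actions(3)] commutes_sym[OF commutes_actions(4)]
      commutes_sym[OF commutes_actions(5)] commutes_sym[OF commutes_actions(6)])

lemma end_op_respectful: "bimods Ms \<Longrightarrow> end_op Ms op i \<Longrightarrow> respectful Ms Ms (act_at i (op (Ms ! i)))"
  by (rule respectful_op_at) (auto simp: end_op_def)

lemma end_op_teq:
  "bimods Ms \<Longrightarrow> end_op Ms op i \<Longrightarrow> teq Ms x y \<Longrightarrow> teq Ms (op_at Ms op i x) (op_at Ms op i y)"
  using respectful_teq[OF end_op_respectful] by (simp add: frag_extend_act_at)

lemma end_op_frags: "bimods Ms \<Longrightarrow> end_op Ms op i \<Longrightarrow> x \<in> frags Ms \<Longrightarrow> op_at Ms op i x \<in> frags Ms"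
  by (rule op_at_closed) (auto simp: end_op_def)

lemma end_op_restricted:
  assumes bim: "bimods Ms" and op: "end_op Ms op i" and x: "x \<in> rfrags Ms"
  shows "op_at Ms op i x \<in> rfrags Ms"
proof -
  have "teq Ms (op_at Ms (Rbar s) j (op_at Ms op i x)) (op_at Ms (Ract s) (Suc j) (op_at Ms op i x))"
    if s: "s \<in> carrier R" and j: "Suc j < length Ms" for s j
  proof -
    have "op_at Ms op i (op_at Ms (Rbar s) j x) = op_at Ms (Rbar s) j (op_at Ms op i x)"
      "op_at Ms op i (op_at Ms (Ract s) (Suc j) x) = op_at Ms (Ract s) (Suc j) (op_at Ms op i x)"
      using op s j x bim by (auto intro!: op_at_commute' simp: rfrags_def end_op_def)
    then show ?thesis
      using end_op_teq[OF bim op, of "op_at Ms (Rbar s) j x" "op_at Ms (Ract s) (Suc j) x"] x s j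
      by (simp add: rfrags_def)
  qed
  then show ?thesis using x end_op_frags[OF bim op] by (simp add: rfrags_def)
qed


section \<open>Tensor products with a single factor\<close>

lemma frags_singleton_rep:
  assumes M: "env_bimodule R M" and x: "x \<in> frags [M]"
  shows "\<exists>m\<in>carrier M. teq [M] x (frag_of [m])"
proof -
  interpret env_bimodule R M by fact
  have add: "teq [M] (frag_of [m \<oplus>\<^bsub>M\<^esub> n]) (frag_of [m] + frag_of [n])"
    if "m \<in> carrier M" "n \<in> carrier M" for m n
    using teq_additive[of "[m]" "[M]" 0 m n] that by simp
  show ?thesis
    using x
  proof (induction x rule: frags_induct)
    case zero
    have "teq [M] (frag_of [\<zero>\<^bsub>M\<^esub>] + 0) (frag_of [\<zero>\<^bsub>M\<^esub>] + frag_of [\<zero>\<^bsub>M\<^esub>])"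
      using add[of "\<zero>\<^bsub>M\<^esub>" "\<zero>\<^bsub>M\<^esub>"] by simp
    then have "teq [M] 0 (frag_of [\<zero>\<^bsub>M\<^esub>])" by (simp add: teq_def)
    then show ?case by blast
  next
    case (diff x y)
    then obtain m n where m: "m \<in> carrier M" "teq [M] x (frag_of [m])"
      and n: "n \<in> carrier M" "teq [M] y (frag_of [n])" by blast
    have "m \<ominus>\<^bsub>M\<^esub> n \<oplus>\<^bsub>M\<^esub> n = m"
      using m n by (simp add: M.minus_eq M.a_assoc M.l_neg)
    then have "teq [M] (frag_of [m]) (frag_of [m \<ominus>\<^bsub>M\<^esub> n] + frag_of [n])"
      using add[of "m \<ominus>\<^bsub>M\<^esub> n" n] m n by simp
    then have "teq [M] (x - y) (frag_of [m \<ominus>\<^bsub>M\<^esub> n] + frag_of [n] - frag_of [n])"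
      by (intro teq_diff teq_trans[OF m(2)] n(2)) (use M in auto)
    then show ?case using m n by (auto intro: bexI[of _ "m \<ominus>\<^bsub>M\<^esub> n"])
  qed auto
qed

lemma frags_singleton_inj:
  assumes M: "env_bimodule R M" and mn: "m \<in> carrier M" "n \<in> carrier M"
    and teq: "teq [M] (frag_of [m]) (frag_of [n])"
  shows "m = n"
proof -
  interpret env_bimodule R M by fact
  obtain h where h: "h \<in> Group.hom (free_Abelian_group (tuples [M])) (add_monoid M)"
    and h_of: "\<And>t. t \<in> tuples [M] \<Longrightarrow> h (frag_of t) = hd t"
    by (rule comm_group.free_Abelian_group_universal[OF M.a_comm_group, of hd "tuples [M]"]) auto
  have h_closed: "h x \<in> carrier M" if "x \<in> frags [M]" for x
    using h that by (auto simp: Group.hom_def frags_def)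
  have h_add: "h (x + y) = h x \<oplus>\<^bsub>M\<^esub> h y" if "x \<in> frags [M]" "y \<in> frags [M]" for x y
    using h that by (auto simp: Group.hom_def frags_def)
  have cancel: "u = \<zero>\<^bsub>M\<^esub>" if "u \<oplus>\<^bsub>M\<^esub> v = v" "u \<in> carrier M" "v \<in> carrier M" for u v
    using that by (metis M.a_comm M.add.l_cancel_one)
  have h_0: "h 0 = \<zero>\<^bsub>M\<^esub>"
    using h_add[of 0 0] h_closed[of 0] cancel by simp
  have h_rel: "h x = \<zero>\<^bsub>M\<^esub>" if rel: "x \<in> tensor_relations R [M]" for x
  proof -
    from rel obtain u v where uv: "u \<in> carrier M" "v \<in> carrier M"
      and x: "x = frag_of [u \<oplus>\<^bsub>M\<^esub> v] - frag_of [u] - frag_of [v]"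
      unfolding tensor_relations_def by auto
    have xf: "x \<in> frags [M]" using tensor_relations_frags[OF _ rel] M by simp
    have "h (x + (frag_of [u] + frag_of [v])) = h x \<oplus>\<^bsub>M\<^esub> (u \<oplus>\<^bsub>M\<^esub> v)"
      using xf uv by (simp add: h_add frags_add h_of)
    moreover have "x + (frag_of [u] + frag_of [v]) = frag_of [u \<oplus>\<^bsub>M\<^esub> v]" using x by simp
    ultimately show ?thesis using uv cancel[of "h x" "u \<oplus>\<^bsub>M\<^esub> v"] h_closed[OF xf] by (simp add: h_of)
  qed
  have "x \<in> frags [M] \<and> h x = \<zero>\<^bsub>M\<^esub>" if "x \<in> ker [M]" for x
    using that
  proof (rule kernel_induct)
    fix x assume rel: "x \<in> tensor_relations R [M]"
    have xf: "x \<in> frags [M]" using tensor_relations_frags[OF _ rel] M by simp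
    show "x \<in> frags [M] \<and> h x = \<zero>\<^bsub>M\<^esub>" using xf h_rel[OF rel] by simp
    have "h (- x) \<oplus>\<^bsub>M\<^esub> h x = \<zero>\<^bsub>M\<^esub>"
      using h_add[OF frags_minus[OF xf] xf] h_0 by simp
    then show "- x \<in> frags [M] \<and> h (- x) = \<zero>\<^bsub>M\<^esub>"
      using xf h_rel[OF rel] h_closed[OF frags_minus[OF xf]] by (simp add: frags_minus)
  qed (use M in \<open>auto simp: h_0 h_add frags_add\<close>)
  then have *: "frag_of [m] - frag_of [n] \<in> frags [M]" "h (frag_of [m] - frag_of [n]) = \<zero>\<^bsub>M\<^esub>"
    using teq by (simp_all add: teq_def)
  show ?thesis
    using h_add[OF *(1), of "frag_of [n]"] * mn by (simp add: h_of)
qed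


section \<open>Encoding of classes\<close>

lemma frag_of_list_append: "frag_of_list (l @ l') = frag_of_list l + frag_of_list l'"
  by (simp add: frag_of_list_def)

lemma frag_of_list_negate: "frag_of_list (map (\<lambda>(k, t). (- k, t)) l) = - frag_of_list l"
  by (induction l) (auto simp: frag_of_list_def)

lemma frag_of_list_surj: "\<exists>l. frag_of_list l = x"
proof (induction x rule: frag_induction[OF subset_UNIV])
  case 1
  show ?case by (rule exI[of _ "[]"]) (simp add: frag_of_list_def)
next
  case (2 t)
  show ?case by (rule exI[of _ "[(1, t)]"]) (simp add: frag_of_list_def)
next
  case (3 x y)
  then obtain l l' where "frag_of_list l = x" "frag_of_list l' = y" by blast
  then have "frag_of_list (l @ map (\<lambda>(k, t). (- k, t)) l') = x - y"
    by (simp add: frag_of_list_append frag_of_list_negate)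
  then show ?case ..
qed

definition val :: "('r, ('a, 'r) elt) bimod list \<Rightarrow> (('a, 'r) elt list \<Rightarrow>\<^sub>0 int) \<Rightarrow> ('a, 'r) elt" where
  "val Ms x = encode R Ms (cls Ms x)"

definition rep :: "('r, ('a, 'r) elt) bimod list \<Rightarrow> ('a, 'r) elt \<Rightarrow> (('a, 'r) elt list \<Rightarrow>\<^sub>0 int)" where
  "rep Ms m = (SOME z. z \<in> decode R Ms m)"

lemma val_singleton:
  assumes M: "env_bimodule R M" and m: "m \<in> carrier M"
  shows "val [M] (frag_of [m]) = m"
proof -
  have "(THE n. n \<in> carrier M \<and> cls [M] (frag_of [n]) = cls [M] (frag_of [m])) = m"
    using assms by (auto simp: tensor_class_eq_iff intro!: the_equality intro: frags_singleton_inj)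
  then show ?thesis by (simp add: val_def encode_def)
qed

lemma encode_inj:
  assumes bim: "bimods Ms" and ne: "Ms \<noteq> []"
  shows "inj_on (encode R Ms) (carrier (tensor R Ms))"
proof (cases "length Ms = 1")
  case True
  then obtain M where Ms: "Ms = [M]" by (auto simp: length_Suc_conv)
  have M: "env_bimodule R M" using bim Ms by simp
  have "X = cls [M] (frag_of [encode R [M] X])" if "X \<in> carrier (tensor R [M])" for X
  proof -
    obtain x where "x \<in> frags [M]" "X = cls [M] x"
      using \<open>X \<in> carrier (tensor R [M])\<close> by (auto simp: carrier_tensor)
    moreover obtain m where "m \<in> carrier M" "teq [M] x (frag_of [m])"
      using frags_singleton_rep[OF M] calculation(1) by blast
    ultimately have "m \<in> carrier M" "X = cls [M] (frag_of [m])"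
      using M by (simp_all add: tensor_class_eq_iff)
    then show ?thesis using val_singleton[OF M] by (simp add: val_def)
  qed
  then show ?thesis
    unfolding Ms by (intro inj_on_inverseI[where g = "\<lambda>m. cls [M] (frag_of [m])"]) simp
next
  case False
  have *: "frag_of_list (SOME l. frag_of_list l \<in> X) \<in> X" if "X \<in> carrier (tensor R Ms)" for X
  proof -
    obtain x where "X = cls Ms x"
      using \<open>X \<in> carrier (tensor R Ms)\<close> by (auto simp: carrier_tensor)
    then have "x \<in> X" by (simp add: mem_tensor_class)
    moreover obtain l where "frag_of_list l = x" using frag_of_list_surj by blast
    ultimately show ?thesis by (auto intro: someI[of "\<lambda>l. frag_of_list l \<in> X" l])
  qed
  show ?thesis
  proof (rule inj_onI)
    fix X Y assume XY: "X \<in> carrier (tensor R Ms)" "Y \<in> carrier (tensor R Ms)"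
      and "encode R Ms X = encode R Ms Y"
    then have "(SOME l. frag_of_list l \<in> X) = (SOME l. frag_of_list l \<in> Y)"
      using False by (simp add: encode_def)
    then obtain z where "z \<in> X" "z \<in> Y" using *[OF XY(1)] *[OF XY(2)] by metis
    then show "X = Y"
      using XY bim unfolding carrier_tensor
      by (metis (no_types, lifting) imageE mem_tensor_class tensor_class_eq_iff)
  qed
qed

lemma decode_val:
  assumes "bimods Ms" "Ms \<noteq> []" "x \<in> frags Ms"
  shows "decode R Ms (val Ms x) = cls Ms x"
  unfolding decode_def val_def
  by (rule the_inv_into_f_f[OF encode_inj]) (use assms in \<open>auto simp: carrier_tensor\<close>)

lemma val_eq_iff:
  assumes "bimods Ms" "Ms \<noteq> []" "x \<in> frags Ms" "y \<in> frags Ms"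
  shows "val Ms x = val Ms y \<longleftrightarrow> teq Ms x y"
  using decode_val[OF assms(1-3)] decode_val[OF assms(1,2,4)] tensor_class_eq_iff[OF assms(1)]
  by (metis val_def)

lemma val_cong:
  assumes "bimods Ms" "teq Ms x y"
  shows "val Ms x = val Ms y"
  using tensor_class_eq_iff[OF assms(1), THEN iffD2, OF assms(2)] by (simp add: val_def)

lemma rep_val:
  assumes "bimods Ms" "Ms \<noteq> []" "x \<in> frags Ms"
  shows "teq Ms (rep Ms (val Ms x)) x"
proof -
  have "(SOME z. z \<in> cls Ms x) \<in> cls Ms x"
    by (rule someI[of _ x]) (simp add: mem_tensor_class)
  then show ?thesis by (simp add: rep_def decode_val[OF assms] mem_tensor_class)
qed

end

lemma right_action_iff:
  "right_action S M act \<longleftrightarrow> left_action (op_ring S) M (\<lambda>r m. act m r)"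
  by (auto simp: right_action_def left_action_def op_ring_def)

context ground_ring
begin

section \<open>Products of bimodules are bimodules\<close>

lemma rprod_multi: "Suc 0 < length Ms \<Longrightarrow> rprod R Ms = multi_bimod R Ms"
  by (cases "(R, Ms)" rule: rprod.cases) auto

lemma nonempty_cases:
  assumes "Ms \<noteq> []"
  obtains (single) M where "Ms = [M]" | (multi) "Suc 0 < length Ms"
  using assms by (cases Ms rule: list.exhaust; cases "tl Ms") auto

lemma val_singleton_rep:
  assumes "env_bimodule R M" "x \<in> frags [M]"
  shows "val [M] x \<in> carrier M \<and> teq [M] x (frag_of [val [M] x])"
proof -
  obtain m where m: "m \<in> carrier M" "teq [M] x (frag_of [m])"
    using frags_singleton_rep[OF assms] by blast
  then have "val [M] x = m" using val_cong[of "[M]"] val_singleton[OF assms(1)] assms(1) by simp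
  with m show ?thesis by simp
qed

lemma val_op_at_singleton:
  assumes M: "env_bimodule R M" and op: "end_op [M] op 0" and x: "x \<in> frags [M]"
  shows "val [M] (op_at [M] op 0 x) = op M (val [M] x)"
proof -
  note v = val_singleton_rep[OF M x]
  have "teq [M] (op_at [M] op 0 x) (frag_of [op M (val [M] x)])"
    using end_op_teq[OF _ op conjunct2[OF v]] M by (simp add: op_at_frag_of)
  moreover have "op M (val [M] x) \<in> carrier M"
    using op v M by (simp add: end_op_def additive_op_def)
  ultimately show ?thesis using val_cong[of "[M]"] val_singleton[OF M] M by simp
qed

lemma carrier_rprod:
  assumes "bimods Ms" "Ms \<noteq> []"
  shows "carrier (rprod R Ms) = val Ms ` rfrags Ms"
  using assms(2)
proof (cases rule: nonempty_cases)
  case (single M)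
  then have M: "env_bimodule R M" using assms by simp
  have "m \<in> val [M] ` frags [M]" if "m \<in> carrier M" for m
    using val_singleton[OF M that] that by (intro image_eqI[of _ _ "frag_of [m]"]) auto
  then show ?thesis
    using val_singleton_rep[OF M] single by (auto simp: rfrags_singleton)
next
  case multi
  then show ?thesis
    using assms by (simp add: rprod_multi multi_bimod_def restricted_eq val_def image_image Let_def)
qed

lemma val_closed:
  "bimods Ms \<Longrightarrow> Ms \<noteq> [] \<Longrightarrow> x \<in> rfrags Ms \<Longrightarrow> val Ms x \<in> carrier (rprod R Ms)"
  by (simp add: carrier_rprod)

lemma zero_rprod:
  assumes "bimods Ms" "Ms \<noteq> []"
  shows "\<zero>\<^bsub>rprod R Ms\<^esub> = val Ms 0"
  using assms(2)
proof (cases rule: nonempty_cases)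
  case (single M)
  then have M: "env_bimodule R M" using assms by simp
  interpret env_bimodule R M by fact
  have "teq [M] (frag_of [\<zero>\<^bsub>M\<^esub> \<oplus>\<^bsub>M\<^esub> \<zero>\<^bsub>M\<^esub>]) (frag_of [\<zero>\<^bsub>M\<^esub>] + frag_of [\<zero>\<^bsub>M\<^esub>])"
    using teq_additive[of "[\<zero>\<^bsub>M\<^esub>]" "[M]" 0 "\<zero>\<^bsub>M\<^esub>" "\<zero>\<^bsub>M\<^esub>"] by simp
  then have "teq [M] 0 (frag_of [\<zero>\<^bsub>M\<^esub>])" by (simp add: teq_def)
  then show ?thesis
    using val_cong[of "[M]" 0 "frag_of [\<zero>\<^bsub>M\<^esub>]"] single val_singleton[OF M] M by simp
next
  case multi
  then show ?thesis
    by (simp add: rprod_multi multi_bimod_def one_tensor val_def Let_def)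
qed

lemma add_rprod:
  assumes "bimods Ms" "Ms \<noteq> []" and x: "x \<in> frags Ms" and y: "y \<in> frags Ms"
  shows "val Ms x \<oplus>\<^bsub>rprod R Ms\<^esub> val Ms y = val Ms (x + y)"
  using assms(2)
proof (cases rule: nonempty_cases)
  case (single M)
  then have M: "env_bimodule R M" using assms by simp
  interpret env_bimodule R M by fact
  let ?m = "val [M] x" and ?n = "val [M] y"
  have mn: "?m \<in> carrier M" "?n \<in> carrier M" "teq [M] x (frag_of [?m])" "teq [M] y (frag_of [?n])"
    using val_singleton_rep[OF M] x y single by auto
  have "teq [M] (frag_of [?m \<oplus>\<^bsub>M\<^esub> ?n]) (frag_of [?m] + frag_of [?n])"
    using teq_additive[of "[?m]" "[M]" 0 ?m ?n] mn by simp
  from val_cong[OF _ this] have "?m \<oplus>\<^bsub>M\<^esub> ?n = val [M] (frag_of [?m] + frag_of [?n])"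
    using M mn by (simp add: val_singleton)
  also have "\<dots> = val [M] (x + y)"
    using val_cong[OF _ teq_add[OF mn(3,4)]] M by simp
  finally show ?thesis using single by simp
next
  case multi
  then show ?thesis
    using assms by (simp add: rprod_multi multi_bimod_def decode_val mult_tensor Let_def)
      (simp add: val_def)
qed

lemma actions_rprod:
  assumes bim: "bimods Ms" and ne: "Ms \<noteq> []" and x: "x \<in> frags Ms" and r: "r \<in> carrier R"
  shows "lact (rprod R Ms) r (val Ms x) = val Ms (op_at Ms (Lact r) 0 x)" (is ?lact)
    "lbar (rprod R Ms) r (val Ms x) = val Ms (op_at Ms (Lbar r) (length Ms - 1) x)" (is ?lbar)
    "ract (rprod R Ms) (val Ms x) r = val Ms (op_at Ms (Ract r) 0 x)" (is ?ract)
    "rbar (rprod R Ms) (val Ms x) r = val Ms (op_at Ms (Rbar r) (length Ms - 1) x)" (is ?rbar)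
proof -
  note ops = end_op_actions[OF ne r]
  have "?lact \<and> ?lbar \<and> ?ract \<and> ?rbar"
    using ne
  proof (cases rule: nonempty_cases)
    case (single M)
    then have M: "env_bimodule R M" using bim by simp
    show ?thesis
      using val_op_at_singleton[OF M, of "Lact r" x] val_op_at_singleton[OF M, of "Lbar r" x]
        val_op_at_singleton[OF M, of "Ract r" x] val_op_at_singleton[OF M, of "Rbar r" x]
        ops x unfolding single by simp
  next
    case multi
    show ?thesis
      using ops[THEN end_op_respectful[OF bim]]
      by (simp add: rprod_multi[OF multi] multi_bimod_def decode_val[OF bim ne x] Let_def
          induced_tensor_class[OF _ bim] frag_extend_act_at) (simp add: val_def op_at_def)
  qed
  then show ?lact ?lbar ?ract ?rbar
    by blast+
qed

lemma abelian_group_rprod: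
  assumes bim: "bimods Ms" and ne: "Ms \<noteq> []"
  shows "abelian_group (rprod R Ms)"
proof (rule abelian_groupI)
  note [simp] = add_rprod[OF assms] zero_rprod[OF assms] rfrags_subset frags_add
  fix u v w
  assume "u \<in> carrier (rprod R Ms)" "v \<in> carrier (rprod R Ms)" "w \<in> carrier (rprod R Ms)"
  then show "u \<oplus>\<^bsub>rprod R Ms\<^esub> v \<oplus>\<^bsub>rprod R Ms\<^esub> w = u \<oplus>\<^bsub>rprod R Ms\<^esub> (v \<oplus>\<^bsub>rprod R Ms\<^esub> w)"
    unfolding carrier_rprod[OF assms] by (auto simp: add.assoc)
next
  note [simp] = add_rprod[OF assms] zero_rprod[OF assms] rfrags_subset frags_add
  fix u v assume uv: "u \<in> carrier (rprod R Ms)" "v \<in> carrier (rprod R Ms)"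
  then show "u \<oplus>\<^bsub>rprod R Ms\<^esub> v \<in> carrier (rprod R Ms)"
    unfolding carrier_rprod[OF assms] by (auto intro!: imageI rfrags_add)
  show "u \<oplus>\<^bsub>rprod R Ms\<^esub> v = v \<oplus>\<^bsub>rprod R Ms\<^esub> u"
    using uv unfolding carrier_rprod[OF assms] by (auto simp: add.commute)
next
  show "\<zero>\<^bsub>rprod R Ms\<^esub> \<in> carrier (rprod R Ms)"
    unfolding carrier_rprod[OF assms] zero_rprod[OF assms] by (simp add: rfrags_0)
next
  fix u assume "u \<in> carrier (rprod R Ms)"
  then obtain x where x: "x \<in> rfrags Ms" "u = val Ms x"
    unfolding carrier_rprod[OF assms] by auto
  then show "\<zero>\<^bsub>rprod R Ms\<^esub> \<oplus>\<^bsub>rprod R Ms\<^esub> u = u"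
    by (simp add: zero_rprod[OF assms] add_rprod[OF assms] rfrags_subset)
  have "0 - x \<in> rfrags Ms"
    using bim x by (intro rfrags_diff rfrags_0)
  then show "\<exists>v\<in>carrier (rprod R Ms). v \<oplus>\<^bsub>rprod R Ms\<^esub> u = \<zero>\<^bsub>rprod R Ms\<^esub>"
    using x by (intro bexI[of _ "val Ms (0 - x)"] val_closed assms)
      (simp_all add: zero_rprod[OF assms] add_rprod[OF assms] rfrags_subset)
qed

lemma left_action_rprod:
  assumes bim: "bimods Ms" and ne: "Ms \<noteq> []"
    and S: "carrier S = carrier R" "\<And>r s. r \<in> carrier R \<Longrightarrow> s \<in> carrier R \<Longrightarrow> r \<oplus>\<^bsub>S\<^esub> s \<in> carrier R"
      "\<And>r s. r \<in> carrier R \<Longrightarrow> s \<in> carrier R \<Longrightarrow> r \<otimes>\<^bsub>S\<^esub> s \<in> carrier R" "\<one>\<^bsub>S\<^esub> \<in> carrier R"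
    and op: "\<And>r. r \<in> carrier R \<Longrightarrow> end_op Ms (op r) i"
    and left: "left_action S (Ms ! i) (\<lambda>r. op r (Ms ! i))"
    and act: "\<And>r x. r \<in> carrier R \<Longrightarrow> x \<in> frags Ms
      \<Longrightarrow> act r (val Ms x) = val Ms (op_at Ms (op r) i x)"
  shows "left_action S (rprod R Ms) act"
proof -
  interpret left: left_action S "Ms ! i" "\<lambda>r. op r (Ms ! i)" by fact
  note [simp] = add_rprod[OF assms(1,2)] act rfrags_subset end_op_frags[OF bim op]
  have i: "i < length Ms" using op[OF S(4)] by (simp add: end_op_def)
  have add_op: "additive_op (op r)" if "r \<in> carrier R" for r
    using op[OF that] by (simp add: end_op_def)
  show ?thesis
  proof
    fix r m assume r: "r \<in> carrier S" and "m \<in> carrier (rprod R Ms)"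
    then obtain x where x: "x \<in> rfrags Ms" "m = val Ms x"
      by (auto simp: carrier_rprod[OF assms(1,2)])
    show "act r m \<in> carrier (rprod R Ms)"
      using x r S by (simp add: val_closed[OF assms(1,2)] end_op_restricted[OF bim op])
  next
    fix r m n
    assume r: "r \<in> carrier S" and "m \<in> carrier (rprod R Ms)" "n \<in> carrier (rprod R Ms)"
    then obtain x y where x: "x \<in> rfrags Ms" "m = val Ms x"
      and y: "y \<in> rfrags Ms" "n = val Ms y"
      by (auto simp: carrier_rprod[OF assms(1,2)])
    show "act r (m \<oplus>\<^bsub>rprod R Ms\<^esub> n) = act r m \<oplus>\<^bsub>rprod R Ms\<^esub> act r n"
      using x y r S by (simp add: frags_add op_at_add)
  next
    fix r s m
    assume r: "r \<in> carrier S" and s: "s \<in> carrier S" and "m \<in> carrier (rprod R Ms)"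
    then obtain x where x: "x \<in> frags Ms" "m = val Ms x"
      using rfrags_subset by (auto simp: carrier_rprod[OF assms(1,2)])
    have "teq Ms (op_at Ms (op (r \<oplus>\<^bsub>S\<^esub> s)) i x) (op_at Ms (op r) i x + op_at Ms (op s) i x)"
      by (rule teq_op_at_plus) (use x i bim r s S in \<open>auto simp: add_op left.add_act\<close>)
    then show "act (r \<oplus>\<^bsub>S\<^esub> s) m = act r m \<oplus>\<^bsub>rprod R Ms\<^esub> act s m"
      using x r s S by (simp add: val_cong[OF bim])
    have "op_at Ms (op (r \<otimes>\<^bsub>S\<^esub> s)) i x = op_at Ms (op r) i (op_at Ms (op s) i x)"
      unfolding op_at_op_at[OF x(1) i]
      by (rule op_at_cong) (use x i r s S in \<open>auto simp: left.mult_act\<close>)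
    then show "act (r \<otimes>\<^bsub>S\<^esub> s) m = act r (act s m)"
      using x r s S by simp
  next
    fix m assume "m \<in> carrier (rprod R Ms)"
    then obtain x where x: "x \<in> frags Ms" "m = val Ms x"
      using rfrags_subset by (auto simp: carrier_rprod[OF assms(1,2)])
    then show "act \<one>\<^bsub>S\<^esub> m = m"
      using S op_at_id[where Ms = Ms and j = i and op = "op \<one>\<^bsub>S\<^esub>", OF x(1) left.one_act i] by simp
  qed
qed

lemma env_bimodule_rprod_nonempty:
  assumes bim: "bimods Ms" and ne: "Ms \<noteq> []"
  shows "env_bimodule R (rprod R Ms)"
proof -
  let ?P = "rprod R Ms" and ?n = "length Ms - 1"
  interpret P: abelian_group ?P by (rule abelian_group_rprod[OF assms])
  have n: "0 < length Ms" "?n < length Ms" using ne by auto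
  have ops: "left_action R M (lact M) \<and> left_action (op_ring R) M (lbar M) \<and>
      right_action R M (ract M) \<and> right_action (op_ring R) M (rbar M)" if "env_bimodule R M" for M
    using that by (simp add: env_bimodule_def)
  note left = left_action_rprod[OF assms]
  note closed = end_op_frags[OF bim end_op_actions(1)[OF ne]]
    end_op_frags[OF bim end_op_actions(2)[OF ne]] end_op_frags[OF bim end_op_actions(3)[OF ne]]
    end_op_frags[OF bim end_op_actions(4)[OF ne]]
  have acts: "left_action R ?P (lact ?P)" "left_action (op_ring R) ?P (lbar ?P)"
    "right_action R ?P (ract ?P)" "right_action (op_ring R) ?P (rbar ?P)"
    unfolding right_action_iff
    subgoal by (rule left[where op = Lact and i = 0])
        (use ops[OF bimods_nth[OF bim n(1)]] in \<open>auto intro: actions_rprod[OF assms] end_op_actions[OF ne]\<close>)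
    subgoal by (rule left[where op = Lbar and i = ?n])
        (use ops[OF bimods_nth[OF bim n(2)]] in
          \<open>auto intro: actions_rprod[OF assms] end_op_actions[OF ne]
            simp del: One_nat_def simp: op_ring_def\<close>)
    subgoal by (rule left[where op = Ract and i = 0])
        (use ops[OF bimods_nth[OF bim n(1)]] in
          \<open>auto intro: actions_rprod[OF assms] end_op_actions[OF ne]
            simp: op_ring_def right_action_iff\<close>)
    subgoal by (rule left[where op = Rbar and i = ?n])
        (use ops[OF bimods_nth[OF bim n(2)]] in
          \<open>auto intro: actions_rprod[OF assms] end_op_actions[OF ne]
            simp del: One_nat_def simp: op_ring_def right_action_iff\<close>)
    done
  have commute: "val Ms (op_at Ms op i (op_at Ms op' j x)) = val Ms (op_at Ms op' j (op_at Ms op i x))"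
    if "x \<in> frags Ms" "commutes op op'" "i < length Ms" for op op' i j x
    using op_at_commute'[OF that(1) bim that(3), of j op op'] that(2) by simp
  have "lact ?P r (lbar ?P s m) = lbar ?P s (lact ?P r m) \<and>
    ract ?P (rbar ?P m s) r = rbar ?P (ract ?P m r) s \<and>
    lact ?P r (ract ?P m s) = ract ?P (lact ?P r m) s \<and>
    lact ?P r (rbar ?P m s) = rbar ?P (lact ?P r m) s \<and>
    lbar ?P r (ract ?P m s) = ract ?P (lbar ?P r m) s \<and>
    lbar ?P r (rbar ?P m s) = rbar ?P (lbar ?P r m) s"
    if rs: "r \<in> carrier R" "s \<in> carrier R" and "m \<in> carrier ?P" for r s m
  proof -
    obtain x where x: "x \<in> frags Ms" "m = val Ms x"
      using \<open>m \<in> carrier ?P\<close> by (auto simp: carrier_rprod[OF assms] dest: rfrags_subset)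
    show ?thesis
      using x(1) rs n unfolding x(2)
      by (simp add: actions_rprod[OF assms] closed del: One_nat_def)
        (intro conjI commute commutes_actions; simp)
  qed
  then show ?thesis
    using acts P.abelian_group_axioms ring_axioms
    unfolding env_bimodule_def env_bimodule_axioms_def by blast
qed

lemma env_bimodule_End: "env_bimodule R (End_bimod R)"
proof -
  let ?E = "End_bimod R :: ('r, ('a, 'r) elt) bimod"
  let ?A = "{f \<in> carrier R \<rightarrow>\<^sub>E carrier R.
         \<forall>x\<in>carrier R. \<forall>y\<in>carrier R. f (x \<oplus>\<^bsub>R\<^esub> y) = f x \<oplus>\<^bsub>R\<^esub> f y}"
  have carrier: "carrier ?E = Endo ` ?A" by (simp add: End_bimod_def)
  have E: "u \<in> carrier ?E \<Longrightarrow> \<exists>f. u = Endo f \<and> f \<in> extensional (carrier R) \<and>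
      (\<forall>x\<in>carrier R. f x \<in> carrier R) \<and> (\<forall>x\<in>carrier R. \<forall>y\<in>carrier R. f (x \<oplus>\<^bsub>R\<^esub> y) = f x \<oplus>\<^bsub>R\<^esub> f y)" for u
    unfolding carrier by (auto simp: PiE_def Pi_def)
  have I: "Endo (\<lambda>m\<in>carrier R. g m) \<in> carrier ?E"
    if "\<And>x. x \<in> carrier R \<Longrightarrow> g x \<in> carrier R"
      "\<And>x y. x \<in> carrier R \<Longrightarrow> y \<in> carrier R \<Longrightarrow> g (x \<oplus>\<^bsub>R\<^esub> y) = g x \<oplus>\<^bsub>R\<^esub> g y" for g
    unfolding carrier using that by auto
  have ext': "restrict g (carrier R) = f"
    if "\<And>x. x \<in> carrier R \<Longrightarrow> g x = f x" "f \<in> extensional (carrier R)" for g f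
    using that by (auto simp: extensional_def restrict_def)
  have ops: "\<zero>\<^bsub>?E\<^esub> = Endo (\<lambda>m\<in>carrier R. \<zero>\<^bsub>R\<^esub>)"
     "Endo f \<oplus>\<^bsub>?E\<^esub> Endo g = Endo (\<lambda>m\<in>carrier R. f m \<oplus>\<^bsub>R\<^esub> g m)"
     "lact ?E r (Endo f) = Endo (\<lambda>m\<in>carrier R. r \<otimes>\<^bsub>R\<^esub> f m)"
     "lbar ?E r (Endo f) = Endo (\<lambda>m\<in>carrier R. f m \<otimes>\<^bsub>R\<^esub> r)"
     "ract ?E (Endo f) r = Endo (\<lambda>m\<in>carrier R. f (r \<otimes>\<^bsub>R\<^esub> m))"
     "rbar ?E (Endo f) r = Endo (\<lambda>m\<in>carrier R. f (m \<otimes>\<^bsub>R\<^esub> r))" for f g r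
    by (simp_all add: End_bimod_def)
  have grp: "abelian_group ?E"
  proof (rule abelian_groupI)
    fix u assume "u \<in> carrier ?E"
    then obtain f where f: "u = Endo f" "f \<in> extensional (carrier R)" "\<forall>x\<in>carrier R. f x \<in> carrier R"
      "\<forall>x\<in>carrier R. \<forall>y\<in>carrier R. f (x \<oplus>\<^bsub>R\<^esub> y) = f x \<oplus>\<^bsub>R\<^esub> f y" using E by blast
    show "\<exists>v\<in>carrier ?E. v \<oplus>\<^bsub>?E\<^esub> u = \<zero>\<^bsub>?E\<^esub>"
      using f by (intro bexI[of _ "Endo (\<lambda>m\<in>carrier R. \<ominus>\<^bsub>R\<^esub> f m)"] I)
        (auto simp: ops l_neg minus_add intro!: restrict_ext)
  qed (auto dest!: E simp: ops a_ac intro!: I restrict_ext ext')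
  have acts: "left_action R ?E (lact ?E)" "left_action (op_ring R) ?E (lbar ?E)"
    "right_action R ?E (ract ?E)" "right_action (op_ring R) ?E (rbar ?E)"
    by (unfold_locales; auto dest!: E simp: op_ring_def ops r_distr l_distr m_assoc a_ac
        intro!: I restrict_ext ext')+
  show ?thesis
    unfolding env_bimodule_def env_bimodule_axioms_def
    using grp acts ring_axioms
    by (auto dest!: E simp: ops m_assoc intro!: restrict_ext)
qed

lemma env_bimodule_rprod: "bimods Ms \<Longrightarrow> env_bimodule R (rprod R Ms)"
  using env_bimodule_rprod_nonempty env_bimodule_End by (cases "Ms = []") auto

end

section \<open>Categories\<close>

lemma bimod_mor_eqI: "src F = src G \<Longrightarrow> tgt F = tgt G \<Longrightarrow> fn F = fn G \<Longrightarrow> F = G"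
  by (cases F; cases G) auto

lemma Hom_bimod_category:
  "F \<in> Hom (bimod_category R) M N \<longleftrightarrow> env_bimodule R M \<and> env_bimodule R N \<and>
     src F = M \<and> tgt F = N \<and> fn F \<in> bimod_maps R M N"
  by (auto simp: Hom_def bimod_category_def)

lemma Obj_bimod_category [simp]: "M \<in> Obj (bimod_category R) \<longleftrightarrow> env_bimodule R M"
  by (simp add: bimod_category_def)

lemma Dom_Cod_bimod_category [simp]:
  "Dom (bimod_category R) = src" "Cod (bimod_category R) = tgt"
  by (simp_all add: bimod_category_def)

lemma Ident_bimod_category: "Ident (bimod_category R) M = BMor M M (\<lambda>m\<in>carrier M. m)"
  by (simp add: bimod_category_def)

lemma Ident_bimod_simps [simp]:
  "src (Ident (bimod_category R) M) = M" "tgt (Ident (bimod_category R) M) = M"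
  "fn (Ident (bimod_category R) M) = (\<lambda>m\<in>carrier M. m)"
  by (simp_all add: Ident_bimod_category)

lemma Comp_bimod_simps [simp]:
  "src (Comp (bimod_category R) G F) = src F" "tgt (Comp (bimod_category R) G F) = tgt G"
  "fn (Comp (bimod_category R) G F) = compose (carrier (src F)) (fn G) (fn F)"
  by (simp_all add: bimod_category_def)

lemma bimod_mapsD:
  assumes "f \<in> bimod_maps R M N"
  shows "f \<in> extensional (carrier M)" "\<And>m. m \<in> carrier M \<Longrightarrow> f m \<in> carrier N"
    "\<And>m n. m \<in> carrier M \<Longrightarrow> n \<in> carrier M \<Longrightarrow> f (m \<oplus>\<^bsub>M\<^esub> n) = f m \<oplus>\<^bsub>N\<^esub> f n"
    "\<And>r m. r \<in> carrier R \<Longrightarrow> m \<in> carrier M \<Longrightarrow> f (lact M r m) = lact N r (f m)"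
    "\<And>r m. r \<in> carrier R \<Longrightarrow> m \<in> carrier M \<Longrightarrow> f (lbar M r m) = lbar N r (f m)"
    "\<And>r m. r \<in> carrier R \<Longrightarrow> m \<in> carrier M \<Longrightarrow> f (ract M m r) = ract N (f m) r"
    "\<And>r m. r \<in> carrier R \<Longrightarrow> m \<in> carrier M \<Longrightarrow> f (rbar M m r) = rbar N (f m) r"
  using assms by (auto simp: bimod_maps_def PiE_def)

lemma bimod_mapsI:
  assumes "f \<in> extensional (carrier M)" "\<And>m. m \<in> carrier M \<Longrightarrow> f m \<in> carrier N"
    "\<And>m n. m \<in> carrier M \<Longrightarrow> n \<in> carrier M \<Longrightarrow> f (m \<oplus>\<^bsub>M\<^esub> n) = f m \<oplus>\<^bsub>N\<^esub> f n"
    "\<And>r m. r \<in> carrier R \<Longrightarrow> m \<in> carrier M \<Longrightarrow> f (lact M r m) = lact N r (f m)"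
    "\<And>r m. r \<in> carrier R \<Longrightarrow> m \<in> carrier M \<Longrightarrow> f (lbar M r m) = lbar N r (f m)"
    "\<And>r m. r \<in> carrier R \<Longrightarrow> m \<in> carrier M \<Longrightarrow> f (ract M m r) = ract N (f m) r"
    "\<And>r m. r \<in> carrier R \<Longrightarrow> m \<in> carrier M \<Longrightarrow> f (rbar M m r) = rbar N (f m) r"
  shows "f \<in> bimod_maps R M N"
  using assms by (auto simp: bimod_maps_def PiE_def)

lemma Hom_power_category:
  "fs \<in> Hom (power_category C n) xs ys \<longleftrightarrow>
     length fs = n \<and> xs = map (Dom C) fs \<and> ys = map (Cod C) fs \<and> set fs \<subseteq> Mor C"
  by (auto simp: Hom_def power_category_def)

lemma Hom_nth:
  assumes "set fs \<subseteq> Mor C" "i < length fs"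
  shows "fs ! i \<in> Hom C (Dom C (fs ! i)) (Cod C (fs ! i))"
  using assms by (auto simp: Hom_def)

lemma category_power_category:
  assumes "category C"
  shows "category (power_category C n)"
proof -
  interpret C: category C by fact
  have comp: "Comp C (gs ! i) (fs ! i) \<in> Hom C (Dom C (fs ! i)) (Cod C (gs ! i))"
    if "set fs \<subseteq> Mor C" "set gs \<subseteq> Mor C" "map (Cod C) fs = map (Dom C) gs" "i < length fs"
    for fs gs i
    using C.comp_hom[OF Hom_nth[OF that(1,4)]] Hom_nth[OF that(2), of i] that(3,4)
    by (metis length_map nth_map)
  show ?thesis
  proof
    fix fs assume "fs \<in> Mor (power_category C n)"
    then show "Dom (power_category C n) fs \<in> Obj (power_category C n)"
      "Cod (power_category C n) fs \<in> Obj (power_category C n)"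
      by (auto simp: power_category_def intro: C.dom_obj C.cod_obj)
  next
    fix xs assume "xs \<in> Obj (power_category C n)"
    then have xs: "length xs = n" "\<And>x. x \<in> set xs \<Longrightarrow> Ident C x \<in> Hom C x x"
      using C.ident_hom by (auto simp: power_category_def)
    then show "Ident (power_category C n) xs \<in> Hom (power_category C n) xs xs"
      unfolding Hom_power_category
      by (auto simp: power_category_def Hom_def comp_def intro!: map_idI[symmetric])
  next
    fix fs gs xs ys zs
    assume "fs \<in> Hom (power_category C n) xs ys" "gs \<in> Hom (power_category C n) ys zs"
    then have *: "set fs \<subseteq> Mor C" "set gs \<subseteq> Mor C" "map (Cod C) fs = map (Dom C) gs"
      "length fs = n" "length gs = n" "xs = map (Dom C) fs" "zs = map (Cod C) gs"
      by (auto simp: Hom_power_category)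
    have "map (Dom C) (map2 (Comp C) gs fs) = map (Dom C) fs"
      "map (Cod C) (map2 (Comp C) gs fs) = map (Cod C) gs"
      using comp[OF *(1-3)] *(4,5) by (auto intro!: nth_equalityI simp: Hom_def)
    moreover have "set (map2 (Comp C) gs fs) \<subseteq> Mor C"
      using comp[OF *(1-3)] *(4,5) by (auto simp: set_zip Hom_def)
    ultimately show "Comp (power_category C n) gs fs \<in> Hom (power_category C n) xs zs"
      using * by (simp add: Hom_power_category) (simp add: power_category_def)
  next
    fix fs xs ys assume "fs \<in> Hom (power_category C n) xs ys"
    then have *: "length fs = n" "xs = map (Dom C) fs" "ys = map (Cod C) fs" "set fs \<subseteq> Mor C"
      by (auto simp: Hom_power_category)
    show "Comp (power_category C n) (Ident (power_category C n) ys) fs = fs"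
      "Comp (power_category C n) fs (Ident (power_category C n) xs) = fs"
      using * C.comp_ident_left[OF Hom_nth[OF *(4)]] C.comp_ident_right[OF Hom_nth[OF *(4)]]
      by (auto simp: power_category_def intro!: nth_equalityI)
  next
    fix fs gs hs ws xs ys zs
    assume "fs \<in> Hom (power_category C n) ws xs" "gs \<in> Hom (power_category C n) xs ys"
      "hs \<in> Hom (power_category C n) ys zs"
    then have *: "set fs \<subseteq> Mor C" "set gs \<subseteq> Mor C" "set hs \<subseteq> Mor C"
       "map (Cod C) fs = map (Dom C) gs" "map (Cod C) gs = map (Dom C) hs"
      "length fs = n" "length gs = n" "length hs = n"
      by (auto simp: Hom_power_category)
    have "Comp C (hs ! i) (Comp C (gs ! i) (fs ! i)) = Comp C (Comp C (hs ! i) (gs ! i)) (fs ! i)"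
      if "i < n" for i
    proof (rule C.comp_assoc)
      show "fs ! i \<in> Hom C (Dom C (fs ! i)) (Dom C (gs ! i))"
        using Hom_nth[OF *(1), of i] * that by (metis length_map nth_map)
      show "gs ! i \<in> Hom C (Dom C (gs ! i)) (Dom C (hs ! i))"
        using Hom_nth[OF *(2), of i] * that by (metis length_map nth_map)
      show "hs ! i \<in> Hom C (Dom C (hs ! i)) (Cod C (hs ! i))"
        using Hom_nth[OF *(3), of i] * that by simp
    qed
    then show "Comp (power_category C n) hs (Comp (power_category C n) gs fs) =
        Comp (power_category C n) (Comp (power_category C n) hs gs) fs"
      using * by (auto simp: power_category_def intro!: nth_equalityI)
  qed
qed

context ground_ring
begin

abbreviation "ident \<equiv> Ident (bimod_category R)"
abbreviation "bcomp \<equiv> Comp (bimod_category R)"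

lemma category_bimod_category: "category (bimod_category R)"
proof
  fix F :: "('r, 'u) bimod_mor" assume "F \<in> Mor (bimod_category R)"
  then show "Dom (bimod_category R) F \<in> Obj (bimod_category R)"
    "Cod (bimod_category R) F \<in> Obj (bimod_category R)"
    by (auto simp: bimod_category_def)
next
  fix M :: "('r, 'u) bimod" assume M: "M \<in> Obj (bimod_category R)"
  then interpret env_bimodule R M by simp
  have "(\<lambda>m\<in>carrier M. m) \<in> bimod_maps R M M"
    using M by (auto intro!: bimod_mapsI simp: bimod_closed)
  then show "ident M \<in> Hom (bimod_category R) M M"
    using M by (simp add: Hom_bimod_category)
next
  fix F G :: "('r, 'u) bimod_mor" and L M N
  assume "F \<in> Hom (bimod_category R) L M" "G \<in> Hom (bimod_category R) M N"
  then have *: "env_bimodule R L" "env_bimodule R N" "src F = L" "tgt G = N"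
    "fn F \<in> bimod_maps R L M" "fn G \<in> bimod_maps R M N"
    by (auto simp: Hom_bimod_category)
  interpret L: env_bimodule R L by fact
  have "compose (carrier L) (fn G) (fn F) \<in> bimod_maps R L N"
    using bimod_mapsD[OF *(5)] bimod_mapsD[OF *(6)] *(1)
    by (intro bimod_mapsI) (auto simp: compose_def bimod_closed)
  then show "bcomp G F \<in> Hom (bimod_category R) L N"
    using * by (simp add: Hom_bimod_category)
next
  fix F :: "('r, 'u) bimod_mor" and M N
  assume "F \<in> Hom (bimod_category R) M N"
  then have *: "src F = M" "tgt F = N" "fn F \<in> bimod_maps R M N"
    by (auto simp: Hom_bimod_category)
  show "bcomp (ident N) F = F"
    "bcomp F (ident M) = F"
    using * bimod_mapsD(1,2)[OF *(3)]
    by (auto intro!: bimod_mor_eqI ext simp: compose_def extensional_def)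
next
  fix F G H :: "('r, 'u) bimod_mor" and K L M N
  assume "F \<in> Hom (bimod_category R) K L" "G \<in> Hom (bimod_category R) L M"
    "H \<in> Hom (bimod_category R) M N"
  then have *: "src F = K" "src G = L" "fn F \<in> bimod_maps R K L"
    by (auto simp: Hom_bimod_category)
  show "bcomp H (bcomp G F) =
      bcomp (bcomp H G) F"
    using * bimod_mapsD(2)[OF *(3)]
    by (auto intro!: bimod_mor_eqI ext simp: compose_def)
qed


section \<open>Morphisms induced by maps of tuples\<close>

definition tensor_map :: "('r, 'u) bimod list \<Rightarrow> ('r, 'u) bimod list
    \<Rightarrow> ('u list \<Rightarrow> ('u list \<Rightarrow>\<^sub>0 int)) \<Rightarrow> bool" where
  "tensor_map Ms Ns phi \<longleftrightarrow> respectful Ms Ns phi \<and> (\<forall>x\<in>rfrags Ms.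
     lin phi x \<in> rfrags Ns \<and> (\<forall>r\<in>carrier R.
       teq Ns (lin phi (op_at Ms (Lact r) 0 x)) (op_at Ns (Lact r) 0 (lin phi x)) \<and>
       teq Ns (lin phi (op_at Ms (Lbar r) (length Ms - 1) x))
         (op_at Ns (Lbar r) (length Ns - 1) (lin phi x)) \<and>
       teq Ns (lin phi (op_at Ms (Ract r) 0 x)) (op_at Ns (Ract r) 0 (lin phi x)) \<and>
       teq Ns (lin phi (op_at Ms (Rbar r) (length Ms - 1) x))
         (op_at Ns (Rbar r) (length Ns - 1) (lin phi x))))"

lemma tensor_map_respectful: "tensor_map Ms Ns phi \<Longrightarrow> respectful Ms Ns phi"
  by (simp add: tensor_map_def)

lemma tensor_map_restricted:
  "tensor_map Ms Ns phi \<Longrightarrow> x \<in> rfrags Ms \<Longrightarrow> lin phi x \<in> rfrags Ns"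
  by (simp add: tensor_map_def)

abbreviation "rind \<equiv> rprod_induced R"

lemma rprod_induced_simps [simp]:
  "src (rind Ms Ns phi) = rprod R Ms" "tgt (rind Ms Ns phi) = rprod R Ns"
  by (simp_all add: rprod_induced_def)

lemma rprod_induced_val:
  assumes "respectful Ms Ns phi" "bimods Ms" "bimods Ns" "Ms \<noteq> []" "x \<in> rfrags Ms"
  shows "fn (rind Ms Ns phi) (val Ms x) = val Ns (lin phi x)"
  using assms
  by (simp add: rprod_induced_def val_closed decode_val rfrags_subset induced_tensor_class)
    (simp add: val_def)

lemma rprod_induced_eqI:
  assumes "respectful Ms Ns phi" "respectful Ms Ns psi" "bimods Ms" "bimods Ns" "Ms \<noteq> []"
    and "\<And>x. x \<in> rfrags Ms \<Longrightarrow> teq Ns (lin phi x) (lin psi x)"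
  shows "rind Ms Ns phi = rind Ms Ns psi"
proof (rule bimod_mor_eqI)
  have "fn (rind Ms Ns phi) m = fn (rind Ms Ns psi) m"
    if "m \<in> carrier (rprod R Ms)" for m
    using that assms val_cong[OF assms(4)] by (auto simp: carrier_rprod rprod_induced_val)
  then show "fn (rind Ms Ns phi) = fn (rind Ms Ns psi)"
    by (auto simp: rprod_induced_def fun_eq_iff)
qed simp_all

lemma rprod_induced_hom:
  assumes phi: "tensor_map Ms Ns phi" and bim: "bimods Ms" "bimods Ns" and ne: "Ms \<noteq> []" "Ns \<noteq> []"
  shows "rind Ms Ns phi \<in> Hom (bimod_category R) (rprod R Ms) (rprod R Ns)"
proof -
  note resp = tensor_map_respectful[OF phi]
  let ?f = "fn (rind Ms Ns phi)"
  have f: "?f (val Ms x) = val Ns (lin phi x)" if "x \<in> rfrags Ms" for x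
    using rprod_induced_val[OF resp bim ne(1) that] .
  have "?f \<in> bimod_maps R (rprod R Ms) (rprod R Ns)"
  proof (rule bimod_mapsI)
    show "?f \<in> extensional (carrier (rprod R Ms))" by (simp add: rprod_induced_def)
  next
    fix m assume "m \<in> carrier (rprod R Ms)"
    then obtain x where x: "x \<in> rfrags Ms" "m = val Ms x"
      by (auto simp: carrier_rprod bim ne)
    then show "?f m \<in> carrier (rprod R Ns)"
      using f tensor_map_restricted[OF phi] val_closed[OF bim(2) ne(2)] by simp
  next
    fix m n assume "m \<in> carrier (rprod R Ms)" "n \<in> carrier (rprod R Ms)"
    then obtain x y where x: "x \<in> rfrags Ms" "m = val Ms x"
      and y: "y \<in> rfrags Ms" "n = val Ms y"
      by (auto simp: carrier_rprod bim ne)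
    then show "?f (m \<oplus>\<^bsub>rprod R Ms\<^esub> n) = ?f m \<oplus>\<^bsub>rprod R Ns\<^esub> ?f n"
      by (simp add: add_rprod bim ne f rfrags_add rfrags_subset
          respectful_frags[OF resp] frag_extend_add)
  next
    fix r m assume r: "r \<in> carrier R" and "m \<in> carrier (rprod R Ms)"
    then obtain x where x: "x \<in> rfrags Ms" "m = val Ms x"
      by (auto simp: carrier_rprod bim ne)
    note ops = end_op_restricted[OF bim(1) end_op_actions(1)[OF ne(1) r] x(1)]
      end_op_restricted[OF bim(1) end_op_actions(2)[OF ne(1) r] x(1)]
      end_op_restricted[OF bim(1) end_op_actions(3)[OF ne(1) r] x(1)]
      end_op_restricted[OF bim(1) end_op_actions(4)[OF ne(1) r] x(1)]
    have x': "x \<in> frags Ms" "lin phi x \<in> frags Ns"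
      using x(1) rfrags_subset respectful_frags[OF resp] by auto
    have "teq Ns (lin phi (op_at Ms (Lact r) 0 x)) (op_at Ns (Lact r) 0 (lin phi x))"
      "teq Ns (lin phi (op_at Ms (Lbar r) (length Ms - 1) x))
         (op_at Ns (Lbar r) (length Ns - 1) (lin phi x))"
      "teq Ns (lin phi (op_at Ms (Ract r) 0 x)) (op_at Ns (Ract r) 0 (lin phi x))"
      "teq Ns (lin phi (op_at Ms (Rbar r) (length Ms - 1) x))
         (op_at Ns (Rbar r) (length Ns - 1) (lin phi x))"
      using phi x r by (auto simp: tensor_map_def)
    note * = this[THEN val_cong[OF bim(2)]]
    show "?f (lact (rprod R Ms) r m) = lact (rprod R Ns) r (?f m)"
      "?f (lbar (rprod R Ms) r m) = lbar (rprod R Ns) r (?f m)"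
      "?f (ract (rprod R Ms) m r) = ract (rprod R Ns) (?f m) r"
      "?f (rbar (rprod R Ms) m r) = rbar (rprod R Ns) (?f m) r"
      using * ops x x' r by (simp_all add: actions_rprod bim ne f)
  qed
  then show ?thesis
    by (simp add: Hom_bimod_category env_bimodule_rprod bim)
qed

lemma rprod_induced_comp:
  assumes "tensor_map Ms Ns phi" "respectful Ns Os psi" "bimods Ms" "bimods Ns" "bimods Os"
    "Ms \<noteq> []" "Ns \<noteq> []"
  shows "bcomp (rind Ns Os psi) (rind Ms Ns phi) =
    rind Ms Os (\<lambda>t. lin psi (phi t))"
proof (rule bimod_mor_eqI)
  have r: "respectful Ms Os (\<lambda>t. lin psi (phi t))"
    using respectful_compose assms(1,2) tensor_map_respectful by blast
  have "fn (rind Ns Os psi) (fn (rind Ms Ns phi) m) =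
      fn (rind Ms Os (\<lambda>t. lin psi (phi t))) m" if "m \<in> carrier (rprod R Ms)" for m
    using that assms r tensor_map_restricted[OF assms(1)] tensor_map_respectful[OF assms(1)]
    by (auto simp: carrier_rprod rprod_induced_val frag_extend_frag_extend)
  then show "fn (bcomp (rind Ns Os psi) (rind Ms Ns phi)) =
    fn (rind Ms Os (\<lambda>t. lin psi (phi t)))"
    by (auto simp: compose_def fun_eq_iff) (auto simp: rprod_induced_def)
qed simp_all

lemma tensor_map_frag_of: "tensor_map Ms Ms frag_of"
  by (simp add: tensor_map_def respectful_def frag_extend_id)

lemma rprod_induced_frag_of:
  assumes "bimods Ms" "Ms \<noteq> []"
  shows "rind Ms Ms frag_of = ident (rprod R Ms)"
proof (rule bimod_mor_eqI)
  have "fn (rind Ms Ms frag_of) m = m" if "m \<in> carrier (rprod R Ms)" for m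
    using that rprod_induced_val[OF tensor_map_respectful[OF tensor_map_frag_of] assms(1,1,2)]
    by (auto simp: carrier_rprod[OF assms] frag_extend_id)
  then show "fn (rind Ms Ms frag_of) = fn (ident (rprod R Ms))"
    by (auto simp: fun_eq_iff) (auto simp: rprod_induced_def)
qed simp_all

lemma rprod_induced_Ident:
  assumes "respectful Ms Ms phi" "bimods Ms" "Ms \<noteq> []" "\<And>t. t \<in> tuples Ms \<Longrightarrow> teq Ms (phi t) (frag_of t)"
  shows "rind Ms Ms phi = ident (rprod R Ms)"
proof -
  have "teq Ms (lin phi x) (lin frag_of x)" if "x \<in> rfrags Ms" for x
    by (rule teq_extend_cong[OF rfrags_subset[OF that] assms(2,4)])
  then show ?thesis
    using rprod_induced_eqI[OF assms(1) tensor_map_respectful[OF tensor_map_frag_of] assms(2,2,3)] assms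
    by (simp add: rprod_induced_frag_of)
qed


section \<open>The product functors\<close>

abbreviation map_tuple :: "('r, 'u) bimod_mor list \<Rightarrow> 'u list \<Rightarrow> ('u list \<Rightarrow>\<^sub>0 int)" where
  "map_tuple Fs t \<equiv> frag_of (map2 fn Fs t)"

abbreviation mors :: "('r, 'u) bimod_mor list \<Rightarrow> bool" where
  "mors Fs \<equiv> set Fs \<subseteq> Mor (bimod_category R)"

lemma mors_nth:
  assumes "mors Fs" "j < length Fs"
  shows "env_bimodule R (src (Fs ! j))" "env_bimodule R (tgt (Fs ! j))"
    "fn (Fs ! j) \<in> bimod_maps R (src (Fs ! j)) (tgt (Fs ! j))"
  using subsetD[OF assms(1) nth_mem[OF assms(2)]] by (simp_all add: bimod_category_def)

lemma mors_bimods: "mors Fs \<Longrightarrow> bimods (map src Fs)" "mors Fs \<Longrightarrow> bimods (map tgt Fs)"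
  by (auto simp: bimods_def bimod_category_def)

lemma map2_update:
  "j < length xs \<Longrightarrow> length xs = length ys \<Longrightarrow> map2 f xs (ys[j := v]) = (map2 f xs ys)[j := f (xs ! j) v]"
  by (rule nth_equalityI) (auto simp: nth_list_update)

lemma map_tuple_tuples:
  assumes "mors Fs" "t \<in> tuples (map src Fs)"
  shows "map2 fn Fs t \<in> tuples (map tgt Fs)"
  using assms tuples_length[OF assms(2)] tuples_nth[OF assms(2)]
  by (auto simp: tuples_iff list_all2_conv_all_nth intro!: bimod_mapsD(2)[OF mors_nth(3)])

lemma map_tuple_op_at:
  assumes Fs: "mors Fs" and x: "x \<in> frags (map src Fs)" and j: "j < length Fs"
    and op: "\<And>m. m \<in> carrier (src (Fs ! j))
      \<Longrightarrow> fn (Fs ! j) (op (src (Fs ! j)) m) = op (tgt (Fs ! j)) (fn (Fs ! j) m)"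
  shows "lin (map_tuple Fs) (op_at (map src Fs) op j x) =
    op_at (map tgt Fs) op j (lin (map_tuple Fs) x)"
  using x
proof (induction x rule: frags_induct)
  case (tuple t)
  with j show ?case
    using op[of "t ! j"] tuples_nth[OF tuple, of j] tuples_length[OF tuple]
    by (simp add: op_at_frag_of map2_update)
qed (simp_all add: op_at_diff frag_extend_diff)

lemma respectful_map_tuple:
  assumes Fs: "mors Fs"
  shows "respectful (map src Fs) (map tgt Fs) (map_tuple Fs)"
proof (rule respectfulI)
  fix t j x y assume *: "t \<in> tuples (map src Fs)" "j < length (map src Fs)"
    "x \<in> carrier (map src Fs ! j)" "y \<in> carrier (map src Fs ! j)"
  then show "teq (map tgt Fs) (map_tuple Fs (t[j := x \<oplus>\<^bsub>map src Fs ! j\<^esub> y]))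
      (map_tuple Fs (t[j := x]) + map_tuple Fs (t[j := y]))"
    using teq_additive[OF map_tuple_tuples[OF Fs *(1)], of j "fn (Fs ! j) x" "fn (Fs ! j) y"]
      bimod_mapsD(2,3)[OF mors_nth(3)[OF Fs, of j]] tuples_length[OF *(1)]
    by (simp add: map2_update)
next
  fix t j r assume *: "t \<in> tuples (map src Fs)" "Suc j < length (map src Fs)" "r \<in> carrier R"
  then show "teq (map tgt Fs)
      (lin (map_tuple Fs) (op_at (map src Fs) (Lbar r) j (frag_of t)))
      (lin (map_tuple Fs) (op_at (map src Fs) (Lact r) (Suc j) (frag_of t)))"
    using teq_balanced[of "map_tuple Fs t" "map tgt Fs" j r] mors_bimods[OF Fs]
      map_tuple_op_at[OF Fs, of "frag_of t" j "Lbar r"] map_tuple_op_at[OF Fs, of "frag_of t" "Suc j" "Lact r"]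
      bimod_mapsD(5)[OF mors_nth(3)[OF Fs, of j]] bimod_mapsD(4)[OF mors_nth(3)[OF Fs, of "Suc j"]]
      map_tuple_tuples[OF Fs *(1)]
    by simp
qed (use mors_bimods[OF Fs] map_tuple_tuples[OF Fs] in auto)

lemma tensor_map_map_tuple:
  assumes Fs: "mors Fs" and ne: "Fs \<noteq> []"
  shows "tensor_map (map src Fs) (map tgt Fs) (map_tuple Fs)"
proof -
  let ?T = "lin (map_tuple Fs)"
  note resp = respectful_map_tuple[OF Fs]
  have T: "?T (op_at (map src Fs) (Lact r) j x) = op_at (map tgt Fs) (Lact r) j (?T x)"
    "?T (op_at (map src Fs) (Lbar r) j x) = op_at (map tgt Fs) (Lbar r) j (?T x)"
    "?T (op_at (map src Fs) (Ract r) j x) = op_at (map tgt Fs) (Ract r) j (?T x)"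
    "?T (op_at (map src Fs) (Rbar r) j x) = op_at (map tgt Fs) (Rbar r) j (?T x)"
    if "r \<in> carrier R" "j < length Fs" "x \<in> frags (map src Fs)" for r j x
    using map_tuple_op_at[OF Fs that(3,2)] bimod_mapsD(4-7)[OF mors_nth(3)[OF Fs that(2)] that(1)]
    by simp_all
  have "?T x \<in> rfrags (map tgt Fs)" if x: "x \<in> rfrags (map src Fs)" for x
  proof -
    have "teq (map tgt Fs) (op_at (map tgt Fs) (Rbar s) j (?T x)) (op_at (map tgt Fs) (Ract s) (Suc j) (?T x))"
      if "s \<in> carrier R" "Suc j < length Fs" for s j
      using respectful_teq[OF resp, of "op_at (map src Fs) (Rbar s) j x"
        "op_at (map src Fs) (Ract s) (Suc j) x"] x that T[of s j x] T[of s "Suc j" x]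
      by (simp add: rfrags_def)
    then show ?thesis
      using x respectful_frags[OF resp] by (simp add: rfrags_def)
  qed
  moreover have "length Fs - 1 < length Fs" using ne by simp
  ultimately show ?thesis
    unfolding tensor_map_def using resp T ne by (auto simp: rfrags_subset)
qed

lemma rprod_mor_nonempty:
  "Fs \<noteq> [] \<Longrightarrow> rprod_mor R Fs = rind (map src Fs) (map tgt Fs) (map_tuple Fs)"
  by (simp add: rprod_mor_def)

lemma rprod_mor_Nil: "rprod_mor R [] = ident (End_bimod R)"
  by (simp add: rprod_mor_def)

lemma Ident_hom: "env_bimodule R M \<Longrightarrow> ident M \<in> Hom (bimod_category R) M M"
  using category.ident_hom[OF category_bimod_category] by simp

lemma rprod_mor_hom:
  assumes "mors Fs"
  shows "rprod_mor R Fs \<in> Hom (bimod_category R) (rprod R (map src Fs)) (rprod R (map tgt Fs))"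
proof (cases "Fs = []")
  case True
  then show ?thesis using Ident_hom[OF env_bimodule_End] by (simp add: rprod_mor_Nil)
next
  case False
  then show ?thesis
    using rprod_induced_hom[OF tensor_map_map_tuple[OF assms False] mors_bimods[OF assms]]
    by (simp add: rprod_mor_nonempty)
qed

lemma rprod_mor_Ident:
  assumes "bimods Ms"
  shows "rprod_mor R (map (ident) Ms) = ident (rprod R Ms)"
proof (cases "Ms = []")
  case False
  let ?Fs = "map (ident) Ms"
  have Fs: "mors ?Fs" "map src ?Fs = Ms" "map tgt ?Fs = Ms"
    using Ident_hom assms by (auto simp: Hom_def bimods_def comp_def)
  have "map2 fn ?Fs t = t" if "t \<in> tuples Ms" for t
    using tuples_length[OF that] tuples_nth[OF that] by (auto intro!: nth_equalityI)
  then show ?thesis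
    using rprod_induced_Ident[OF respectful_map_tuple[OF Fs(1), unfolded Fs(2,3)] assms] False Fs(2,3)
    by (simp add: rprod_mor_nonempty)
qed (simp add: rprod_mor_Nil)

lemma rprod_mor_Comp:
  assumes Fs: "mors Fs" and Gs: "mors Gs" and eq: "map tgt Fs = map src Gs"
  shows "rprod_mor R (map2 (bcomp) Gs Fs) =
    bcomp (rprod_mor R Gs) (rprod_mor R Fs)"
proof (cases "Fs = []")
  case True
  then show ?thesis
    using eq
    by (simp add: rprod_mor_Nil category.comp_ident_left[OF category_bimod_category
          Ident_hom[OF env_bimodule_End]])
next
  case False
  let ?Hs = "map2 (bcomp) Gs Fs"
  have len: "length Gs = length Fs" using eq by (metis length_map)
  then have Gs_ne: "Gs \<noteq> []" using False by auto
  have Hs: "map src ?Hs = map src Fs" "map tgt ?Hs = map tgt Gs" "?Hs \<noteq> []"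
    using len False Gs_ne by (auto intro!: nth_equalityI)
  note comp = rprod_induced_comp[OF tensor_map_map_tuple[OF Fs False]
      respectful_map_tuple[OF Gs, folded eq] mors_bimods[OF Fs] mors_bimods(2)[OF Gs]]
  have "map2 fn Gs (map2 fn Fs t) = map2 fn ?Hs t" if t: "t \<in> tuples (map src Fs)" for t
    using tuples_length[OF t] tuples_nth[OF t] len by (auto intro!: nth_equalityI simp: compose_def)
  then have *: "lin (map_tuple Gs) (map_tuple Fs t) = map_tuple ?Hs t"
    if "t \<in> tuples (map src Fs)" for t using that by simp
  have **: "lin (map_tuple ?Hs) x = lin (\<lambda>t. lin (map_tuple Gs) (map_tuple Fs t)) x"
    if "x \<in> rfrags (map src Fs)" for x
    by (rule frag_extend_cong[OF rfrags_subset[OF that] *[symmetric]])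
  have Hs_mors: "mors ?Hs"
  proof -
    have "Gs ! i \<in> Hom (bimod_category R) (tgt (Fs ! i)) (tgt (Gs ! i))"
      "Fs ! i \<in> Hom (bimod_category R) (src (Fs ! i)) (tgt (Fs ! i))"
      if "i < length Fs" for i
      using Hom_nth[OF Fs that] Hom_nth[OF Gs, of i] that eq len
      by (simp_all) (metis length_map nth_map)
    from category.comp_hom[OF category_bimod_category this(2,1)]
    show ?thesis using len by (auto simp: set_zip Hom_def)
  qed
  show ?thesis
    unfolding rprod_mor_nonempty[OF False] rprod_mor_nonempty[OF Gs_ne] rprod_mor_nonempty[OF Hs(3)]
      Hs(1,2)
    unfolding eq comp[unfolded eq map_is_Nil_conv, OF False Gs_ne]
    using mors_bimods[OF Fs] mors_bimods[OF Gs] False ** eq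
      respectful_map_tuple[OF Hs_mors, unfolded Hs(1,2)]
      respectful_compose[OF respectful_map_tuple[OF Fs] respectful_map_tuple[OF Gs, folded eq]]
    by (intro rprod_induced_eqI) auto
qed

lemma rprod_mor_singleton:
  assumes "F \<in> Mor (bimod_category R)"
  shows "rprod_mor R [F] = F"
proof (rule bimod_mor_eqI)
  have F: "mors [F]" using assms by simp
  have 1: "env_bimodule R (src F)" "env_bimodule R (tgt F)" "fn F \<in> bimod_maps R (src F) (tgt F)"
    using mors_nth[OF F, of 0] by auto
  have "fn (rprod_mor R [F]) m = fn F m" if m: "m \<in> carrier (src F)" for m
    using rprod_induced_val[OF respectful_map_tuple[OF F], of "frag_of [m]"] 1 m
      bimod_mapsD(2)[OF 1(3) m]
    by (simp add: rprod_mor_nonempty rfrags_singleton val_singleton)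
  moreover have "fn (rprod_mor R [F]) \<in> extensional (carrier (src F))"
    by (simp add: rprod_mor_nonempty rprod_induced_def)
  ultimately show "fn (rprod_mor R [F]) = fn F"
    using bimod_mapsD(1)[OF 1(3)] extensionalityI by blast
qed (simp_all add: rprod_mor_nonempty)

lemma functor_rprod:
  "category_functor (power_category (bimod_category R) n) (bimod_category R) (rprod R) (rprod_mor R)"
proof -
  interpret C: category "bimod_category R" by (rule category_bimod_category)
  interpret P: category "power_category (bimod_category R) n"
    by (rule category_power_category[OF category_bimod_category])
  show ?thesis
  proof
    fix Ms :: "('r, ('a, 'r) elt) bimod list"
    assume "Ms \<in> Obj (power_category (bimod_category R) n)"
    then have Ms: "bimods Ms" by (auto simp: power_category_def bimods_def)
    show "rprod R Ms \<in> Obj (bimod_category R)" by (simp add: env_bimodule_rprod[OF Ms])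
    show "rprod_mor R (Ident (power_category (bimod_category R) n) Ms) =
        ident (rprod R Ms)"
      using rprod_mor_Ident[OF Ms] by (simp add: power_category_def)
  next
    fix Fs :: "('r, ('a, 'r) elt) bimod_mor list" and Ms Ns
    assume "Fs \<in> Hom (power_category (bimod_category R) n) Ms Ns"
    then show "rprod_mor R Fs \<in> Hom (bimod_category R) (rprod R Ms) (rprod R Ns)"
      using rprod_mor_hom by (auto simp: Hom_power_category)
  next
    fix Fs Gs :: "('r, ('a, 'r) elt) bimod_mor list" and Ls Ms Ns
    assume "Fs \<in> Hom (power_category (bimod_category R) n) Ls Ms"
      "Gs \<in> Hom (power_category (bimod_category R) n) Ms Ns"
    then show "rprod_mor R (Comp (power_category (bimod_category R) n) Gs Fs) =
        bcomp (rprod_mor R Gs) (rprod_mor R Fs)"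
      using rprod_mor_Comp[of Fs Gs] by (auto simp: Hom_power_category) (simp add: power_category_def)
  qed
qed

end

section \<open>Maps acting on a block of adjacent factors\<close>

lemma frags_induct3 [consumes 1, case_names zero tuple diff]:
  assumes "x \<in> frags (As @ Bs @ Cs)" "P 0"
    and "\<And>a b c. a \<in> tuples As \<Longrightarrow> b \<in> tuples Bs \<Longrightarrow> c \<in> tuples Cs
      \<Longrightarrow> P (frag_of a * frag_of b * frag_of c)"
    and "\<And>x y. x \<in> frags (As @ Bs @ Cs) \<Longrightarrow> y \<in> frags (As @ Bs @ Cs) \<Longrightarrow> P x \<Longrightarrow> P y \<Longrightarrow> P (x - y)"
  shows "P x"
  using assms(1)
proof (induction x rule: frags_induct)
  case (tuple t)
  then show ?case using assms(3) by (auto simp: tuples_append frag_of_append mult.assoc)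
qed (use assms in auto)

lemma frags_mult3:
  "x \<in> frags As \<Longrightarrow> y \<in> frags Bs \<Longrightarrow> z \<in> frags Cs \<Longrightarrow> x * y * z \<in> frags (As @ Bs @ Cs)"
  using frags_mult[OF _ frags_mult, of x As y Bs z Cs] by (simp add: mult.assoc)

lemma op_at_left3:
  assumes "x \<in> frags As" "y \<in> frags Bs" "z \<in> frags Cs" "j < length As"
  shows "op_at (As @ Bs @ Cs) op j (x * y * z) = op_at As op j x * y * z"
  using op_at_left[OF assms(1) frags_mult[OF assms(2,3)] assms(4), of op] by (simp add: mult.assoc)

lemma op_at_right3:
  assumes "x \<in> frags As" "y \<in> frags Bs" "z \<in> frags Cs" "j = length As + length Bs + i"
  shows "op_at (As @ Bs @ Cs) op j (x * y * z) = x * y * op_at Cs op i z"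
  using op_at_right[OF frags_mult[OF assms(1,2)] assms(3), of j i op] assms(4) by simp

lemma adjacent_positions_cases:
  fixes j k l m :: nat
  assumes "Suc j < k + l + m" "0 < l"
  shows "Suc j < k \<or> Suc j = k \<or> (\<exists>i. j = k + i \<and> Suc i < l) \<or> (j = k + (l - 1) \<and> 0 < m)
    \<or> (\<exists>i. j = k + l + i \<and> Suc i < m)"
  using assms by presburger

locale insertion = ground_ring R for R :: "('r, 'k) ring_scheme" +
  fixes xs Bs Cs zs :: "('r, 'u) bimod list"
    and psi phi :: "'u list \<Rightarrow> ('u list \<Rightarrow>\<^sub>0 int)"
  assumes bimods: "bimods xs" "bimods Bs" "bimods Cs" "bimods zs"
    and nonempty: "Bs \<noteq> []" "Cs \<noteq> []"
    and psi: "respectful Bs Cs psi"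
    and phi: "\<And>a b c. a \<in> tuples xs \<Longrightarrow> b \<in> tuples Bs \<Longrightarrow> c \<in> tuples zs
      \<Longrightarrow> phi (a @ b @ c) = frag_of a * psi b * frag_of c"
    and psi_lact: "\<And>r b. r \<in> carrier R \<Longrightarrow> b \<in> tuples Bs
      \<Longrightarrow> teq Cs (lin psi (op_at Bs (Lact r) 0 (frag_of b))) (op_at Cs (Lact r) 0 (psi b))"
    and psi_lbar: "\<And>r b. r \<in> carrier R \<Longrightarrow> b \<in> tuples Bs
      \<Longrightarrow> teq Cs (lin psi (op_at Bs (Lbar r) (length Bs - 1) (frag_of b)))
            (op_at Cs (Lbar r) (length Cs - 1) (psi b))"
begin

abbreviation "Src \<equiv> xs @ Bs @ zs"
abbreviation "Tgt \<equiv> xs @ Cs @ zs"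
abbreviation "T \<equiv> lin phi"

lemma bimods_Src_Tgt: "bimods Src" "bimods Tgt"
  using bimods by auto

lemma psi_frags: "b \<in> tuples Bs \<Longrightarrow> psi b \<in> frags Cs"
  using psi by (simp add: respectful_def)

lemma T_mult:
  "x \<in> frags xs \<Longrightarrow> y \<in> frags Bs \<Longrightarrow> z \<in> frags zs \<Longrightarrow> T (x * y * z) = x * lin psi y * z"
  using frag_extend_mult3[of x xs y Bs z zs phi frag_of psi frag_of] phi by (simp add: frag_extend_id)

lemma phi_frags:
  assumes "t \<in> tuples Src"
  shows "phi t \<in> frags Tgt"
  using assms phi psi_frags
  by (auto simp: tuples_append[of _ xs] tuples_append[of _ Bs] intro!: frags_mult3)

lemma T_frags: "x \<in> frags Src \<Longrightarrow> T x \<in> frags Tgt"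
  by (rule frags_extend[OF phi_frags])

lemma T_op_at_left:
  assumes x: "x \<in> frags Src" and op: "additive_op op" and j: "j < length xs"
  shows "T (op_at Src op j x) = op_at Tgt op j (T x)"
  using x
proof (induction x rule: frags_induct3)
  case (tuple a b c)
  then show ?case
    using op_at_closed[OF op bimods(1) j, of "frag_of a"] j psi_frags
    by (simp add: op_at_left3 T_mult)
qed (simp_all add: op_at_diff frag_extend_diff)

lemma T_op_at_right:
  assumes x: "x \<in> frags Src" and op: "additive_op op" and j: "j < length zs"
  shows "T (op_at Src op (length xs + length Bs + j) x) = op_at Tgt op (length xs + length Cs + j) (T x)"
  using x
proof (induction x rule: frags_induct3)
  case (tuple a b c)
  then show ?case
    using op_at_closed[OF op bimods(4) j, of "frag_of c"] psi_frags
    by (simp add: op_at_right3 T_mult)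
qed (simp_all add: op_at_diff frag_extend_diff)

lemma T_op_at_mid:
  assumes "a \<in> tuples xs" "b \<in> tuples Bs" "c \<in> tuples zs" "additive_op op" "i < length Bs"
  shows "T (op_at Src op (length xs + i) (frag_of a * frag_of b * frag_of c)) =
    frag_of a * lin psi (op_at Bs op i (frag_of b)) * frag_of c"
  using assms op_at_closed[OF assms(4) bimods(2) assms(5), of "frag_of b"]
  by (simp add: op_at_mid T_mult)

lemma T_op_at_block:
  assumes x: "x \<in> frags Src" and op: "additive_op op" and i: "i < length Bs" "i' < length Cs"
    and psi_op: "\<And>b. b \<in> tuples Bs
      \<Longrightarrow> teq Cs (lin psi (op_at Bs op i (frag_of b))) (op_at Cs op i' (psi b))"
  shows "teq Tgt (T (op_at Src op (length xs + i) x)) (op_at Tgt op (length xs + i') (T x))"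
  using x
proof (induction x rule: frags_induct3)
  case (tuple a b c)
  have "teq Tgt (frag_of a * lin psi (op_at Bs op i (frag_of b)) * frag_of c)
      (frag_of a * op_at Cs op i' (psi b) * frag_of c)"
    by (rule teq_mult3) (use tuple bimods psi_op in auto)
  then show ?case
    unfolding T_op_at_mid[OF tuple op i(1)]
    using tuple i psi_frags by (simp add: T_mult op_at_mid)
qed (simp_all add: op_at_diff frag_extend_diff bimods teq_diff)

lemma T_lact:
  assumes "x \<in> frags Src" "r \<in> carrier R"
  shows "teq Tgt (T (op_at Src (Lact r) (length xs) x)) (op_at Tgt (Lact r) (length xs) (T x))"
  using T_op_at_block[OF assms(1) additive_actions(1)[OF assms(2)], of 0 0] psi_lact[OF assms(2)]
    nonempty by simp

lemma T_lbar:
  assumes "x \<in> frags Src" "r \<in> carrier R"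
  shows "teq Tgt (T (op_at Src (Lbar r) (length xs + (length Bs - 1)) x))
    (op_at Tgt (Lbar r) (length xs + (length Cs - 1)) (T x))"
  using T_op_at_block[OF assms(1) additive_actions(2)[OF assms(2)], of "length Bs - 1" "length Cs - 1"]
    psi_lbar[OF assms(2)] nonempty by simp

lemma respectful: "respectful Src Tgt phi"
proof (rule respectfulI[OF bimods_Src_Tgt phi_frags])
  fix t j x y
  assume t: "t \<in> tuples Src" and j: "j < length Src"
    and xy: "x \<in> carrier (Src ! j)" "y \<in> carrier (Src ! j)"
  from t obtain a b c where abc: "a \<in> tuples xs" "b \<in> tuples Bs" "c \<in> tuples zs" "t = a @ b @ c"
    by (auto simp: tuples_append[of _ xs] tuples_append[of _ Bs])
  note len = tuples_length[OF abc(1)] tuples_length[OF abc(2)] tuples_length[OF abc(3)]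
  consider (left) "j < length xs" | (mid) i where "j = length xs + i" "i < length Bs"
    | (right) i where "j = length xs + length Bs + i" "i < length zs"
  proof -
    have "j < length xs \<or> (\<exists>i. j = length xs + i \<and> i < length Bs)
        \<or> (\<exists>i. j = length xs + length Bs + i \<and> i < length zs)"
      using j by simp presburger
    then show ?thesis using that by blast
  qed
  then show "teq Tgt (phi (t[j := x \<oplus>\<^bsub>Src ! j\<^esub> y])) (phi (t[j := x]) + phi (t[j := y]))"
  proof cases
    case left
    then have "x \<in> carrier (xs ! j)" "y \<in> carrier (xs ! j)" using xy by (simp_all add: nth_append)
    moreover have "x \<oplus>\<^bsub>xs ! j\<^esub> y \<in> carrier (xs ! j)"
      using carrier_add[OF bimods_nth[OF bimods(1) left]] calculation by simp
    ultimately show ?thesis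
      using left abc len bimods psi_frags
        teq_mult_right[of xs "Cs @ zs" "psi b * frag_of c", OF _ _ _ teq_additive[OF abc(1) left, of x y]]
      by (simp add: list_update_append nth_append phi tuples_update frags_mult distrib_right mult.assoc)
  next
    case (mid i)
    then have "x \<in> carrier (Bs ! i)" "y \<in> carrier (Bs ! i)" using xy by (simp_all add: nth_append)
    moreover have "x \<oplus>\<^bsub>Bs ! i\<^esub> y \<in> carrier (Bs ! i)"
      using carrier_add[OF bimods_nth[OF bimods(2) mid(2)]] calculation by simp
    ultimately show ?thesis
      using mid abc len bimods
        teq_mult3[of xs Cs zs "frag_of a" "frag_of c",
          OF _ _ _ _ _ respectful_additive[OF psi abc(2) mid(2), of x y]]
      by (simp add: list_update_append nth_append phi tuples_update distrib_right distrib_left)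
  next
    case (right i)
    then have "x \<in> carrier (zs ! i)" "y \<in> carrier (zs ! i)" using xy by (simp_all add: nth_append)
    moreover have "x \<oplus>\<^bsub>zs ! i\<^esub> y \<in> carrier (zs ! i)"
      using carrier_add[OF bimods_nth[OF bimods(4) right(2)]] calculation by simp
    ultimately show ?thesis
      using right abc len bimods psi_frags
        teq_mult_left[of "xs @ Cs" zs "frag_of a * psi b", OF _ _ _ teq_additive[OF abc(3) right(2), of x y]]
      by (simp add: list_update_append nth_append phi tuples_update frags_mult distrib_left)
  qed
next
  fix t j r
  assume t: "t \<in> tuples Src" and j: "Suc j < length Src" and r: "r \<in> carrier R"
  note op = additive_actions[OF r]
  have bal: "teq Tgt (op_at Tgt (Lbar r) i (T (frag_of t))) (op_at Tgt (Lact r) (Suc i) (T (frag_of t)))"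
    if "Suc i < length Tgt" for i
    by (rule teq_balanced) (use that t bimods r phi_frags in auto)
  have ne: "0 < length Bs" "0 < length Cs" using nonempty by auto
  consider (left) "Suc j < length xs" | (left_mid) "Suc j = length xs"
    | (mid) i where "j = length xs + i" "Suc i < length Bs"
    | (mid_right) "j = length xs + (length Bs - 1)" "0 < length zs"
    | (right) i where "j = length xs + length Bs + i" "Suc i < length zs"
  proof -
    have "Suc j < length xs \<or> Suc j = length xs \<or> (\<exists>i. j = length xs + i \<and> Suc i < length Bs)
        \<or> (j = length xs + (length Bs - 1) \<and> 0 < length zs)
        \<or> (\<exists>i. j = length xs + length Bs + i \<and> Suc i < length zs)"
      using adjacent_positions_cases[OF _ ne(1), of j "length xs" "length zs"] j by simp
    then show ?thesis using that by blast
  qed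
  then show "teq Tgt (T (op_at Src (Lbar r) j (frag_of t))) (T (op_at Src (Lact r) (Suc j) (frag_of t)))"
  proof cases
    case left
    then show ?thesis 
      using bal[of j] t T_op_at_left[of "frag_of t" "Lbar r" j]
        T_op_at_left[of "frag_of t" "Lact r" "Suc j"]
      by (simp add: op)
  next
    case left_mid
    have "T (op_at Src (Lbar r) j (frag_of t)) = op_at Tgt (Lbar r) j (T (frag_of t))"
      by (rule T_op_at_left) (use left_mid t op in auto)
    also have "teq Tgt \<dots> (op_at Tgt (Lact r) (length xs) (T (frag_of t)))"
      using bal[of j] left_mid ne by simp
    also have "teq Tgt \<dots> (T (op_at Src (Lact r) (length xs) (frag_of t)))"
      by (rule teq_sym[OF T_lact]) (use t r bimods in auto)
    finally show ?thesis using left_mid by simp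
  next
    case (mid i)
    from t obtain a b c where abc: "a \<in> tuples xs" "b \<in> tuples Bs" "c \<in> tuples zs" "t = a @ b @ c"
      by (auto simp: tuples_append[of _ xs] tuples_append[of _ Bs])
    have "teq Tgt (frag_of a * lin psi (op_at Bs (Lbar r) i (frag_of b)) * frag_of c)
        (frag_of a * lin psi (op_at Bs (Lact r) (Suc i) (frag_of b)) * frag_of c)"
      by (intro teq_mult3 respectful_teq[OF psi] teq_balanced) (use mid abc bimods r in auto)
    then show ?thesis
      using mid T_op_at_mid[OF abc(1-3) op(2), of i] T_op_at_mid[OF abc(1-3) op(1), of "Suc i"]
      unfolding abc(4) frag_of_append mult.assoc[symmetric] by simp
  next
    case mid_right
    have "teq Tgt (T (op_at Src (Lbar r) j (frag_of t)))
        (op_at Tgt (Lbar r) (length xs + (length Cs - 1)) (T (frag_of t)))"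
      unfolding mid_right(1) by (rule T_lbar) (use t r in auto)
    also have "teq Tgt \<dots> (op_at Tgt (Lact r) (length xs + length Cs + 0) (T (frag_of t)))"
    proof -
      have "Suc (length xs + (length Cs - 1)) = length xs + length Cs + 0" using ne by simp
      moreover have "length xs + length Cs + 0 < length Tgt" using mid_right by simp
      ultimately show ?thesis using bal[of "length xs + (length Cs - 1)"] by metis
    qed
    also have "\<dots> = T (op_at Src (Lact r) (length xs + length Bs + 0) (frag_of t))"
      by (rule T_op_at_right[symmetric]) (use mid_right t op in auto)
    finally show ?thesis using mid_right ne by simp
  next
    case (right i)
    then show ?thesis
      using bal[of "length xs + length Cs + i"] t
        T_op_at_right[of "frag_of t" "Lbar r" i] T_op_at_right[of "frag_of t" "Lact r" "Suc i"]
      by (simp add: op)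
  qed
qed

text \<open>
  The compatibility with the right actions may use that the argument is restricted; for the
  unitors it has to.
\<close>

lemma tensor_map:
  assumes ract: "\<And>x s. x \<in> rfrags Src \<Longrightarrow> s \<in> carrier R
      \<Longrightarrow> teq Tgt (T (op_at Src (Ract s) (length xs) x)) (op_at Tgt (Ract s) (length xs) (T x))"
    and rbar: "\<And>x s. x \<in> rfrags Src \<Longrightarrow> s \<in> carrier R
      \<Longrightarrow> teq Tgt (T (op_at Src (Rbar s) (length xs + (length Bs - 1)) x))
            (op_at Tgt (Rbar s) (length xs + (length Cs - 1)) (T x))"
    and inner: "\<And>x s i. x \<in> rfrags Src \<Longrightarrow> s \<in> carrier R \<Longrightarrow> Suc i < length Cs
      \<Longrightarrow> teq Tgt (op_at Tgt (Rbar s) (length xs + i) (T x))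
            (op_at Tgt (Ract s) (length xs + Suc i) (T x))"
  shows "tensor_map Src Tgt phi"
proof -
  have ne: "0 < length Bs" "0 < length Cs" using nonempty by auto
  have res: "T x \<in> rfrags Tgt" if x: "x \<in> rfrags Src" for x
  proof -
    have xf: "x \<in> frags Src" using rfrags_subset[OF x] .
    have "teq Tgt (op_at Tgt (Rbar s) j (T x)) (op_at Tgt (Ract s) (Suc j) (T x))"
      if s: "s \<in> carrier R" and j: "Suc j < length Tgt" for s j
    proof -
      note op = additive_actions[OF s]
      have bal: "teq Tgt (T (op_at Src (Rbar s) i x)) (T (op_at Src (Ract s) (Suc i) x))"
        if "Suc i < length Src" for i
        by (rule respectful_teq[OF respectful])
          (use x s that in \<open>auto simp del: length_append simp: rfrags_def\<close>)
      consider (left) "Suc j < length xs" | (left_mid) "Suc j = length xs"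
        | (mid) i where "j = length xs + i" "Suc i < length Cs"
        | (mid_right) "j = length xs + (length Cs - 1)" "0 < length zs"
        | (right) i where "j = length xs + length Cs + i" "Suc i < length zs"
      proof -
        have "Suc j < length xs \<or> Suc j = length xs \<or> (\<exists>i. j = length xs + i \<and> Suc i < length Cs)
            \<or> (j = length xs + (length Cs - 1) \<and> 0 < length zs)
            \<or> (\<exists>i. j = length xs + length Cs + i \<and> Suc i < length zs)"
          using adjacent_positions_cases[OF _ ne(2), of j "length xs" "length zs"] j by simp
        then show ?thesis using that by blast
      qed
      then show ?thesis
      proof cases
        case left
        then show ?thesis 
          using bal[of j] T_op_at_left[OF xf op(4), of j] T_op_at_left[OF xf op(3), of "Suc j"] by simp
      next
        case left_mid
        have "op_at Tgt (Rbar s) j (T x) = T (op_at Src (Rbar s) j x)"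
          by (rule T_op_at_left[symmetric]) (use left_mid xf op in auto)
        also have "teq Tgt \<dots> (T (op_at Src (Ract s) (length xs) x))"
          using bal[of j] left_mid ne by simp
        also have "teq Tgt \<dots> (op_at Tgt (Ract s) (length xs) (T x))"
          by (rule ract[OF x s])
        finally show ?thesis using left_mid by simp
      next
        case (mid i)
        then show ?thesis using inner[OF x s] by simp
      next
        case mid_right
        have "teq Tgt (op_at Tgt (Rbar s) j (T x)) (T (op_at Src (Rbar s) (length xs + (length Bs - 1)) x))"
          unfolding mid_right(1) by (rule teq_sym[OF rbar[OF x s]]) (use bimods in auto)
        also have "teq Tgt \<dots> (T (op_at Src (Ract s) (length xs + length Bs + 0) x))"
        proof -
          have "Suc (length xs + (length Bs - 1)) = length xs + length Bs + 0" using ne by simp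
          moreover have "length xs + length Bs + 0 < length Src" using mid_right by simp
          ultimately show ?thesis using bal[of "length xs + (length Bs - 1)"] by metis
        qed
        also have "\<dots> = op_at Tgt (Ract s) (length xs + length Cs + 0) (T x)"
          by (rule T_op_at_right) (use mid_right xf op in auto)
        finally show ?thesis using mid_right ne by simp
      next
        case (right i)
        then show ?thesis
          using bal[of "length xs + length Bs + i"] T_op_at_right[OF xf op(4), of i]
            T_op_at_right[OF xf op(3), of "Suc i"] by simp
      qed
    qed
    then show ?thesis using T_frags[OF xf] by (simp add: rfrags_def)
  qed
  have first: "teq Tgt (T (op_at Src op 0 x)) (op_at Tgt op 0 (T x))"
    if "x \<in> frags Src" "additive_op op"
      "teq Tgt (T (op_at Src op (length xs) x)) (op_at Tgt op (length xs) (T x))" for x op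
    using that T_op_at_left[OF that(1,2), of 0] by (cases "xs = []") auto
  have last: "teq Tgt (T (op_at Src op (length Src - 1) x)) (op_at Tgt op (length Tgt - 1) (T x))"
    if "x \<in> frags Src" "additive_op op"
      "teq Tgt (T (op_at Src op (length xs + (length Bs - 1)) x))
        (op_at Tgt op (length xs + (length Cs - 1)) (T x))" for x op
  proof (cases "zs = []")
    case True
    then show ?thesis using that ne by simp
  next
    case False
    then have "length Src - 1 = length xs + length Bs + (length zs - 1)"
      "length Tgt - 1 = length xs + length Cs + (length zs - 1)"
      by (simp_all add: Suc_leI)
    then show ?thesis
      using T_op_at_right[OF that(1,2), of "length zs - 1"] False
      by (simp del: length_append One_nat_def)
  qed
  show ?thesis
    unfolding tensor_map_def
    using respectful res
    by (intro conjI ballI first last; (simp add: T_lact T_lbar ract rbar rfrags_subset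
      additive_actions del: length_append One_nat_def)?)
qed

end

context ground_ring
begin

section \<open>Associators and unitors\<close>

lemma rprod_elt:
  assumes "bimods Ms" "Ms \<noteq> []" "m \<in> carrier (rprod R Ms)"
  shows "rep Ms m \<in> rfrags Ms" "val Ms (rep Ms m) = m"
proof -
  obtain x where x: "x \<in> rfrags Ms" "m = val Ms x"
    using assms by (auto simp: carrier_rprod)
  have *: "teq Ms (rep Ms m) x"
    using rep_val[OF assms(1,2) rfrags_subset[OF x(1)]] x(2) by simp
  show "rep Ms m \<in> rfrags Ms"
    by (rule rfrags_teq[OF assms(1) x(1) *])
  show "val Ms (rep Ms m) = m"
    using val_cong[OF assms(1) *] x(2) by simp
qed

lemma rep_frags: "bimods Ms \<Longrightarrow> Ms \<noteq> [] \<Longrightarrow> m \<in> carrier (rprod R Ms) \<Longrightarrow> rep Ms m \<in> frags Ms"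
  by (simp add: rprod_elt(1) rfrags_subset)

lemma rep_add:
  assumes "bimods Ms" "Ms \<noteq> []" "m \<in> carrier (rprod R Ms)" "n \<in> carrier (rprod R Ms)"
  shows "teq Ms (rep Ms (m \<oplus>\<^bsub>rprod R Ms\<^esub> n)) (rep Ms m + rep Ms n)"
  using rep_val[OF assms(1,2) frags_add[OF rep_frags[OF assms(1-3)] rep_frags[OF assms(1,2,4)]]]
    add_rprod[OF assms(1,2) rep_frags[OF assms(1-3)] rep_frags[OF assms(1,2,4)]] assms
  by (simp add: rprod_elt)

lemma rep_actions:
  assumes bim: "bimods Ms" and ne: "Ms \<noteq> []" and m: "m \<in> carrier (rprod R Ms)" and r: "r \<in> carrier R"
  shows "teq Ms (rep Ms (lact (rprod R Ms) r m)) (op_at Ms (Lact r) 0 (rep Ms m))" (is ?lact)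
    "teq Ms (rep Ms (lbar (rprod R Ms) r m)) (op_at Ms (Lbar r) (length Ms - 1) (rep Ms m))" (is ?lbar)
    "teq Ms (rep Ms (ract (rprod R Ms) m r)) (op_at Ms (Ract r) 0 (rep Ms m))" (is ?ract)
    "teq Ms (rep Ms (rbar (rprod R Ms) m r)) (op_at Ms (Rbar r) (length Ms - 1) (rep Ms m))" (is ?rbar)
proof -
  note x = rep_frags[OF bim ne m]
  note acts = actions_rprod[OF bim ne x r, unfolded rprod_elt(2)[OF bim ne m]]
  note ops = end_op_actions[OF ne r, THEN end_op_frags[OF bim _ x]]
  show ?lact ?lbar ?ract ?rbar
    unfolding acts using ops by (auto intro: rep_val[OF bim ne])
qed

definition str_phi :: "('r, ('a, 'r) elt) bimod list \<Rightarrow> ('r, ('a, 'r) elt) bimod list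
    \<Rightarrow> ('r, ('a, 'r) elt) bimod list \<Rightarrow> ('a, 'r) elt list \<Rightarrow> (('a, 'r) elt list \<Rightarrow>\<^sub>0 int)" where
  "str_phi xs ys zs =
    (if ys = [] then
       (\<lambda>u. let k = length xs; e = the_endo (u ! k) \<one>\<^bsub>R\<^esub>; a = take k u; c = drop (Suc k) u in
          frag_of (if zs \<noteq> [] then a @ [lact (hd zs) e (hd c)] @ tl c
                   else butlast a @ [lbar (last xs) e (last a)]))
     else (\<lambda>u. let k = length xs in
        lin (\<lambda>t. frag_of (take k u @ t @ drop (Suc k) u))
          (SOME z. z \<in> decode R ys (u ! k))))"

abbreviation "smap \<equiv> structure_map R"

lemma structure_map_eq:
  "xs @ ys @ zs \<noteq> [] \<Longrightarrow> structure_map R xs ys zs =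
     rind (xs @ [rprod R ys] @ zs) (xs @ ys @ zs) (str_phi xs ys zs)"
  by (auto simp: structure_map_def unitor_def associator_def str_phi_def)

lemma structure_map_Nil: "structure_map R [] [] [] = ident (End_bimod R)"
  by (simp add: structure_map_def unitor_def)

lemma frag_extend_splice: "lin (\<lambda>t. frag_of (a @ t @ c)) z = frag_of a * z * frag_of c"
  by (induction z rule: frag_induction[OF subset_UNIV])
    (simp_all add: frag_extend_diff frag_of_append mult.assoc left_diff_distrib right_diff_distrib)

lemma str_phi_assoc:
  assumes "ys \<noteq> []" "length a = length xs"
  shows "str_phi xs ys zs (a @ [m] @ c) = frag_of a * rep ys m * frag_of c"
  using assms by (simp add: str_phi_def Let_def rep_def frag_extend_splice nth_append)

lemma insertion_assoc:
  assumes "bimods xs" "bimods ys" "bimods zs" "ys \<noteq> []"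
  shows "insertion R xs [rprod R ys] ys zs (\<lambda>b. rep ys (hd b)) (str_phi xs ys zs)"
proof unfold_locales
  show bimods: "bimods xs" "bimods [rprod R ys]" "bimods ys" "bimods zs"
    using assms by (simp_all add: env_bimodule_rprod)
  show "[rprod R ys] \<noteq> []" "ys \<noteq> []" using assms by auto
  show "respectful [rprod R ys] ys (\<lambda>b. rep ys (hd b))"
    by (rule respectfulI[OF bimods(2,3)]) (auto simp: rep_frags assms rep_add)
  show "str_phi xs ys zs (a @ b @ c) = frag_of a * rep ys (hd b) * frag_of c"
    if "a \<in> tuples xs" "b \<in> tuples [rprod R ys]" "c \<in> tuples zs" for a b c
    using that assms str_phi_assoc[OF assms(4) tuples_length[OF that(1)]] by auto
  show "teq ys (lin (\<lambda>b. rep ys (hd b)) (op_at [rprod R ys] (Lact r) 0 (frag_of b)))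
      (op_at ys (Lact r) 0 (rep ys (hd b)))" if "r \<in> carrier R" "b \<in> tuples [rprod R ys]" for r b
    using that assms by (auto simp: op_at_frag_of rep_actions)
  show "teq ys (lin (\<lambda>b. rep ys (hd b))
        (op_at [rprod R ys] (Lbar r) (length [rprod R ys] - 1) (frag_of b)))
      (op_at ys (Lbar r) (length ys - 1) (rep ys (hd b)))"
    if "r \<in> carrier R" "b \<in> tuples [rprod R ys]" for r b
    using that rep_actions(2)[OF assms(2,4) _ that(1)] by (auto simp: op_at_frag_of)
qed

lemma tensor_map_assoc:
  assumes "bimods xs" "bimods ys" "bimods zs" "ys \<noteq> []"
  shows "tensor_map (xs @ [rprod R ys] @ zs) (xs @ ys @ zs) (str_phi xs ys zs)"
proof -
  interpret insertion R xs "[rprod R ys]" ys zs "\<lambda>b. rep ys (hd b)" "str_phi xs ys zs"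
    by (rule insertion_assoc[OF assms])
  show ?thesis
  proof (rule tensor_map)
    fix x s assume x: "x \<in> rfrags (xs @ [rprod R ys] @ zs)" and s: "s \<in> carrier R"
    note xf = rfrags_subset[OF x]
    have "teq Tgt (T (op_at Src (Ract s) (length xs + 0) x)) (op_at Tgt (Ract s) (length xs + 0) (T x))"
      by (rule T_op_at_block[OF xf])
        (use s assms in \<open>auto simp: op_at_frag_of rep_actions additive_actions\<close>)
    then show "teq Tgt (T (op_at Src (Ract s) (length xs) x)) (op_at Tgt (Ract s) (length xs) (T x))"
      by simp
    show "teq Tgt (T (op_at Src (Rbar s) (length xs + (length [rprod R ys] - 1)) x))
        (op_at Tgt (Rbar s) (length xs + (length ys - 1)) (T x))"
      by (rule T_op_at_block[OF xf])
        (use s assms rep_actions(4)[OF assms(2,4) _ s] in \<open>auto simp: op_at_frag_of additive_actions\<close>)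
    fix i assume i: "Suc i < length ys"
    show "teq Tgt (op_at Tgt (Rbar s) (length xs + i) (T x)) (op_at Tgt (Ract s) (length xs + Suc i) (T x))"
      using xf
    proof (induction x rule: frags_induct3)
      case (tuple a b c)
      then obtain m where m: "b = [m]" "m \<in> carrier (rprod R ys)" by auto
      note z = rprod_elt(1)[OF assms(2,4) m(2)]
      have "teq Tgt (frag_of a * op_at ys (Rbar s) i (rep ys m) * frag_of c)
          (frag_of a * op_at ys (Ract s) (Suc i) (rep ys m) * frag_of c)"
        by (rule teq_mult3) (use tuple assms z i s in \<open>auto simp: rfrags_def\<close>)
      then show ?case
        using tuple m i rfrags_subset[OF z]
          op_at_mid[of "frag_of a" xs "rep ys m" ys "frag_of c" zs "length xs + i" i]
          op_at_mid[of "frag_of a" xs "rep ys m" ys "frag_of c" zs "length xs + Suc i" "Suc i"]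
        by (simp add: T_mult)
    qed (use bimods in \<open>simp_all add: op_at_diff frag_extend_diff teq_diff\<close>)
  qed
qed

lemma bimod_laws:
  assumes "env_bimodule R M" "r \<in> carrier R" "s \<in> carrier R" "m \<in> carrier M"
  shows "lact M (r \<otimes>\<^bsub>R\<^esub> s) m = lact M r (lact M s m)" (is ?A)
    "lbar M (r \<otimes>\<^bsub>R\<^esub> s) m = lbar M s (lbar M r m)" (is ?B)
    "lact M (r \<oplus>\<^bsub>R\<^esub> s) m = lact M r m \<oplus>\<^bsub>M\<^esub> lact M s m" (is ?C)
    "lbar M (r \<oplus>\<^bsub>R\<^esub> s) m = lbar M r m \<oplus>\<^bsub>M\<^esub> lbar M s m" (is ?D)
proof -
  interpret env_bimodule R M by fact
  show ?A ?B ?C ?D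
    using assms lact.mult_act lbar.mult_act[of s r m] lact.add_act lbar.add_act[of r s m]
    by (simp_all add: op_ring_def)
qed

abbreviation ev :: "('a, 'r) elt \<Rightarrow> 'r" where
  "ev \<phi> \<equiv> the_endo \<phi> \<one>\<^bsub>R\<^esub>"

lemma ev_End:
  assumes "\<phi> \<in> carrier (End_bimod R)"
  shows "ev \<phi> \<in> carrier R"
    "\<psi> \<in> carrier (End_bimod R) \<Longrightarrow> ev (\<phi> \<oplus>\<^bsub>End_bimod R\<^esub> \<psi>) = ev \<phi> \<oplus>\<^bsub>R\<^esub> ev \<psi>"
    "r \<in> carrier R \<Longrightarrow> ev (lact (End_bimod R) r \<phi>) = r \<otimes>\<^bsub>R\<^esub> ev \<phi>"
    "r \<in> carrier R \<Longrightarrow> ev (lbar (End_bimod R) r \<phi>) = ev \<phi> \<otimes>\<^bsub>R\<^esub> r"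
    "r \<in> carrier R \<Longrightarrow> ev (ract (End_bimod R) \<phi> r) = the_endo \<phi> r"
    "r \<in> carrier R \<Longrightarrow> ev (rbar (End_bimod R) \<phi> r) = the_endo \<phi> r"
  using assms by (auto simp: End_bimod_def)

lemma teq_singleton_add:
  "m \<in> carrier M \<Longrightarrow> n \<in> carrier M \<Longrightarrow> teq [M] (frag_of [m \<oplus>\<^bsub>M\<^esub> n]) (frag_of [m] + frag_of [n])"
  using teq_additive[of "[m]" "[M]" 0 m n] by simp

lemma str_phi_unit_right:
  assumes "length a = length xs"
  shows "str_phi xs [] (N # zs) (a @ [\<phi>] @ n # c) = frag_of (a @ [lact N (ev \<phi>) n] @ c)"
  using assms by (simp add: str_phi_def Let_def nth_append)

lemma str_phi_unit_left:
  assumes "length a = length xs"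
  shows "str_phi (xs @ [M]) [] [] (a @ [m] @ [\<phi>]) = frag_of (a @ [lbar M (ev \<phi>) m])"
  using assms by (simp add: str_phi_def Let_def nth_append butlast_append)

lemma less_Suc_Suc_0_iff: "j < Suc (Suc 0) \<longleftrightarrow> j = 0 \<or> j = Suc 0"
  by auto

lemma insertion_unit_right:
  assumes "bimods xs" "env_bimodule R N" "bimods zs"
  shows "insertion R xs [End_bimod R, N] [N] zs (\<lambda>b. frag_of [lact N (ev (b ! 0)) (b ! 1)])
    (str_phi xs [] (N # zs))"
proof unfold_locales
  note comm = commutes_actions[unfolded commutes_def, rule_format, OF _ _ assms(2)]
  show bimods: "bimods xs" "bimods [End_bimod R, N]" "bimods [N]" "bimods zs"
    using assms by (simp_all add: env_bimodule_End)
  show "[End_bimod R, N] \<noteq> []" "[N] \<noteq> []" by auto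
  show "respectful [End_bimod R, N] [N] (\<lambda>b. frag_of [lact N (ev (b ! 0)) (b ! 1)])"
    by (rule respectfulI[OF bimods(2,3)])
      (auto simp: less_Suc_Suc_0_iff ev_End bimod_closed assms carrier_add action_add bimod_laws op_at_frag_of
        intro!: teq_singleton_add)
  show "str_phi xs [] (N # zs) (a @ b @ c) =
      frag_of a * frag_of [lact N (ev (b ! 0)) (b ! 1)] * frag_of c"
    if "a \<in> tuples xs" "b \<in> tuples [End_bimod R, N]" "c \<in> tuples zs" for a b c
    using that str_phi_unit_right[OF tuples_length[OF that(1)]]
    by (auto simp flip: frag_of_append)
  show "teq [N] (lin (\<lambda>b. frag_of [lact N (ev (b ! 0)) (b ! 1)])
        (op_at [End_bimod R, N] (Lact r) 0 (frag_of b)))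
      (op_at [N] (Lact r) 0 (frag_of [lact N (ev (b ! 0)) (b ! 1)]))"
    if "r \<in> carrier R" "b \<in> tuples [End_bimod R, N]" for r b
    using that assms by (auto simp: op_at_frag_of ev_End bimod_laws)
  show "teq [N] (lin (\<lambda>b. frag_of [lact N (ev (b ! 0)) (b ! 1)])
        (op_at [End_bimod R, N] (Lbar r) (length [End_bimod R, N] - 1) (frag_of b)))
      (op_at [N] (Lbar r) (length [N] - 1) (frag_of [lact N (ev (b ! 0)) (b ! 1)]))"
    if "r \<in> carrier R" "b \<in> tuples [End_bimod R, N]" for r b
    using that comm(1) by (auto simp: op_at_frag_of ev_End)
qed

lemma insertion_unit_left:
  assumes "bimods xs" "env_bimodule R M"
  shows "insertion R xs [M, End_bimod R] [M] [] (\<lambda>b. frag_of [lbar M (ev (b ! 1)) (b ! 0)])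
    (str_phi (xs @ [M]) [] [])"
proof unfold_locales
  note comm = commutes_actions[unfolded commutes_def, rule_format, OF _ _ assms(2)]
  show bimods: "bimods xs" "bimods [M, End_bimod R]" "bimods [M]" "bimods []"
    using assms by (simp_all add: env_bimodule_End)
  show "[M, End_bimod R] \<noteq> []" "[M] \<noteq> []" by auto
  show "respectful [M, End_bimod R] [M] (\<lambda>b. frag_of [lbar M (ev (b ! 1)) (b ! 0)])"
    by (rule respectfulI[OF bimods(2,3)])
      (auto simp: less_Suc_Suc_0_iff ev_End bimod_closed assms carrier_add action_add bimod_laws op_at_frag_of
        intro!: teq_singleton_add)
  show "str_phi (xs @ [M]) [] [] (a @ b @ c) =
      frag_of a * frag_of [lbar M (ev (b ! 1)) (b ! 0)] * frag_of c"
    if "a \<in> tuples xs" "b \<in> tuples [M, End_bimod R]" "c \<in> tuples []" for a b c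
    using that str_phi_unit_left[OF tuples_length[OF that(1)]]
    by (auto simp: frag_of_Nil simp flip: frag_of_append)
  show "teq [M] (lin (\<lambda>b. frag_of [lbar M (ev (b ! 1)) (b ! 0)])
        (op_at [M, End_bimod R] (Lact r) 0 (frag_of b)))
      (op_at [M] (Lact r) 0 (frag_of [lbar M (ev (b ! 1)) (b ! 0)]))"
    if "r \<in> carrier R" "b \<in> tuples [M, End_bimod R]" for r b
    using that comm(1) by (auto simp: op_at_frag_of ev_End)
  show "teq [M] (lin (\<lambda>b. frag_of [lbar M (ev (b ! 1)) (b ! 0)])
        (op_at [M, End_bimod R] (Lbar r) (length [M, End_bimod R] - 1) (frag_of b)))
      (op_at [M] (Lbar r) (length [M] - 1) (frag_of [lbar M (ev (b ! 1)) (b ! 0)]))"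
    if "r \<in> carrier R" "b \<in> tuples [M, End_bimod R]" for r b
    using that assms by (auto simp: op_at_frag_of ev_End bimod_laws)
qed

text \<open>
  Both right actions of \<open>s\<close> on \<open>\<phi>\<close> evaluate at \<open>1\<close> to \<open>\<phi>(s)\<close>.  So the relation between \<open>\<phi>\<close>
  and its left neighbour transforms into the one between \<open>\<phi>\<close> and its right neighbour.
\<close>

lemma tensor_map_unit_right:
  assumes "bimods xs" "env_bimodule R N" "bimods zs"
  shows "tensor_map (xs @ [End_bimod R, N] @ zs) (xs @ [N] @ zs) (str_phi xs [] (N # zs))"
proof -
  note comm = commutes_actions[unfolded commutes_def, rule_format, OF _ _ assms(2)]
  interpret insertion R xs "[End_bimod R, N]" "[N]" zs "\<lambda>b. frag_of [lact N (ev (b ! 0)) (b ! 1)]"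
    "str_phi xs [] (N # zs)"
    by (rule insertion_unit_right[OF assms])
  show ?thesis
  proof (rule tensor_map)
    fix x s assume x: "x \<in> rfrags (xs @ [End_bimod R, N] @ zs)" and s: "s \<in> carrier R"
    note xf = rfrags_subset[OF x] and op = additive_actions[OF s]
    have "T (op_at Src (Ract s) (length xs + 0) x) = T (op_at Src (Rbar s) (length xs + 0) x)"
      using xf
    proof (induction x rule: frags_induct3)
      case (tuple a b c)
      then show ?case using T_op_at_mid[OF tuple op(3), of 0] T_op_at_mid[OF tuple op(4), of 0] s
        by (auto simp: op_at_frag_of ev_End)
    qed (simp_all add: op_at_diff frag_extend_diff)
    also have "teq Tgt \<dots> (T (op_at Src (Ract s) (length xs + 1) x))"
      by (rule respectful_teq[OF respectful]) (use x s in \<open>simp add: rfrags_def\<close>)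
    also have "teq Tgt \<dots> (op_at Tgt (Ract s) (length xs + 0) (T x))"
      by (rule T_op_at_block[OF xf op(3)])
        (use s assms comm(2) in \<open>auto simp: op_at_frag_of ev_End\<close>)
    finally show "teq Tgt (T (op_at Src (Ract s) (length xs) x)) (op_at Tgt (Ract s) (length xs) (T x))"
      by simp
    show "teq Tgt (T (op_at Src (Rbar s) (length xs + (length [End_bimod R, N] - 1)) x))
        (op_at Tgt (Rbar s) (length xs + (length [N] - 1)) (T x))"
      by (rule T_op_at_block[OF xf op(4)])
        (use s assms comm(3) in \<open>auto simp: op_at_frag_of ev_End\<close>)
  qed auto
qed

lemma tensor_map_unit_left:
  assumes "bimods xs" "env_bimodule R M"
  shows "tensor_map (xs @ [M, End_bimod R]) (xs @ [M]) (str_phi (xs @ [M]) [] [])"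
proof -
  note comm = commutes_actions[unfolded commutes_def, rule_format, OF _ _ assms(2)]
  interpret insertion R xs "[M, End_bimod R]" "[M]" "[]" "\<lambda>b. frag_of [lbar M (ev (b ! 1)) (b ! 0)]"
    "str_phi (xs @ [M]) [] []"
    by (rule insertion_unit_left[OF assms])
  have "tensor_map Src Tgt (str_phi (xs @ [M]) [] [])"
  proof (rule tensor_map)
    fix x s assume x: "x \<in> rfrags Src" and s: "s \<in> carrier R"
    note xf = rfrags_subset[OF x] and op = additive_actions[OF s]
    have "teq Tgt (T (op_at Src (Ract s) (length xs + 0) x)) (op_at Tgt (Ract s) (length xs + 0) (T x))"
      by (rule T_op_at_block[OF xf op(3)])
        (use s assms comm(4) in \<open>auto simp: op_at_frag_of ev_End\<close>)
    then show "teq Tgt (T (op_at Src (Ract s) (length xs) x)) (op_at Tgt (Ract s) (length xs) (T x))"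
      by simp
    have "T (op_at Src (Rbar s) (length xs + 1) x) = T (op_at Src (Ract s) (length xs + 1) x)"
      using xf
    proof (induction x rule: frags_induct3)
      case (tuple a b c)
      then show ?case using T_op_at_mid[OF tuple op(3), of 1] T_op_at_mid[OF tuple op(4), of 1] s
        by (auto simp: op_at_frag_of ev_End)
    qed (simp_all add: op_at_diff frag_extend_diff)
    also have "teq Tgt \<dots> (T (op_at Src (Rbar s) (length xs + 0) x))"
      by (rule teq_sym[OF respectful_teq[OF respectful]])
        (use x s assms in \<open>auto simp: rfrags_def\<close>)
    also have "teq Tgt \<dots> (op_at Tgt (Rbar s) (length xs + 0) (T x))"
      by (rule T_op_at_block[OF xf op(4)])
        (use s assms comm(5) in \<open>auto simp: op_at_frag_of ev_End\<close>)
    finally show "teq Tgt (T (op_at Src (Rbar s) (length xs + (length [M, End_bimod R] - 1)) x))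
        (op_at Tgt (Rbar s) (length xs + (length [M] - 1)) (T x))"
      by simp
  qed auto
  then show ?thesis by simp
qed

lemma tensor_map_structure_phi:
  assumes "bimods (xs @ ys @ zs)" "xs @ ys @ zs \<noteq> []"
  shows "tensor_map (xs @ [rprod R ys] @ zs) (xs @ ys @ zs) (str_phi xs ys zs)"
proof -
  consider "ys \<noteq> []" | (right) N zs' where "ys = []" "zs = N # zs'"
    | (left) M xs' where "ys = []" "zs = []" "xs = xs' @ [M]"
    using assms(2) by (metis append_Nil append_Nil2 neq_Nil_conv rev_exhaust)
  then show ?thesis
  proof cases
    case 1
    then show ?thesis using tensor_map_assoc[of xs ys zs] assms by simp
  next
    case right
    then show ?thesis using tensor_map_unit_right[of xs N zs'] assms by simp
  next
    case left
    then show ?thesis using tensor_map_unit_left[of xs' M] assms by simp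
  qed
qed

lemma bimods_insert: "bimods (xs @ ys @ zs) \<Longrightarrow> bimods (xs @ [rprod R ys] @ zs)"
  by (simp add: env_bimodule_rprod)

lemma structure_map_hom:
  assumes "bimods (xs @ ys @ zs)"
  shows "smap xs ys zs
    \<in> Hom (bimod_category R) (rprod R (xs @ [rprod R ys] @ zs)) (rprod R (xs @ ys @ zs))"
proof (cases "xs @ ys @ zs = []")
  case True
  then show ?thesis using Ident_hom[OF env_bimodule_End] by (simp add: structure_map_Nil)
next
  case False
  show ?thesis
    unfolding structure_map_eq[OF False]
    by (rule rprod_induced_hom[OF tensor_map_structure_phi[OF assms False] bimods_insert assms])
      (use assms False in auto)
qed


section \<open>Coherence\<close>

lemma str_phi_mult_assoc:
  assumes "bimods xs" "bimods ys" "bimods zs" "ys \<noteq> []"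
    and "x \<in> frags xs" "m \<in> carrier (rprod R ys)" "z \<in> frags zs"
  shows "lin (str_phi xs ys zs) (x * frag_of [m] * z) = x * rep ys m * z"
  using insertion.T_mult[OF insertion_assoc[OF assms(1-4)] assms(5), of "frag_of [m]" z] assms by simp

lemma str_phi_mult_right:
  assumes "zs \<noteq> []" "x \<in> frags xs" "z \<in> frags zs"
  shows "lin (str_phi xs [] zs) (x * frag_of [\<phi>] * z) =
    x * op_at zs (Lact (ev \<phi>)) 0 z"
  using assms(2)
proof (induction x rule: frags_induct)
  case (tuple a)
  show ?case
    using assms(3)
  proof (induction z rule: frags_induct)
    case (tuple c)
    obtain N zs' where zs: "zs = N # zs'" using assms(1) by (cases zs) auto
    with tuple obtain n c' where c: "c = n # c'" by auto
    show ?case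
      using str_phi_unit_right[OF tuples_length[OF \<open>a \<in> tuples xs\<close>], of N zs' \<phi> n c']
      by (simp add: zs c op_at_frag_of flip: frag_of_append)
  qed (simp_all add: op_at_diff frag_extend_diff right_diff_distrib)
qed (simp_all add: frag_extend_diff left_diff_distrib)

lemma str_phi_mult_left:
  assumes "xs \<noteq> []" "x \<in> frags xs"
  shows "lin (str_phi xs [] []) (x * frag_of [\<phi>]) =
    op_at xs (Lbar (ev \<phi>)) (length xs - 1) x"
  using assms(2)
proof (induction x rule: frags_induct)
  case (tuple a)
  obtain xs' M where xs: "xs = xs' @ [M]" using assms(1) by (cases xs rule: rev_cases) auto
  with tuple obtain a' m where a: "a = a' @ [m]" "a' \<in> tuples xs'" by (auto simp: tuples_append)
  show ?case
    using str_phi_unit_left[OF tuples_length[OF a(2)], of M m \<phi>] tuples_length[OF a(2)]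
    by (simp add: xs a op_at_frag_of nth_append list_update_append flip: frag_of_append)
qed (simp_all add: op_at_diff frag_extend_diff left_diff_distrib)

lemma op_at_lact_mult:
  assumes "zs \<noteq> []" "x \<in> frags zs" "y \<in> frags ws"
  shows "op_at (zs @ ws) op 0 (x * y) = op_at zs op 0 x * y"
  using assms by (intro op_at_left) auto

lemma op_at_last_mult:
  assumes "zs \<noteq> []" "x \<in> frags ws" "y \<in> frags zs"
  shows "op_at (ws @ zs) op (length (ws @ zs) - 1) (x * y) = x * op_at zs op (length zs - 1) y"
  using assms by (intro op_at_right) (auto simp: Suc_leI)

lemma str_phi_mult_left_teq:
  assumes bim: "bimods xs" "bimods zs" and ne: "xs \<noteq> []" and x: "x \<in> frags xs" and c: "c \<in> tuples zs"
    and \<phi>: "\<phi> \<in> carrier (End_bimod R)"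
  shows "teq (xs @ zs) (lin (str_phi xs [] zs) (x * frag_of [\<phi>] * frag_of c))
    (op_at xs (Lbar (ev \<phi>)) (length xs - 1) x * frag_of c)"
proof (cases "zs = []")
  case True
  then show ?thesis using c str_phi_mult_left[OF ne x] by (simp add: frag_of_Nil)
next
  case False
  have "teq (xs @ zs) (op_at (xs @ zs) (Lbar (ev \<phi>)) (length xs - 1) (x * frag_of c))
      (op_at (xs @ zs) (Lact (ev \<phi>)) (Suc (length xs - 1)) (x * frag_of c))"
    by (rule teq_balanced) (use assms False ev_End in \<open>auto intro: frags_mult\<close>)
  moreover have "op_at (xs @ zs) (Lact (ev \<phi>)) (Suc (length xs - 1)) (x * frag_of c) =
      x * op_at zs (Lact (ev \<phi>)) 0 (frag_of c)"
    using assms by (intro op_at_right) auto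
  moreover have "op_at (xs @ zs) (Lbar (ev \<phi>)) (length xs - 1) (x * frag_of c) =
      op_at xs (Lbar (ev \<phi>)) (length xs - 1) x * frag_of c"
    using assms by (intro op_at_left) auto
  ultimately show ?thesis
    using str_phi_mult_right[OF False x, of "frag_of c"] c bim by (simp add: teq_sym)
qed

lemma str_phi_local:
  assumes bim: "bimods xs" "bimods ys" "bimods zs" "bimods ws" "bimods vs"
    and ne: "ys @ zs @ ws \<noteq> []"
    and a: "a \<in> tuples xs" and c: "c \<in> tuples vs" and y: "y \<in> frags (ys @ [rprod R zs] @ ws)"
  shows "teq (xs @ ys @ zs @ ws @ vs)
    (lin (str_phi (xs @ ys) zs (ws @ vs)) (frag_of a * y * frag_of c))
    (frag_of a * lin (str_phi ys zs ws) y * frag_of c)"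
  using y
proof (induction y rule: frags_induct3)
  case (tuple p b q)
  then obtain m where m: "b = [m]" "m \<in> carrier (rprod R zs)" by auto
  let ?A = "frag_of a" and ?P = "frag_of p" and ?Q = "frag_of q" and ?C = "frag_of c"
  have AP: "?A * ?P \<in> frags (xs @ ys)" and QC: "?Q * ?C \<in> frags (ws @ vs)"
    using a c tuple by (auto intro: frags_mult)
  have assoc: "?A * (?P * frag_of b * ?Q) * ?C = (?A * ?P) * frag_of [m] * (?Q * ?C)"
    by (simp add: mult.assoc m)
  consider (assoc) "zs \<noteq> []" | (right) "zs = []" "ws \<noteq> []" | (left) "zs = []" "ws = []" "ys \<noteq> []"
    using ne by auto
  then show ?case
  proof cases
    case assoc
    then show ?thesis
      using str_phi_mult_assoc[OF _ bim(3) _ assoc AP m(2) QC] str_phi_mult_assoc[OF bim(2-4) assoc, of ?P m ?Q]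
        tuple m bim
      unfolding \<open>?A * (?P * frag_of b * ?Q) * ?C = _\<close> by (simp add: mult.assoc)
  next
    case right
    then show ?thesis
      using str_phi_mult_right[OF _ AP QC, of m] str_phi_mult_right[of ws ?P ys ?Q m]
        op_at_lact_mult[of ws ?Q ?C vs] tuple m c
      unfolding assoc by (simp add: mult.assoc)
  next
    case left
    then have q: "?Q = 1" using tuple by (simp add: frag_of_Nil)
    have "teq (xs @ ys @ vs) (lin (str_phi (xs @ ys) [] vs) ((?A * ?P) * frag_of [m] * ?C))
       (op_at (xs @ ys) (Lbar (ev m)) (length (xs @ ys) - 1) (?A * ?P) * ?C)"
      using str_phi_mult_left_teq[of "xs @ ys" vs "?A * ?P" c m] bim left AP c m by simp
    then show ?thesis
      using str_phi_mult_left[of ys ?P m] op_at_last_mult[of ys ?A xs ?P] tuple a left m q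
      unfolding assoc by (simp add: mult.assoc)
  qed
next
  case (diff x y)
  from teq_diff[OF diff(3,4)] bim show ?case
    by (simp add: frag_extend_diff left_diff_distrib right_diff_distrib)
qed simp

lemma rprod_induced_comp_eqI:
  assumes "tensor_map Ms Ns phi" "tensor_map Ns Os psi" "tensor_map Ms Ns' phi'" "tensor_map Ns' Os psi'"
    and "bimods Ms" "bimods Ns" "bimods Ns'" "bimods Os" "Ms \<noteq> []" "Ns \<noteq> []" "Ns' \<noteq> []"
    and "\<And>t. t \<in> tuples Ms \<Longrightarrow> teq Os (lin psi (phi t)) (lin psi' (phi' t))"
  shows "bcomp (rind Ns Os psi) (rind Ms Ns phi) =
    bcomp (rind Ns' Os psi') (rind Ms Ns' phi')"
proof -
  note resp = assms(1-4)[THEN tensor_map_respectful]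
  have "rind Ms Os (\<lambda>t. lin psi (phi t)) =
      rind Ms Os (\<lambda>t. lin psi' (phi' t))"
    using assms
    by (intro rprod_induced_eqI respectful_compose[OF resp(1,2)] respectful_compose[OF resp(3,4)]
        teq_extend_cong[OF rfrags_subset]) auto
  then show ?thesis
    using assms resp by (simp add: rprod_induced_comp)
qed

lemma structure_map_Mor:
  "bimods (xs @ ys @ zs) \<Longrightarrow> smap xs ys zs \<in> Mor (bimod_category R)"
  using structure_map_hom by (auto simp: Hom_def)

lemma structure_map_src_tgt:
  assumes "bimods (xs @ ys @ zs)"
  shows "src (smap xs ys zs) = rprod R (xs @ [rprod R ys] @ zs)"
    "tgt (smap xs ys zs) = rprod R (xs @ ys @ zs)"
  using structure_map_hom[OF assms] by (auto simp: Hom_def)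

lemma mors_Ident: "bimods Ms \<Longrightarrow> mors (map (ident) Ms)"
  using Ident_hom by (auto simp: Hom_def bimods_def)

lemma structure_map_outer_Ident:
  assumes bim: "bimods xs"
  shows "smap [] xs [] = ident (rprod R xs)"
proof (cases "xs = []")
  case True
  then show ?thesis by (simp add: structure_map_Nil)
next
  case False
  have P: "env_bimodule R (rprod R xs)" using bim by (rule env_bimodule_rprod)
  have "tensor_map ([] @ [rprod R xs] @ []) ([] @ xs @ []) (str_phi [] xs [])"
    by (rule tensor_map_structure_phi) (use bim False in auto)
  then have resp: "respectful [rprod R xs] xs (str_phi [] xs [])"
    by (simp add: tensor_map_respectful)
  have "fn (smap [] xs []) m = m" if m: "m \<in> carrier (rprod R xs)" for m
    using rprod_induced_val[OF resp, of "frag_of [m]"] P False bim m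
      str_phi_assoc[OF False, of "[]" "[]" "[]" m "[]"] structure_map_eq[of "[]" xs "[]"]
    by (simp add: val_singleton rfrags_singleton frag_of_Nil rprod_elt)
  moreover have "fn (smap [] xs []) \<in> extensional (carrier (rprod R xs))"
    using False by (simp add: structure_map_eq rprod_induced_def)
  ultimately show ?thesis
    using structure_map_src_tgt[of "[]" xs "[]"] bim
    by (intro bimod_mor_eqI) (auto intro: extensionalityI[of _ "carrier (rprod R xs)"])
qed

lemma structure_map_inner_Ident:
  assumes bim: "bimods (xs @ [M] @ zs)"
  shows "smap xs [M] zs = ident (rprod R (xs @ [M] @ zs))"
proof -
  have M: "env_bimodule R M" using bim by simp
  have tm: "tensor_map (xs @ [M] @ zs) (xs @ [M] @ zs) (str_phi xs [M] zs)"
    using tensor_map_structure_phi[OF bim] by simp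
  have "teq (xs @ [M] @ zs) (str_phi xs [M] zs t) (frag_of t)" if "t \<in> tuples (xs @ [M] @ zs)" for t
  proof -
    obtain a m c where t: "a \<in> tuples xs" "m \<in> carrier M" "c \<in> tuples zs" "t = a @ [m] @ c"
      using \<open>t \<in> _\<close> by (auto simp: tuples_append)
    have "teq [M] (rep [M] m) (frag_of [m])"
      using rep_val[of "[M]" "frag_of [m]"] t(2) M by (simp add: val_singleton)
    then have "teq (xs @ [M] @ zs) (frag_of a * rep [M] m * frag_of c)
        (frag_of a * frag_of [m] * frag_of c)"
      using t bim by (intro teq_mult3) auto
    moreover have "str_phi xs [M] zs t = frag_of a * rep [M] m * frag_of c"
      unfolding t(4) by (rule str_phi_assoc) (use t tuples_length in auto)
    ultimately show ?thesis
      unfolding t(4) frag_of_append mult.assoc[symmetric] by simp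
  qed
  from rprod_induced_Ident[OF tensor_map_respectful[OF tm] bim _ this] show ?thesis
    by (simp add: structure_map_eq)
qed

lemma structure_map_assoc_nested:
  assumes bim: "bimods (xs @ ys @ zs @ ws @ vs)"
  shows "bcomp (smap (xs @ ys) zs (ws @ vs))
      (smap xs (ys @ [rprod R zs] @ ws) vs) =
    bcomp (smap xs (ys @ zs @ ws) vs)
      (rprod_mor R (map (ident) xs @ [smap ys zs ws] @
         map (ident) vs))"
proof (cases "ys @ zs @ ws = []")
  case True
  have E: "bimods (xs @ [End_bimod R] @ vs)" "bimods (xs @ [] @ vs)"
    using bim env_bimodule_End by auto
  have "smap xs [End_bimod R] vs =
      ident (rprod R (xs @ [End_bimod R] @ vs))"
    by (rule structure_map_inner_Ident[OF E(1)])
  moreover have "rprod_mor R (map (ident) xs @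
      [ident (End_bimod R)] @ map (ident) vs) =
      ident (rprod R (xs @ [End_bimod R] @ vs))"
    using rprod_mor_Ident[OF E(1)] by simp
  ultimately show ?thesis using True by (simp add: structure_map_Nil)
next
  case False
  let ?P = "rprod R zs" and ?B = "ys @ [rprod R zs] @ ws" and ?C = "ys @ zs @ ws"
  let ?G = "smap ys zs ws"
  let ?Fs = "map (ident) xs @ [?G] @ map (ident) vs"
  have bims: "bimods xs" "bimods ys" "bimods zs" "bimods ws" "bimods vs" using bim by auto
  have B: "bimods ?B" and C: "bimods ?C" using bims by (simp_all add: env_bimodule_rprod)
  have G: "?G = rind ?B ?C (str_phi ys zs ws)"
    by (rule structure_map_eq[OF False])
  have Fs: "mors ?Fs"
    using mors_Ident[OF bims(1)] mors_Ident[OF bims(5)] structure_map_Mor[OF C] by auto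
  have src: "map src ?Fs = xs @ [rprod R ?B] @ vs" and tgt: "map tgt ?Fs = xs @ [rprod R ?C] @ vs"
    using structure_map_src_tgt[OF C] by (simp_all add: comp_def)
  note phi = tensor_map_structure_phi[OF C False]
  have tm1: "tensor_map (xs @ [rprod R ?B] @ vs) (xs @ ?B @ vs) (str_phi xs ?B vs)"
    by (rule tensor_map_structure_phi) (use bims B in auto)
  have tm2: "tensor_map (xs @ ?B @ vs) (xs @ ?C @ vs) (str_phi (xs @ ys) zs (ws @ vs))"
    using tensor_map_structure_phi[of "xs @ ys" zs "ws @ vs"] bims False by auto
  have tm3: "tensor_map (xs @ [rprod R ?B] @ vs) (xs @ [rprod R ?C] @ vs) (map_tuple ?Fs)"
    using tensor_map_map_tuple[OF Fs] unfolding src tgt by simp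
  have tm4: "tensor_map (xs @ [rprod R ?C] @ vs) (xs @ ?C @ vs) (str_phi xs ?C vs)"
    by (rule tensor_map_structure_phi) (use bims False in auto)
  have eq1: "rprod_mor R ?Fs =
      rind (xs @ [rprod R ?B] @ vs) (xs @ [rprod R ?C] @ vs) (map_tuple ?Fs)"
    using rprod_mor_nonempty[of ?Fs] unfolding src tgt by simp
  have eq2: "smap (xs @ ys) zs (ws @ vs) =
      rind (xs @ ?B @ vs) (xs @ ?C @ vs) (str_phi (xs @ ys) zs (ws @ vs))"
    using structure_map_eq[of "xs @ ys" zs "ws @ vs"] False by auto
  have eq3: "smap xs ?B vs =
      rind (xs @ [rprod R ?B] @ vs) (xs @ ?B @ vs) (str_phi xs ?B vs)"
    by (rule structure_map_eq) auto
  have eq4: "smap xs ?C vs =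
      rind (xs @ [rprod R ?C] @ vs) (xs @ ?C @ vs) (str_phi xs ?C vs)"
    by (rule structure_map_eq) (use False in auto)
  show ?thesis
    unfolding eq1 eq2 eq3 eq4
  proof (rule rprod_induced_comp_eqI[OF tm1 tm2 tm3 tm4])
    fix t assume "t \<in> tuples (xs @ [rprod R ?B] @ vs)"
    then obtain a b c where t: "a \<in> tuples xs" "b \<in> carrier (rprod R ?B)" "c \<in> tuples vs" "t = a @ [b] @ c"
      by (auto simp: tuples_append simp del: append.simps)
    have y: "rep ?B b \<in> rfrags ?B" "val ?B (rep ?B b) = b"
      using rprod_elt[OF B _ t(2)] by auto
    let ?y = "rep ?B b"
    have yf: "?y \<in> frags ?B" by (rule rfrags_subset[OF y(1)])
    have z: "lin (str_phi ys zs ws) ?y \<in> frags ?C"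
      by (rule respectful_frags[OF tensor_map_respectful[OF phi] yf])
    have Gb: "fn ?G b = val ?C (lin (str_phi ys zs ws) ?y)"
      using rprod_induced_val[OF tensor_map_respectful[OF phi] B C _ y(1)] y(2) unfolding G by simp
    have "map2 fn ?Fs t = a @ [fn ?G b] @ c"
      using tuples_length[OF t(1)] tuples_length[OF t(3)] tuples_nth[OF t(1)] tuples_nth[OF t(3)]
      unfolding t(4) by (auto intro!: nth_equalityI simp: nth_append)
    then have "lin (str_phi xs ?C vs) (map_tuple ?Fs t) =
        str_phi xs ?C vs (a @ [fn ?G b] @ c)" by simp
    also have "\<dots> = frag_of a * rep ?C (fn ?G b) * frag_of c"
      by (rule str_phi_assoc[OF False tuples_length[OF t(1)]])
    also have "teq (xs @ ?C @ vs) \<dots> (frag_of a * lin (str_phi ys zs ws) ?y * frag_of c)"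
      unfolding Gb by (intro teq_mult3 rep_val[OF C False z]) (use t bims in auto)
    finally have 1: "teq (xs @ ?C @ vs) (lin (str_phi xs ?C vs) (map_tuple ?Fs t))
        (frag_of a * lin (str_phi ys zs ws) ?y * frag_of c)" .
    have "str_phi xs ?B vs t = frag_of a * ?y * frag_of c"
      unfolding t(4) by (rule str_phi_assoc) (use tuples_length[OF t(1)] in auto)
    then have "teq (xs @ ?C @ vs)
        (lin (str_phi (xs @ ys) zs (ws @ vs)) (str_phi xs ?B vs t))
        (frag_of a * lin (str_phi ys zs ws) ?y * frag_of c)"
      using str_phi_local[OF bims False t(1,3) yf] by simp
    also have "teq (xs @ ?C @ vs) \<dots> (lin (str_phi xs ?C vs) (map_tuple ?Fs t))"
      by (rule teq_sym[OF 1]) (use bims in auto)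
    finally show "teq (xs @ ?C @ vs)
        (lin (str_phi (xs @ ys) zs (ws @ vs)) (str_phi xs ?B vs t))
        (lin (str_phi xs ?C vs) (map_tuple ?Fs t))" .
  qed (use bims B C False env_bimodule_rprod[OF B] env_bimodule_rprod[OF C] in \<open>auto\<close>)
qed

lemma map_tuple_mult:
  assumes "x \<in> frags (map src Fs)" "y \<in> frags (map src Gs)"
  shows "lin (map_tuple (Fs @ Gs)) (x * y) =
    lin (map_tuple Fs) x * lin (map_tuple Gs) y"
  by (rule frag_extend_mult[OF assms]) (auto dest!: tuples_length simp: frag_of_append)

lemma Ident_End_Mor: "ident (End_bimod R) \<in> Mor (bimod_category R)"
  using Ident_hom[OF env_bimodule_End] by (auto simp: Hom_def)

lemma structure_map_natural:
  assumes mors: "mors (fs @ gs @ hs)"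
  shows "bcomp (smap (map tgt fs) (map tgt gs) (map tgt hs))
      (rprod_mor R (fs @ [rprod_mor R gs] @ hs)) =
    bcomp (rprod_mor R (fs @ gs @ hs))
      (smap (map src fs) (map src gs) (map src hs))"
proof (cases "fs @ gs @ hs = []")
  case True
  then show ?thesis
    by (simp add: structure_map_Nil rprod_mor_Nil rprod_mor_singleton[OF Ident_End_Mor])
next
  case False
  let ?G = "rprod_mor R gs"
  let ?Fs = "fs @ [?G] @ hs"
  let ?xs = "map src fs" and ?ys = "map src gs" and ?zs = "map src hs"
  let ?xt = "map tgt fs" and ?yt = "map tgt gs" and ?zt = "map tgt hs"
  have ms: "mors fs" "mors gs" "mors hs" using mors by auto
  note bims = mors_bimods(1)[OF ms(1)] mors_bimods(1)[OF ms(2)] mors_bimods(1)[OF ms(3)]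
    mors_bimods(2)[OF ms(1)] mors_bimods(2)[OF ms(2)] mors_bimods(2)[OF ms(3)]
  have G: "?G \<in> Mor (bimod_category R)" "src ?G = rprod R ?ys" "tgt ?G = rprod R ?yt"
    using rprod_mor_hom[OF ms(2)] by (auto simp: Hom_def)
  have Fs: "mors ?Fs" using ms G by auto
  have src: "map src ?Fs = ?xs @ [rprod R ?ys] @ ?zs" and tgt: "map tgt ?Fs = ?xt @ [rprod R ?yt] @ ?zt"
    using G by auto
  have tm1: "tensor_map (?xs @ [rprod R ?ys] @ ?zs) (?xt @ [rprod R ?yt] @ ?zt) (map_tuple ?Fs)"
    using tensor_map_map_tuple[OF Fs] unfolding src tgt by simp
  have tm2: "tensor_map (?xt @ [rprod R ?yt] @ ?zt) (?xt @ ?yt @ ?zt) (str_phi ?xt ?yt ?zt)"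
    by (rule tensor_map_structure_phi) (use bims False in auto)
  have tm3: "tensor_map (?xs @ [rprod R ?ys] @ ?zs) (?xs @ ?ys @ ?zs) (str_phi ?xs ?ys ?zs)"
    by (rule tensor_map_structure_phi) (use bims False in auto)
  have tm4: "tensor_map (?xs @ ?ys @ ?zs) (?xt @ ?yt @ ?zt) (map_tuple (fs @ gs @ hs))"
    using tensor_map_map_tuple[OF mors False] by simp
  have eq1: "rprod_mor R ?Fs =
      rind (?xs @ [rprod R ?ys] @ ?zs) (?xt @ [rprod R ?yt] @ ?zt) (map_tuple ?Fs)"
    using rprod_mor_nonempty[of ?Fs] unfolding src tgt by simp
  have eq2: "rprod_mor R (fs @ gs @ hs) =
      rind (?xs @ ?ys @ ?zs) (?xt @ ?yt @ ?zt) (map_tuple (fs @ gs @ hs))"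
    using rprod_mor_nonempty[OF False] by simp
  have eq3: "smap ?xs ?ys ?zs =
      rind (?xs @ [rprod R ?ys] @ ?zs) (?xs @ ?ys @ ?zs) (str_phi ?xs ?ys ?zs)"
    "smap ?xt ?yt ?zt =
      rind (?xt @ [rprod R ?yt] @ ?zt) (?xt @ ?yt @ ?zt) (str_phi ?xt ?yt ?zt)"
    by (rule structure_map_eq; use False in auto)+
  show ?thesis
    unfolding eq1 eq2 eq3
  proof (rule rprod_induced_comp_eqI[OF tm1 tm2 tm3 tm4])
    fix t assume "t \<in> tuples (?xs @ [rprod R ?ys] @ ?zs)"
    then obtain a m c where t: "a \<in> tuples ?xs" "m \<in> carrier (rprod R ?ys)" "c \<in> tuples ?zs"
      "t = a @ [m] @ c"
      by (auto simp: tuples_append)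
    have len: "length a = length fs" "length c = length hs" using t tuples_length by force+
    let ?a = "map2 fn fs a" and ?c = "map2 fn hs c"
    have ac: "?a \<in> tuples ?xt" "?c \<in> tuples ?zt"
      using map_tuple_tuples ms t by auto
    have Ft: "map2 fn ?Fs t = ?a @ [fn ?G m] @ ?c"
      using len by (simp add: t(4))
    have t_eq: "frag_of t = frag_of a * frag_of [m] * frag_of c"
      unfolding t(4) by (simp only: frag_of_append mult.assoc)
    have Ft_eq: "frag_of (map2 fn ?Fs t) = frag_of ?a * frag_of [fn ?G m] * frag_of ?c"
      unfolding Ft by (simp only: frag_of_append mult.assoc)
    consider (assoc) "gs \<noteq> []" | (right) "gs = []" "hs \<noteq> []" | (left) "gs = []" "hs = []" "fs \<noteq> []"
      using False by auto
    then show "teq (?xt @ ?yt @ ?zt) (lin (str_phi ?xt ?yt ?zt) (map_tuple ?Fs t))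
        (lin (map_tuple (fs @ gs @ hs)) (str_phi ?xs ?ys ?zs t))"
    proof cases
      case assoc
      let ?y = "rep ?ys m"
      have ne: "?ys \<noteq> []" "?yt \<noteq> []" using assoc by auto
      note y = rprod_elt[OF bims(2) ne(1) t(2)]
      note yf = rfrags_subset[OF y(1)]
      have "fn ?G m = val ?yt (lin (map_tuple gs) ?y)"
        using rprod_induced_val[OF respectful_map_tuple[OF ms(2)] bims(2,5) ne(1) y(1)] y(2) assoc
        by (simp add: rprod_mor_nonempty)
      then have "teq ?yt (rep ?yt (fn ?G m)) (lin (map_tuple gs) ?y)"
        using rep_val[OF bims(5) ne(2) respectful_frags[OF respectful_map_tuple[OF ms(2)] yf]] by simp
      then have "teq (?xt @ ?yt @ ?zt) (frag_of ?a * rep ?yt (fn ?G m) * frag_of ?c)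
          (frag_of ?a * lin (map_tuple gs) ?y * frag_of ?c)"
        using bims ac by (intro teq_mult3) auto
      moreover have "str_phi ?xt ?yt ?zt (map2 fn ?Fs t) =
          frag_of ?a * rep ?yt (fn ?G m) * frag_of ?c"
        unfolding Ft by (rule str_phi_assoc[OF ne(2)]) (use len in auto)
      moreover have "lin (map_tuple (fs @ gs @ hs)) (str_phi ?xs ?ys ?zs t) =
          frag_of ?a * lin (map_tuple gs) ?y * frag_of ?c"
      proof -
        have "str_phi ?xs ?ys ?zs t = frag_of a * (?y * frag_of c)"
          unfolding t(4) mult.assoc[symmetric] by (rule str_phi_assoc[OF ne(1)]) (use len in auto)
        moreover have "?y * frag_of c \<in> frags (map src (gs @ hs))"
          using frags_mult[OF yf, of "frag_of c" ?zs] t by simp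
        ultimately show ?thesis
          using map_tuple_mult[of "frag_of a" fs "?y * frag_of c" "gs @ hs"]
            map_tuple_mult[OF yf, of "frag_of c" hs] t by (simp add: mult.assoc)
      qed
      ultimately show ?thesis by simp
    next
      case right
      have m: "m \<in> carrier (End_bimod R)" "fn ?G m = m" using t(2) right by (simp_all add: rprod_mor_Nil)
      have e: "ev m \<in> carrier R" by (rule ev_End[OF m(1)])
      have hs0: "0 < length hs" using right by simp
      have "lin (str_phi ?xt [] ?zt) (frag_of ?a * frag_of [m] * frag_of ?c) =
          frag_of ?a * op_at ?zt (Lact (ev m)) 0 (frag_of ?c)"
        by (rule str_phi_mult_right) (use right ac in auto)
      then have "str_phi ?xt [] ?zt (map2 fn ?Fs t) =
          frag_of ?a * op_at ?zt (Lact (ev m)) 0 (frag_of ?c)"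
        using Ft_eq unfolding m(2) by (metis frag_extend_of)
      moreover have "lin (str_phi ?xs [] ?zs) (frag_of a * frag_of [m] * frag_of c) =
          frag_of a * op_at ?zs (Lact (ev m)) 0 (frag_of c)"
        by (rule str_phi_mult_right) (use right t in auto)
      then have "str_phi ?xs [] ?zs t = frag_of a * op_at ?zs (Lact (ev m)) 0 (frag_of c)"
        unfolding t_eq[symmetric] by simp
      moreover have "op_at ?zs (Lact (ev m)) 0 (frag_of c) \<in> frags ?zs"
        by (rule op_at_closed[OF additive_actions(1)[OF e] bims(3)]) (use hs0 t in auto)
      moreover have "lin (map_tuple hs) (op_at ?zs (Lact (ev m)) 0 (frag_of c)) =
          op_at ?zt (Lact (ev m)) 0 (lin (map_tuple hs) (frag_of c))"
        by (rule map_tuple_op_at[OF ms(3)])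
          (use hs0 t e bimod_mapsD(4)[OF mors_nth(3)[OF ms(3) hs0]] in auto)
      ultimately show ?thesis
        using right t(1) map_tuple_mult[of "frag_of a" fs "op_at ?zs (Lact (ev m)) 0 (frag_of c)" hs]
        by simp
    next
      case left
      have m: "m \<in> carrier (End_bimod R)" "fn ?G m = m" using t(2) left by (simp_all add: rprod_mor_Nil)
      have e: "ev m \<in> carrier R" by (rule ev_End[OF m(1)])
      have c: "c = []" using left t by simp
      have fs1: "length fs - 1 < length fs" using left by simp
      have "lin (str_phi ?xt [] []) (frag_of ?a * frag_of [m]) =
          op_at ?xt (Lbar (ev m)) (length ?xt - 1) (frag_of ?a)"
        by (rule str_phi_mult_left) (use left ac in auto)
      moreover have "lin (str_phi ?xs [] []) (frag_of a * frag_of [m]) =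
          op_at ?xs (Lbar (ev m)) (length ?xs - 1) (frag_of a)"
        by (rule str_phi_mult_left) (use left t in auto)
      moreover have "lin (map_tuple fs) (op_at ?xs (Lbar (ev m)) (length fs - 1) (frag_of a)) =
          op_at ?xt (Lbar (ev m)) (length fs - 1) (lin (map_tuple fs) (frag_of a))"
        by (rule map_tuple_op_at[OF ms(1)])
          (use fs1 t e bimod_mapsD(5)[OF mors_nth(3)[OF ms(1) fs1]] in auto)
      moreover have "str_phi ?xs [] [] t = lin (str_phi ?xs [] []) (frag_of a * frag_of [m])"
        by (simp add: t(4) c flip: frag_of_append)
      moreover have "frag_of (map2 fn ?Fs t) = frag_of ?a * frag_of [m]"
        using Ft_eq unfolding m(2) c by (simp add: frag_of_Nil)
      ultimately show ?thesis
        using left by simp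
    qed
  qed (use bims False env_bimodule_rprod[OF bims(2)] env_bimodule_rprod[OF bims(5)] in auto)
qed


lemma ev_val_diff:
  assumes "x \<in> frags [End_bimod R]" "y \<in> frags [End_bimod R]"
  shows "ev (val [End_bimod R] (x - y)) = ev (val [End_bimod R] x) \<ominus>\<^bsub>R\<^esub> ev (val [End_bimod R] y)"
proof -
  let ?E = "End_bimod R" and ?h = "\<lambda>z. ev (val [End_bimod R] z)"
  have E: "bimods [?E]" "env_bimodule R ?E" by (simp_all add: env_bimodule_End)
  have c: "val [?E] z \<in> carrier ?E" if "z \<in> frags [?E]" for z
    using val_singleton_rep[OF E(2) that] by blast
  note xy = frags_diff[OF assms]
  have "val [?E] (x - y) \<oplus>\<^bsub>?E\<^esub> val [?E] y = val [?E] x"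
    using add_rprod[OF E(1) _ xy assms(2)] by simp
  then have "?h x = ?h (x - y) \<oplus>\<^bsub>R\<^esub> ?h y"
    using ev_End(2)[OF c[OF xy] c[OF assms(2)]] by simp
  moreover have "?h x \<in> carrier R" "?h (x - y) \<in> carrier R" "?h y \<in> carrier R"
    using c xy assms ev_End(1) by blast+
  ultimately show ?thesis by (simp add: minus_eq a_assoc r_neg)
qed

lemma End_eqI:
  assumes "f \<in> carrier (End_bimod R)" "g \<in> carrier (End_bimod R)"
    "\<And>s. s \<in> carrier R \<Longrightarrow> the_endo f s = the_endo g s"
  shows "f = g"
  using assms by (auto simp: End_bimod_def PiE_def intro: extensionalityI)

text \<open>
  In \<open>End(R) \<times>\<^sub>R End(R)\<close> both unitors evaluate at \<open>1\<close> to \<open>\<Sum> \<phi>\<^sub>i(1) \<psi>\<^sub>i(1)\<close>.  Applied to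
  \<open>\<Sum> \<phi>\<^sub>i s\<^sup>- \<otimes> \<psi>\<^sub>i = \<Sum> \<phi>\<^sub>i \<otimes> \<psi>\<^sub>i s\<close>, this gives the equality of their values at every \<open>s\<close>.
\<close>

lemma unitors_End_eq:
  "smap [] [] [End_bimod R :: ('r, ('a, 'r) elt) bimod] = smap [End_bimod R] [] []"
proof -
  let ?E = "End_bimod R :: ('r, ('a, 'r) elt) bimod"
  let ?phi = "str_phi [] [] [?E]" and ?psi = "str_phi [?E] [] []"
  let ?L = "lin ?phi" and ?P = "lin ?psi"
  let ?v = "val [?E]"
  have E: "env_bimodule R ?E" by (rule env_bimodule_End)
  have bim: "bimods [?E]" "bimods [?E, ?E]" using E by simp_all
  have tm: "tensor_map [?E, ?E] [?E] ?phi" "tensor_map [?E, ?E] [?E] ?psi"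
    using tensor_map_structure_phi[of "[]" "[]" "[?E]"] tensor_map_structure_phi[of "[?E]" "[]" "[]"] E
    by simp_all
  note resp = tm[THEN tensor_map_respectful]
  interpret L: insertion R "[]" "[?E, ?E]" "[?E]" "[]" "\<lambda>b. frag_of [lact ?E (ev (b ! 0)) (b ! 1)]" ?phi
    by (rule insertion_unit_right) (use E in auto)
  interpret P: insertion R "[]" "[?E, ?E]" "[?E]" "[]" "\<lambda>b. frag_of [lbar ?E (ev (b ! 1)) (b ! 0)]" ?psi
    using insertion_unit_left[of "[]" ?E] E by simp
  note comm = commutes_actions[unfolded commutes_def, rule_format, OF _ _ E]
  have phi: "?L (frag_of [f, g]) = frag_of [lact ?E (ev f) g]" for f g :: "('a, 'r) elt"
    using str_phi_unit_right[of "[]" "[]" ?E "[]" f g "[]"] by simp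
  have psi: "?P (frag_of [f, g]) = frag_of [lbar ?E (ev g) f]" for f g :: "('a, 'r) elt"
    using str_phi_unit_left[of "[]" "[]" ?E f g] by simp
  have ev_eq: "ev (?v (?L y)) = ev (?v (?P y))" if "y \<in> frags [?E, ?E]" for y
    using that
  proof (induction y rule: frags_induct)
    case (tuple t)
    then obtain f g where t: "t = [f, g]" "f \<in> carrier ?E" "g \<in> carrier ?E" by auto
    have "lact ?E (ev f) g \<in> carrier ?E" "lbar ?E (ev g) f \<in> carrier ?E"
      using t E by (simp_all add: bimod_closed ev_End)
    then show ?case
      using ev_End(3)[OF t(3) ev_End(1)[OF t(2)]] ev_End(4)[OF t(2) ev_End(1)[OF t(3)]]
      unfolding t(1) phi psi by (simp only: val_singleton[OF E])
  next
    case (diff x y)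
    then show ?case
      using respectful_frags[OF resp(1)] respectful_frags[OF resp(2)]
      by (simp add: frag_extend_diff ev_val_diff)
  qed simp
  have "teq [?E] (?L x) (?P x)" if x: "x \<in> rfrags [?E, ?E]" for x
  proof -
    note xf = rfrags_subset[OF x]
    note Lf = respectful_frags[OF resp(1)] and Pf = respectful_frags[OF resp(2)]
    note f = val_singleton_rep[OF E Lf[OF xf]] and g = val_singleton_rep[OF E Pf[OF xf]]
    have "the_endo (?v (?L x)) s = the_endo (?v (?P x)) s" if s: "s \<in> carrier R" for s
    proof -
      let ?y = "op_at [?E, ?E] (Rbar s) 0 x"
      note op = additive_actions[OF s]
      have yf: "?y \<in> frags [?E, ?E]" by (rule op_at_closed[OF op(4) bim(2) _ xf]) simp
      have ops: "end_op [?E] (Ract s) 0" "end_op [?E] (Rbar s) 0"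
        using end_op_actions(3,4)[OF _ s, of "[?E]"] by simp_all
      have blockL: "teq [?E]
          (lin (\<lambda>b. frag_of [lact ?E (ev (b ! 0)) (b ! 1)]) (op_at [?E, ?E] (Ract s) 1 (frag_of b)))
          (op_at [?E] (Ract s) 0 (frag_of [lact ?E (ev (b ! 0)) (b ! 1)]))"
        if "b \<in> tuples [?E, ?E]" for b
        using that s comm(2) by (auto simp: op_at_frag_of ev_End)
      have blockP: "teq [?E]
          (lin (\<lambda>b. frag_of [lbar ?E (ev (b ! 1)) (b ! 0)]) (op_at [?E, ?E] (Rbar s) 0 (frag_of b)))
          (op_at [?E] (Rbar s) 0 (frag_of [lbar ?E (ev (b ! 1)) (b ! 0)]))"
        if "b \<in> tuples [?E, ?E]" for b
        using that s comm(5) by (auto simp: op_at_frag_of ev_End)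
      have "teq [?E] (?L ?y) (?L (op_at [?E, ?E] (Ract s) (Suc 0) x))"
        by (rule respectful_teq[OF resp(1)]) (use x s in \<open>simp add: rfrags_def\<close>)
      also have "teq [?E] \<dots> (op_at [?E] (Ract s) 0 (?L x))"
        using L.T_op_at_block[OF _ op(3), of x 1 0, OF _ _ _ blockL] xf by simp
      finally have "?v (?L ?y) = ract ?E (?v (?L x)) s"
        using val_cong[OF bim(1)] val_op_at_singleton[OF E ops(1) Lf[OF xf]] by metis
      then have 1: "ev (?v (?L ?y)) = the_endo (?v (?L x)) s"
        using ev_End(5)[OF conjunct1[OF f] s] by simp
      have "teq [?E] (?P ?y) (op_at [?E] (Rbar s) 0 (?P x))"
        using P.T_op_at_block[OF _ op(4), of x 0 0, OF _ _ _ blockP] xf by simp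
      then have "?v (?P ?y) = rbar ?E (?v (?P x)) s"
        using val_cong[OF bim(1)] val_op_at_singleton[OF E ops(2) Pf[OF xf]] by metis
      then have "ev (?v (?P ?y)) = the_endo (?v (?P x)) s"
        using ev_End(6)[OF conjunct1[OF g] s] by simp
      with 1 ev_eq[OF yf] show ?thesis by simp
    qed
    then have "?v (?L x) = ?v (?P x)"
      using f g by (intro End_eqI) auto
    then show ?thesis
      using val_eq_iff[OF bim(1) _ Lf[OF xf] Pf[OF xf]] by simp
  qed
  then have "rind [?E, ?E] [?E] ?phi = rind [?E, ?E] [?E] ?psi"
    by (intro rprod_induced_eqI resp bim) simp_all
  then show ?thesis
    using structure_map_eq[of "[]" "[]" "[?E]"] structure_map_eq[of "[?E]" "[]" "[]"] by simp
qed

lemma str_phi_assoc_parallel: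
  assumes bim: "bimods xs" "bimods ys" "bimods zs" "bimods ws" "bimods vs"
    and ne: "xs @ ys @ zs @ ws @ vs \<noteq> []"
    and a: "a \<in> tuples xs" and p: "p \<in> carrier (rprod R ys)" and b: "b \<in> tuples zs"
    and q: "q \<in> carrier (rprod R ws)" and c: "c \<in> tuples vs"
  shows "teq (xs @ ys @ zs @ ws @ vs)
    (lin (str_phi (xs @ ys @ zs) ws vs)
      (lin (str_phi xs ys (zs @ [rprod R ws] @ vs))
        (frag_of a * frag_of [p] * frag_of b * frag_of [q] * frag_of c)))
    (lin (str_phi xs ys (zs @ ws @ vs))
      (lin (str_phi (xs @ [rprod R ys] @ zs) ws vs)
        (frag_of a * frag_of [p] * frag_of b * frag_of [q] * frag_of c)))"
proof -
  let ?A = "frag_of a" and ?p = "frag_of [p]" and ?B = "frag_of b" and ?q = "frag_of [q]"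
    and ?C = "frag_of c"
  let ?Y = "rprod R ys" and ?W = "rprod R ws"
  let ?L1 = "lin (str_phi xs ys (zs @ [?W] @ vs))"
  let ?L2 = "lin (str_phi (xs @ ys @ zs) ws vs)"
  let ?P1 = "lin (str_phi (xs @ [?Y] @ zs) ws vs)"
  let ?P2 = "lin (str_phi xs ys (zs @ ws @ vs))"
  let ?u = "?A * ?p * ?B * ?q * ?C"
  have Y: "env_bimodule R ?Y" and W: "env_bimodule R ?W" using bim by (simp_all add: env_bimodule_rprod)
  have F: "?A \<in> frags xs" "?p \<in> frags [?Y]" "?B \<in> frags zs" "?q \<in> frags [?W]" "?C \<in> frags vs"
    using a p b q c by simp_all
  have u1: "?u = ?A * ?p * (?B * ?q * ?C)"
    by (simp add: mult.assoc)
  have BqC: "?B * ?q * ?C \<in> frags (zs @ [?W] @ vs)" and ApB: "?A * ?p * ?B \<in> frags (xs @ [?Y] @ zs)"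
    using frags_mult3 F by blast+
  consider (both) "ys \<noteq> []" "ws \<noteq> []" | (ws) "ys = []" "ws \<noteq> []" | (ys) "ys \<noteq> []" "ws = []"
    | (none) "ys = []" "ws = []" by blast
  then show ?thesis
  proof cases
    case both
    have r: "rep ys p \<in> frags ys" "rep ws q \<in> frags ws" using rep_frags bim both p q by auto
    have "?L1 ?u = ?A * rep ys p * (?B * ?q * ?C)"
      unfolding u1 by (rule str_phi_mult_assoc) (use bim both F BqC W p in auto)
    then have L1: "?L1 ?u = (?A * rep ys p * ?B) * ?q * ?C" by (simp add: mult.assoc)
    have 1: "?L2 (?L1 ?u) = (?A * rep ys p * ?B) * rep ws q * ?C"
      unfolding L1
      by (rule str_phi_mult_assoc[OF _ bim(4,5) both(2) frags_mult3[OF F(1) r(1) F(3)] q F(5)])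
        (simp add: bim)
    have "?P1 ?u = (?A * ?p * ?B) * rep ws q * ?C"
      by (rule str_phi_mult_assoc) (use bim both F ApB Y q in auto)
    then have P1: "?P1 ?u = ?A * ?p * (?B * rep ws q * ?C)" by (simp add: mult.assoc)
    have "?P2 (?P1 ?u) = ?A * rep ys p * (?B * rep ws q * ?C)"
      unfolding P1
      by (rule str_phi_mult_assoc[OF bim(1,2) _ both(1) F(1) p frags_mult3[OF F(3) r(2) F(5)]])
        (simp add: bim)
    with 1 show ?thesis by (simp add: mult.assoc)
  next
    case ws
    let ?e = "ev p"
    have e: "?e \<in> carrier R" using ev_End(1) p ws by simp
    have r: "rep ws q \<in> frags ws" using rep_frags bim ws q by auto
    have BrC: "?B * rep ws q * ?C \<in> frags (zs @ ws @ vs)" by (rule frags_mult3[OF F(3) r F(5)])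
    have L1: "?L1 ?u = ?A * op_at (zs @ [?W] @ vs) (Lact ?e) 0 (?B * ?q * ?C)"
      unfolding u1 unfolding ws(1) by (rule str_phi_mult_right) (use F BqC in auto)
    have "?P1 ?u = (?A * ?p * ?B) * rep ws q * ?C"
      by (rule str_phi_mult_assoc) (use bim ws F ApB Y q in auto)
    then have P1: "?P1 ?u = ?A * ?p * (?B * rep ws q * ?C)" by (simp add: mult.assoc)
    have P: "?P2 (?P1 ?u) = ?A * op_at (zs @ ws @ vs) (Lact ?e) 0 (?B * rep ws q * ?C)"
      unfolding P1 unfolding ws(1) by (rule str_phi_mult_right) (use ws F BrC in auto)
    show ?thesis
    proof (cases "zs = []")
      case False
      then have z: "0 < length zs" by simp
      let ?B' = "op_at zs (Lact ?e) 0 ?B"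
      have B': "?B' \<in> frags zs" by (rule op_at_closed[OF additive_actions(1)[OF e] bim(3) z F(3)])
      have L1': "?L1 ?u = (?A * ?B') * ?q * ?C"
        unfolding L1 op_at_left3[OF F(3,4,5) z] by (simp add: mult.assoc)
      have "?L2 (?L1 ?u) = (?A * ?B') * rep ws q * ?C"
        unfolding L1'
        by (rule str_phi_mult_assoc[OF _ bim(4,5) ws(2) _ q F(5)])
          (use bim ws(1) frags_mult[OF F(1) B'] in simp_all)
      then have "?L2 (?L1 ?u) = ?P2 (?P1 ?u)"
        unfolding P op_at_left3[OF F(3) r F(5) z] by (simp add: mult.assoc)
      then show ?thesis by simp
    next
      case True
      then have B: "?B = 1" using b by (simp add: frag_of_Nil)
      have lq: "lact ?W ?e q \<in> carrier ?W" using bimod_closed(1)[OF W e q] .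
      have L1': "?L1 ?u = ?A * frag_of [lact ?W ?e q] * ?C"
        unfolding L1 using True B op_at_left[OF F(4,5), of 0 "Lact ?e"]
        by (simp add: op_at_frag_of mult.assoc)
      have "?L2 (?L1 ?u) = ?A * rep ws (lact ?W ?e q) * ?C"
        unfolding L1' using str_phi_mult_assoc[OF bim(1,4,5) ws(2) F(1) lq F(5)] ws True by simp
      also have "teq (xs @ ws @ vs) \<dots> (?A * op_at ws (Lact ?e) 0 (rep ws q) * ?C)"
        by (intro teq_mult3 rep_actions(1)) (use bim F ws q e in auto)
      finally show ?thesis
        unfolding P using True B ws op_at_lact_mult[OF ws(2) r F(5)] by (simp add: mult.assoc)
    qed
  next
    case ys
    let ?f = "ev q"
    have f: "?f \<in> carrier R" using ev_End(1) q ys by simp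
    have r: "rep ys p \<in> frags ys" using rep_frags bim ys p by auto
    have ArB: "?A * rep ys p * ?B \<in> frags (xs @ ys @ zs)" by (rule frags_mult3[OF F(1) r F(3)])
    have "?L1 ?u = ?A * rep ys p * (?B * ?q * ?C)"
      unfolding u1 by (rule str_phi_mult_assoc) (use bim ys F BqC W p in auto)
    then have L1: "?L1 ?u = (?A * rep ys p * ?B) * ?q * ?C" by (simp add: mult.assoc)
    show ?thesis
    proof (cases "vs = []")
      case False
      then have v: "0 < length vs" by simp
      let ?C' = "op_at vs (Lact ?f) 0 ?C"
      have C': "?C' \<in> frags vs" by (rule op_at_closed[OF additive_actions(1)[OF f] bim(5) v F(5)])
      have "?L2 (?L1 ?u) = (?A * rep ys p * ?B) * ?C'"
        unfolding L1 unfolding ys(2) by (rule str_phi_mult_right) (use F False ArB in auto)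
      moreover have "?P1 ?u = (?A * ?p * ?B) * ?C'"
        unfolding ys(2) by (rule str_phi_mult_right) (use F False ApB in auto)
      then have "?P1 ?u = ?A * ?p * (?B * ?C')" by (simp add: mult.assoc)
      moreover have "?P2 (?A * ?p * (?B * ?C')) = ?A * rep ys p * (?B * ?C')"
        by (rule str_phi_mult_assoc[OF bim(1,2) _ ys(1) F(1) p])
          (use bim ys(2) frags_mult[OF F(3) C'] in simp_all)
      ultimately show ?thesis by (simp add: mult.assoc)
    next
      case True
      then have C: "?C = 1" using c by (simp add: frag_of_Nil)
      have "?L2 ((?A * rep ys p * ?B) * ?q) =
          op_at (xs @ ys @ zs) (Lbar ?f) (length (xs @ ys @ zs) - 1) (?A * rep ys p * ?B)"
        unfolding ys(2) True by (rule str_phi_mult_left) (use ys ArB in auto)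
      then have L: "?L2 (?L1 ?u) =
          op_at (xs @ ys @ zs) (Lbar ?f) (length (xs @ ys @ zs) - 1) (?A * rep ys p * ?B)"
        unfolding L1 unfolding C by simp
      have "?P1 ((?A * ?p * ?B) * ?q) =
          op_at (xs @ [?Y] @ zs) (Lbar ?f) (length (xs @ [?Y] @ zs) - 1) (?A * ?p * ?B)"
        unfolding ys(2) True by (rule str_phi_mult_left) (use ApB in auto)
      then have P1: "?P1 ?u =
          op_at (xs @ [?Y] @ zs) (Lbar ?f) (length (xs @ [?Y] @ zs) - 1) (?A * ?p * ?B)"
        unfolding C by simp
      show ?thesis
      proof (cases "zs = []")
        case z: False
        let ?B' = "op_at zs (Lbar ?f) (length zs - 1) ?B"
        have B': "?B' \<in> frags zs"
          by (rule op_at_closed[OF additive_actions(2)[OF f] bim(3) _ F(3)]) (use z in auto)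
        have "?L2 (?L1 ?u) = ?A * rep ys p * ?B'"
          unfolding L using op_at_last_mult[OF z frags_mult[OF F(1) r] F(3)] by simp
        moreover have "?P1 ?u = ?A * ?p * ?B'"
          unfolding P1 using op_at_last_mult[OF z frags_mult[OF F(1,2)] F(3)] by simp
        moreover have "?P2 (?A * ?p * ?B') = ?A * rep ys p * ?B'"
          by (rule str_phi_mult_assoc[OF bim(1,2) _ ys(1) F(1) p])
            (use bim ys(2) True B' in simp_all)
        ultimately show ?thesis by simp
      next
        case z: True
        then have B: "?B = 1" using b by (simp add: frag_of_Nil)
        have lp: "lbar ?Y ?f p \<in> carrier ?Y" using bimod_closed(2)[OF Y f p] .
        have L': "?L2 (?L1 ?u) = ?A * op_at ys (Lbar ?f) (length ys - 1) (rep ys p)"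
          unfolding L using op_at_last_mult[OF ys(1) F(1) r] z B by simp
        have "?P1 ?u = ?A * frag_of [lbar ?Y ?f p]"
          unfolding P1 using op_at_last_mult[OF _ F(1,2)] z B by (simp add: op_at_frag_of)
        then have P': "?P2 (?P1 ?u) = ?A * rep ys (lbar ?Y ?f p)"
          using str_phi_mult_assoc[OF bim(1,2) _ ys(1) F(1) lp, of "[]" "frag_of []"] z True ys
          by (simp add: frag_of_Nil one_in_frags)
        have "teq (xs @ ys) (?A * op_at ys (Lbar ?f) (length ys - 1) (rep ys p))
            (?A * rep ys (lbar ?Y ?f p))"
          by (intro teq_mult_left teq_sym[OF rep_actions(2)]) (use bim F ys p f in auto)
        then show ?thesis unfolding L' P' using z True ys by simp
      qed
    qed
  next
    case none
    let ?E = "End_bimod R :: ('r, ('a, 'r) elt) bimod"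
    let ?e = "ev p" and ?f = "ev q"
    have pq: "p \<in> carrier ?E" "q \<in> carrier ?E" using p q none by simp_all
    have YW: "?Y = ?E" "?W = ?E" using none by simp_all
    have ef: "?e \<in> carrier R" "?f \<in> carrier R" using pq ev_End(1) by auto
    have L1: "?L1 ?u = ?A * op_at (zs @ [?E] @ vs) (Lact ?e) 0 (?B * ?q * ?C)"
      unfolding u1 YW unfolding none(1)
      by (rule str_phi_mult_right) (use F BqC in \<open>auto simp: none\<close>)
    show ?thesis
    proof (cases "zs = []")
      case False
      then have z: "0 < length zs" "length zs - 1 < length zs" by auto
      let ?B' = "op_at zs (Lact ?e) 0 ?B"
      have B': "?B' \<in> frags zs"
        by (rule op_at_closed[OF additive_actions(1)[OF ef(1)] bim(3) z(1) F(3)])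
      have L1': "?L1 ?u = (?A * ?B') * ?q * ?C"
        unfolding L1 op_at_left3[OF F(3) F(4)[unfolded YW] F(5) z(1)] by (simp add: mult.assoc)
      show ?thesis
      proof (cases "vs = []")
        case v: False
        then have v0: "0 < length vs" by simp
        let ?C' = "op_at vs (Lact ?f) 0 ?C"
        have C': "?C' \<in> frags vs"
          by (rule op_at_closed[OF additive_actions(1)[OF ef(2)] bim(5) v0 F(5)])
        have "?L2 (?L1 ?u) = (?A * ?B') * ?C'"
          unfolding L1' unfolding none using str_phi_mult_right[OF v _ F(5), of "?A * ?B'" "xs @ zs" q]
          by (simp add: frags_mult[OF F(1) B'])
        moreover have "?P1 ?u = (?A * ?p * ?B) * ?C'"
          unfolding none using str_phi_mult_right[OF v ApB[unfolded none] F(5)] by simp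
        then have "?P1 ?u = ?A * ?p * (?B * ?C')" by (simp add: mult.assoc)
        moreover have "?P2 (?A * ?p * (?B * ?C')) = ?A * op_at (zs @ vs) (Lact ?e) 0 (?B * ?C')"
          unfolding none using str_phi_mult_right[OF _ F(1) frags_mult[OF F(3) C']] False by simp
        ultimately show ?thesis
          using op_at_lact_mult[OF False F(3) C'] by (simp add: mult.assoc)
      next
        case True
        then have C: "?C = 1" using c by (simp add: frag_of_Nil)
        let ?B'' = "op_at zs (Lbar ?f) (length zs - 1) ?B"
        have B'': "?B'' \<in> frags zs"
          by (rule op_at_closed[OF additive_actions(2)[OF ef(2)] bim(3) z(2) F(3)])
        have "?L2 (?L1 ?u) = op_at (xs @ zs) (Lbar ?f) (length (xs @ zs) - 1) (?A * ?B')"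
          unfolding L1' unfolding C none True
          using str_phi_mult_left[OF _ frags_mult[OF F(1) B'], of q] False by simp
        then have L: "?L2 (?L1 ?u) = ?A * op_at zs (Lbar ?f) (length zs - 1) ?B'"
          using op_at_last_mult[OF False F(1) B'] by simp
        have "?P1 ?u = op_at (xs @ [?E] @ zs) (Lbar ?f) (length (xs @ [?E] @ zs) - 1) (?A * ?p * ?B)"
          unfolding C none True
          using str_phi_mult_left[OF _ ApB[unfolded none], of q] by simp
        then have P1: "?P1 ?u = ?A * ?p * ?B''"
          using op_at_last_mult[OF False frags_mult[OF F(1,2)] F(3)] none by simp
        have "?P2 (?A * ?p * ?B'') = ?A * op_at zs (Lact ?e) 0 ?B''"
          unfolding none True using str_phi_mult_right[OF _ F(1) B''] False by simp
        moreover have "op_at zs (Lbar ?f) (length zs - 1) ?B' = op_at zs (Lact ?e) 0 ?B''"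
          by (rule op_at_commute'[OF F(3) bim(3) z(2)])
            (rule commutes_sym[OF commutes_actions(1)[OF ef]])
        ultimately show ?thesis unfolding L P1 by simp
      qed
    next
      case True
      then have B: "?B = 1" using b by (simp add: frag_of_Nil)
      have lq: "lact ?E ?e q \<in> carrier ?E" using bimod_closed(1)[OF env_bimodule_End ef(1) pq(2)] .
      have L1': "?L1 ?u = ?A * frag_of [lact ?E ?e q] * ?C"
        unfolding L1 using True B op_at_left[OF F(4)[unfolded YW] F(5), of 0 "Lact ?e"]
        by (simp add: op_at_frag_of mult.assoc)
      have ev_lq: "ev (lact ?E ?e q) = ?e \<otimes>\<^bsub>R\<^esub> ?f" using ev_End(3)[OF pq(2) ef(1)] .
      have Ap: "?A * ?p \<in> frags (xs @ [?E])" using ApB True B none frags_mult[OF F(1,2)] by simp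
      show ?thesis
      proof (cases "vs = []")
        case v: False
        then have v0: "0 < length vs" by simp
        let ?C' = "op_at vs (Lact ?f) 0 ?C"
        have C': "?C' \<in> frags vs"
          by (rule op_at_closed[OF additive_actions(1)[OF ef(2)] bim(5) v0 F(5)])
        have "?L2 (?L1 ?u) = ?A * op_at vs (Lact (?e \<otimes>\<^bsub>R\<^esub> ?f)) 0 ?C"
          unfolding L1' unfolding none True
          using str_phi_mult_right[OF v F(1,5), of "lact ?E ?e q"] ev_lq by simp
        moreover have "?P1 ?u = ?A * ?p * ?C'"
          unfolding none True B using str_phi_mult_right[OF v Ap F(5)] by simp
        moreover have "?P2 (?A * ?p * ?C') = ?A * op_at vs (Lact ?e) 0 ?C'"
          unfolding none True using str_phi_mult_right[OF v F(1) C'] by simp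
        moreover have "op_at vs (Lact (?e \<otimes>\<^bsub>R\<^esub> ?f)) 0 ?C = op_at vs (Lact ?e) 0 ?C'"
          unfolding op_at_op_at[OF F(5) v0]
          by (rule op_at_cong[OF F(5) _ v0]) (rule bimod_laws(1)[OF bimods_nth[OF bim(5) v0] ef])
        ultimately show ?thesis by simp
      next
        case v: True
        then have C: "?C = 1" using c by (simp add: frag_of_Nil)
        have xs: "xs \<noteq> []" using ne none True v by simp
        have lp: "lbar ?E ?f p \<in> carrier ?E" using bimod_closed(2)[OF env_bimodule_End ef(2) pq(1)] .
        have "?L2 (?L1 ?u) = op_at xs (Lbar (?e \<otimes>\<^bsub>R\<^esub> ?f)) (length xs - 1) ?A"
          unfolding L1' unfolding C none True v
          using str_phi_mult_left[OF xs F(1), of "lact ?E ?e q"] ev_lq by simp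
        moreover have "?P1 ?u = op_at (xs @ [?E]) (Lbar ?f) (length (xs @ [?E]) - 1) (?A * ?p)"
          unfolding C B none True v using str_phi_mult_left[OF _ Ap, of q] by simp
        then have "?P1 ?u = ?A * frag_of [lbar ?E ?f p]"
          using op_at_last_mult[OF _ F(1) F(2)[unfolded YW], of "Lbar ?f"] by (simp add: op_at_frag_of)
        moreover have "?P2 (?A * frag_of [lbar ?E ?f p]) =
            op_at xs (Lbar (?e \<otimes>\<^bsub>R\<^esub> ?f)) (length xs - 1) ?A"
          unfolding none True v
          using str_phi_mult_left[OF xs F(1), of "lbar ?E ?f p"] ev_End(4)[OF pq(1) ef(2)] by simp
        ultimately show ?thesis by simp
      qed
    qed
  qed
qed

lemma structure_map_assoc_parallel:
  assumes bim: "bimods (xs @ ys @ zs @ ws @ vs)"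
  shows "bcomp (smap (xs @ ys @ zs) ws vs)
      (smap xs ys (zs @ [rprod R ws] @ vs)) =
    bcomp (smap xs ys (zs @ ws @ vs))
      (smap (xs @ [rprod R ys] @ zs) ws vs)"
proof (cases "xs @ ys @ zs @ ws @ vs = []")
  case True
  then show ?thesis by (simp add: unitors_End_eq)
next
  case False
  have bims: "bimods xs" "bimods ys" "bimods zs" "bimods ws" "bimods vs" using bim by auto
  let ?Y = "rprod R ys" and ?W = "rprod R ws"
  have YW: "env_bimodule R ?Y" "env_bimodule R ?W" using bims by (simp_all add: env_bimodule_rprod)
  let ?Ms = "xs @ [?Y] @ zs @ [?W] @ vs" and ?Os = "xs @ ys @ zs @ ws @ vs"
  let ?Ns = "xs @ ys @ zs @ [?W] @ vs" and ?Ns' = "xs @ [?Y] @ zs @ ws @ vs"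
  have tm1: "tensor_map ?Ms ?Ns (str_phi xs ys (zs @ [?W] @ vs))"
    by (rule tensor_map_structure_phi) (use bims YW in auto)
  have tm2: "tensor_map ?Ns ?Os (str_phi (xs @ ys @ zs) ws vs)"
    using tensor_map_structure_phi[of "xs @ ys @ zs" ws vs] bims False by auto
  have tm3: "tensor_map ?Ms ?Ns' (str_phi (xs @ [?Y] @ zs) ws vs)"
    using tensor_map_structure_phi[of "xs @ [?Y] @ zs" ws vs] bims YW by auto
  have tm4: "tensor_map ?Ns' ?Os (str_phi xs ys (zs @ ws @ vs))"
    by (rule tensor_map_structure_phi) (use bims False in auto)
  have eq1: "smap xs ys (zs @ [?W] @ vs) =
      rind ?Ms ?Ns (str_phi xs ys (zs @ [?W] @ vs))"
    by (rule structure_map_eq) auto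
  have eq2: "smap (xs @ ys @ zs) ws vs =
      rind ?Ns ?Os (str_phi (xs @ ys @ zs) ws vs)"
    using structure_map_eq[of "xs @ ys @ zs" ws vs] False by auto
  have eq3: "smap (xs @ [?Y] @ zs) ws vs =
      rind ?Ms ?Ns' (str_phi (xs @ [?Y] @ zs) ws vs)"
    using structure_map_eq[of "xs @ [?Y] @ zs" ws vs] by auto
  have eq4: "smap xs ys (zs @ ws @ vs) =
      rind ?Ns' ?Os (str_phi xs ys (zs @ ws @ vs))"
    by (rule structure_map_eq) (use False in auto)
  show ?thesis
    unfolding eq1 eq2 eq3 eq4
  proof (rule rprod_induced_comp_eqI[OF tm1 tm2 tm3 tm4])
    fix t assume "t \<in> tuples ?Ms"
    then obtain a p b q c where t: "a \<in> tuples xs" "p \<in> carrier ?Y" "b \<in> tuples zs"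
      "q \<in> carrier ?W" "c \<in> tuples vs" "t = a @ [p] @ b @ [q] @ c"
      by (fastforce simp: tuples_append)
    have "frag_of t = frag_of a * frag_of [p] * frag_of b * frag_of [q] * frag_of c"
      unfolding t(6) by (simp only: frag_of_append mult.assoc)
    then show "teq ?Os
        (lin (str_phi (xs @ ys @ zs) ws vs) (str_phi xs ys (zs @ [?W] @ vs) t))
        (lin (str_phi xs ys (zs @ ws @ vs)) (str_phi (xs @ [?Y] @ zs) ws vs t))"
      using str_phi_assoc_parallel[OF bims False t(1-5)] by (metis frag_extend_of)
  qed (use bims YW in auto)
qed

lemma bimods_iff: "set Ms \<subseteq> Obj (bimod_category R) \<longleftrightarrow> bimods Ms"
  by (auto simp: bimods_def)

lemma strictly_normal_rprod:
  "strictly_normal_lax_monoidal_category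
    (bimod_category R :: (('r, ('a, 'r) elt) bimod, ('r, ('a, 'r) elt) bimod_mor) category)
    (rprod R) (rprod_mor R) (smap) ident"
proof -
  let ?C = "bimod_category R :: (('r, ('a, 'r) elt) bimod, ('r, ('a, 'r) elt) bimod_mor) category"
  interpret C: category ?C by (rule category_bimod_category)
  have hom: "F \<in> Mor ?C \<Longrightarrow> F \<in> Hom ?C (src F) (tgt F)" for F
    by (simp add: Hom_def)
  show ?thesis
  proof (intro strictly_normal_lax_monoidal_category.intro lax_monoidal_category.intro
      lax_monoidal_category_axioms.intro strictly_normal_lax_monoidal_category_axioms.intro)
    show "category ?C" by (rule category_bimod_category)
    show "category_functor (power_category ?C n) ?C (rprod R) (rprod_mor R)" for n
      by (rule functor_rprod)
  next
    fix xs ys zs ws vs :: "('r, ('a, 'r) elt) bimod list"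
    assume "set (xs @ ys @ zs @ ws @ vs) \<subseteq> Obj ?C"
    then have bim: "bimods (xs @ ys @ zs @ ws @ vs)" unfolding bimods_iff .
    show "Comp ?C (smap (xs @ ys @ zs) ws vs) (smap xs ys (zs @ [rprod R ws] @ vs)) =
        Comp ?C (smap xs ys (zs @ ws @ vs)) (smap (xs @ [rprod R ys] @ zs) ws vs)"
      by (rule structure_map_assoc_parallel[OF bim])
    show "Comp ?C (smap (xs @ ys) zs (ws @ vs)) (smap xs (ys @ [rprod R zs] @ ws) vs) =
        Comp ?C (smap xs (ys @ zs @ ws) vs)
          (rprod_mor R (map (Ident ?C) xs @ [smap ys zs ws] @ map (Ident ?C) vs))"
      by (rule structure_map_assoc_nested[OF bim])
  next
    fix xs ys zs :: "('r, ('a, 'r) elt) bimod list"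
    assume "set (xs @ ys @ zs) \<subseteq> Obj ?C"
    then show "smap xs ys zs \<in> Hom ?C (rprod R (xs @ [rprod R ys] @ zs)) (rprod R (xs @ ys @ zs))"
      unfolding bimods_iff by (rule structure_map_hom)
  next
    fix fs gs hs :: "('r, ('a, 'r) elt) bimod_mor list"
    assume "mors (fs @ gs @ hs)"
    then show "Comp ?C (smap (map (Cod ?C) fs) (map (Cod ?C) gs) (map (Cod ?C) hs))
        (rprod_mor R (fs @ [rprod_mor R gs] @ hs)) =
      Comp ?C (rprod_mor R (fs @ gs @ hs))
        (smap (map (Dom ?C) fs) (map (Dom ?C) gs) (map (Dom ?C) hs))"
      unfolding Dom_Cod_bimod_category by (rule structure_map_natural)
  next
    fix xs :: "('r, ('a, 'r) elt) bimod list" assume "set xs \<subseteq> Obj ?C"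
    then have bim: "bimods xs" unfolding bimods_iff .
    then show *: "smap [] xs [] = Ident ?C (rprod R xs)"
      by (rule structure_map_outer_Ident)
    show "Comp ?C (smap [] xs []) (Ident ?C (rprod R xs)) = Ident ?C (rprod R xs)"
      unfolding * by (rule C.comp_ident_left[OF Ident_hom[OF env_bimodule_rprod[OF bim]]])
  next
    fix xs zs :: "('r, ('a, 'r) elt) bimod list" and y
    assume "set (xs @ [y] @ zs) \<subseteq> Obj ?C"
    then have bim: "bimods (xs @ [y] @ zs)" unfolding bimods_iff .
    then show *: "smap xs [y] zs = Ident ?C (rprod R (xs @ [y] @ zs))"
      by (rule structure_map_inner_Ident)
    have "rprod_mor R (map (Ident ?C) xs @ [Ident ?C y] @ map (Ident ?C) zs) =
        Ident ?C (rprod R (xs @ [y] @ zs))"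
      using rprod_mor_Ident[OF bim] by simp
    then show "Comp ?C (smap xs [y] zs)
        (rprod_mor R (map (Ident ?C) xs @ [Ident ?C y] @ map (Ident ?C) zs)) =
      Ident ?C (rprod R (xs @ [y] @ zs))"
      unfolding * using C.comp_ident_left[OF Ident_hom[OF env_bimodule_rprod[OF bim]]] by simp
  next
    fix M :: "('r, ('a, 'r) elt) bimod" assume M: "M \<in> Obj ?C"
    then show "Ident ?C M \<in> Hom ?C M (rprod R [M])" by (simp add: Ident_hom)
    show "rprod R [M] = M" by simp
    show "Ident ?C M = Ident ?C M" by simp
  next
    fix F assume F: "F \<in> Mor ?C"
    then show *: "rprod_mor R [F] = F" by (rule rprod_mor_singleton)
    show "Comp ?C (Ident ?C (Cod ?C F)) F = Comp ?C (rprod_mor R [F]) (Ident ?C (Dom ?C F))"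
      unfolding * Dom_Cod_bimod_category
      using C.comp_ident_left[OF hom[OF F]] C.comp_ident_right[OF hom[OF F]] by simp
  qed
qed

end

theorem mainTheorem6:
  fixes R :: "('r, 'k) ring_scheme"
  assumes "ring R"
  shows "strictly_normal_lax_monoidal_category
    (bimod_category R :: (('r, ('a, 'r) elt) bimod, ('r, ('a, 'r) elt) bimod_mor) category)
    (rprod R) (rprod_mor R) (structure_map R) (Ident (bimod_category R))"
  by (rule ground_ring.strictly_normal_rprod[OF ground_ring.intro[OF assms]])

end
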